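(* If $\mathcal{C}$ is a properly-splitted hypergraph, then $\psi(\mathcal{C})=\operatorname{conn}(\operatorname{Ind}(\mathcal{C}))+2$.
   Context: A hypergraph $\mathcal{C}$ on a finite vertex set $V$ is a family of pairwise incomparable subsets of $V$ (its edges), each of cardinality at least $2$; vertices lying in no edge are allowed. The independence complex $\operatorname{Ind}(\mathcal{C})$ is the simplicial complex on $V$ whose faces are the subsets of $V$ containing no edge of $\mathcal{C}$ (if $V=\emptyset$ it is $\{\emptyset\}$). For an edge $F$: $\mathcal{C}-F$ is the hypergraph on $V$ with edge set $\mathcal{C}\setminus\{F\}$; $N_{\mathcal{C}}(F)=\bigcup\{E\setminus F : E\in\mathcal{C},\ |E\setminus F|=1\}$; and $\mathcal{C}:F$ is the hypergraph on $V\setminus(F\cup N_{\mathcal{C}}(F))$ whose edges are the members of cardinality at least $2$ among the inclusion-minimal members of the family $\{E\setminus F : E\in \mathcal{C}-F\}$. The number $\psi(\mathcal{C})\in\mathbb{Z}_{\ge 0}\cup\{\infty\}$ is defined recursively: $\psi(\mathcal{C})=0$ if $V=\emptyset$; $\psi(\mathcal{C})=\infty$ if $V\neq\emptyset$ and $\mathcal{C}$ has no edges; otherwise $\psi(\mathcal{C})=\max_{F\in\mathcal{C}}\min\{\psi(\mathcal{C}-F),\ \psi(\mathcal{C}:F)+|F|-1\}$. The homotopical connectivity $\operatorname{conn}(\Delta)$ is the largest integer $k\ge -1$ such that $\Delta$ is nonempty and $\pi_i(\Delta)=0$ for all $0\le i\le k$ ($\infty$ if all vanish; $\operatorname{conn}(\{\emptyset\})=-2$).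 The homological connectivity $\operatorname{conn_h}(\Delta)$ is the largest integer $k$ such that $\tilde H_i(\Delta;\mathbb{Z})=0$ for all $i\le k$ ($\infty$ if all vanish; $\operatorname{conn_h}(\{\emptyset\})=-2$). A hypergraph $\mathcal{C}$ is properly-splitted (recursively on the number of edges) if either $\mathcal{C}$ has no edges, or $\mathcal{C}$ has an edge $F$ with $\operatorname{conn_h}(\operatorname{Ind}(\mathcal{C}:F))\ge \operatorname{conn_h}(\operatorname{Ind}(\mathcal{C}))-|F|+1$ such that both $\mathcal{C}-F$ and $\mathcal{C}:F$ are properly-splitted. *)

theory Defs
  imports "HOL-Analysis.Analysis" "HOL-Homology.Homology"
begin

definition hypergraph :: "'a set \<Rightarrow> 'a set set \<Rightarrow> bool" where
  "hypergraph V E \<longleftrightarrow> finite V \<and> (\<forall>e\<in>E. e \<subseteq> V \<and> 2 \<le> card e) \<and>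
     (\<forall>e1\<in>E. \<forall>e2\<in>E. e1 \<subseteq> e2 \<longrightarrow> e1 = e2)"

definition Ind :: "'a set \<Rightarrow> 'a set set \<Rightarrow> 'a set set" where
  "Ind V E = {S. S \<subseteq> V \<and> (\<forall>e\<in>E. \<not> e \<subseteq> S)}"

definition nbhd :: "'a set set \<Rightarrow> 'a set \<Rightarrow> 'a set" where
  "nbhd E F = \<Union>{e - F | e. e \<in> E \<and> card (e - F) = 1}"

definition colon_V :: "'a set \<Rightarrow> 'a set set \<Rightarrow> 'a set \<Rightarrow> 'a set" where
  "colon_V V E F = V - (F \<union> nbhd E F)"

definition colon_E :: "'a set set \<Rightarrow> 'a set \<Rightarrow> 'a set set" where
  "colon_E E F = (let M = (\<lambda>e. e - F) ` (E - {F}) in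
     {S. S \<in> M \<and> (\<forall>T\<in>M. T \<subseteq> S \<longrightarrow> T = S) \<and> 2 \<le> card S})"

text \<open>psi, defined by the recursion of the paper; the recursion decreases the
  number of edges, so we use a fuel argument which is always sufficient
  (card E + 1).\<close>
fun psi_fuel :: "nat \<Rightarrow> 'a set \<Rightarrow> 'a set set \<Rightarrow> ereal" where
  "psi_fuel 0 V E = 0"
| "psi_fuel (Suc n) V E =
     (if V = {} then 0
      else if E = {} then \<infinity>
      else Max ((\<lambda>F. min (psi_fuel n V (E - {F}))
                          (psi_fuel n (colon_V V E F) (colon_E E F) + ereal (real (card F)) - 1)) ` E))"

definition psi :: "'a set \<Rightarrow> 'a set set \<Rightarrow> ereal" where
  "psi V E = psi_fuel (Suc (card E)) V E"

definition realization :: "'a set \<Rightarrow> 'a set set \<Rightarrow> ('a \<Rightarrow> real) set" where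
  "realization V K = {f. (\<forall>v. 0 \<le> f v) \<and> (\<forall>v. v \<notin> V \<longrightarrow> f v = 0) \<and>
                         (\<Sum>v\<in>V. f v) = 1 \<and> {v. f v \<noteq> 0} \<in> K}"

definition geom :: "'a set \<Rightarrow> 'a set set \<Rightarrow> ('a \<Rightarrow> real) topology" where
  "geom V K = subtopology (powertop_real UNIV) (realization V K)"

text \<open>Homotopical connectivity: pi_i(X) = 0 for all basepoints is expressed as
  "every continuous map from the i-sphere into X is homotopic to a constant map"
  (for i = 0: X path-connected).  Empty space gives -2.\<close>
definition conn :: "'b topology \<Rightarrow> ereal" where
  "conn X = (if topspace X = {} then -2
     else Sup {ereal (real_of_int k) | k. -1 \<le> k \<and>
        (\<forall>i::nat. int i \<le> k \<longrightarrow>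
           (\<forall>f. continuous_map (nsphere i) X f \<longrightarrow>
                (\<exists>c. homotopic_with (\<lambda>_. True) (nsphere i) X f (\<lambda>_. c))))})"

definition conn_h :: "'b topology \<Rightarrow> ereal" where
  "conn_h X = (if topspace X = {} then -2
     else Sup {ereal (real_of_int k) | k.
        \<forall>i::int. i \<le> k \<longrightarrow> trivial_group (reduced_homology_group i X)})"

inductive properly_splitted :: "'a set \<Rightarrow> 'a set set \<Rightarrow> bool" where
  ps_empty: "properly_splitted V {}"
| ps_split: "\<lbrakk> F \<in> E;
     conn_h (geom (colon_V V E F) (Ind (colon_V V E F) (colon_E E F)))
        \<ge> conn_h (geom V (Ind V E)) - ereal (real (card F)) + 1;
     properly_splitted V (E - {F});
     properly_splitted (colon_V V E F) (colon_E E F) \<rbrakk>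
   \<Longrightarrow> properly_splitted V E"

end

theory Submission
  imports Defs
begin

text \<open>
  Adding the faces that contain an edge \<open>F\<close> turns \<open>Ind(C)\<close> into \<open>Ind(C - F)\<close>; up to homotopy
  this attaches a cone over the join \<open>N\<close> of \<open>\<partial>F\<close> with \<open>Ind(C : F)\<close>, and \<open>N\<close> is \<open>|F| - 1\<close> degrees
  more connected than \<open>Ind(C : F)\<close>. If \<open>Ind(C - F)\<close> and \<open>N\<close> are \<open>k\<close>-connected, so is \<open>Ind(C)\<close>,
  because discs in \<open>Ind(C - F)\<close> can be pushed off the cone point; by the recursion, \<open>\<psi>\<close> is at most
  \<open>conn + 2\<close> for every hypergraph. Conversely, if \<open>Ind(C)\<close> and \<open>N\<close> are homologically
  \<open>k\<close>-connected, then by excision so is \<open>Ind(C - F)\<close>; the splitting condition supplies this for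
  \<open>N\<close>, so \<open>\<psi>\<close> is at least \<open>conn\<^sub>h + 2\<close>. Finally \<open>conn\<close> is at most \<open>conn\<^sub>h\<close> by the easy half of the
  Hurewicz theorem: the inclusion of a low-dimensional skeleton is nullhomotopic but surjective
  on homology. Maps of spheres are treated as maps on boundaries of cubes, which are subdivided
  into small cubes and modified cell by cell.
\<close>

text \<open>The comparison is made on thresholds: \<open>cconn m\<close>, \<open>hconn m\<close> and
  \<open>m \<le> psi\<close> for natural numbers \<open>m\<close>. This turns the max-min recursion
  into an existential conjunction. For a properly-splitted hypergraph the three thresholds imply one
  another in a circle: homotopy bounds homology, homology bounds \<open>psi\<close> through the
  splitting condition, and \<open>psi\<close> bounds homotopy. Hence neither a converse of the
  Hurewicz theorem nor a fundamental group enters.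

  Homotopy groups appear only as an extension property for cubes. It has no base points and lets a
  map be corrected one cell at a time. All the topology uses one open cover of a complex with a face
  \<open>F\<close>: the complement of the barycentre of \<open>F\<close>, which retracts to the
  subcomplex of faces not containing \<open>F\<close>, and the open star of \<open>F\<close>, which
  is contractible. Openness supplies both the Lebesgue number for fine subdivisions and the
  hypothesis of excision.\<close>

section \<open>Finite maxima and minima of continuous functions\<close>

lemma continuous_on_Max_family:
  fixes f :: "'i \<Rightarrow> 'x::topological_space \<Rightarrow> real"
  assumes "finite I" "I \<noteq> {}" "\<And>i. i \<in> I \<Longrightarrow> continuous_on S (f i)"
  shows "continuous_on S (\<lambda>x. Max ((\<lambda>i. f i x) ` I))"
  using assms
proof (induction I rule: finite_ne_induct)
  case (insert i I)
  then have "continuous_on S (\<lambda>x. max (f i x) (Max ((\<lambda>i. f i x) ` I)))"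
    by (intro continuous_on_max) auto
  then show ?case using insert.hyps by (simp add: Max_insert)
qed auto

lemma continuous_on_Min_family:
  fixes f :: "'i \<Rightarrow> 'x::topological_space \<Rightarrow> real"
  assumes "finite I" "I \<noteq> {}" "\<And>i. i \<in> I \<Longrightarrow> continuous_on S (f i)"
  shows "continuous_on S (\<lambda>x. Min ((\<lambda>i. f i x) ` I))"
  using assms
proof (induction I rule: finite_ne_induct)
  case (insert i I)
  then have "continuous_on S (\<lambda>x. min (f i x) (Min ((\<lambda>i. f i x) ` I)))"
    by (intro continuous_on_min) auto
  then show ?case using insert.hyps by (simp add: Min_insert)
qed auto

lemma continuous_on_coordinate [continuous_intros, simp]:
  "continuous_on S (\<lambda>x::'i \<Rightarrow> 'y::topological_space. x i)"
  by (rule continuous_on_subset[OF continuous_on_product_coordinates]) simp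

lemma continuous_on_comp:
  "\<lbrakk>continuous_on T g; continuous_on S f; \<And>x. x \<in> S \<Longrightarrow> f x \<in> T\<rbrakk> \<Longrightarrow> continuous_on S (g \<circ> f)"
  by (rule continuous_on_compose) (auto elim!: continuous_on_subset)

lemma continuous_on_If_const:
  "\<lbrakk>P \<Longrightarrow> continuous_on T f; \<not> P \<Longrightarrow> continuous_on T g\<rbrakk> \<Longrightarrow>
    continuous_on T (\<lambda>x. if P then f x else g x)"
  by (cases P) auto

section \<open>Cubical cells\<close>

text \<open>Encoded by the lowest lattice corner \<open>a\<close> and the set \<open>S\<close> of
  free directions, so \<open>card S\<close> is the dimension. Cells of all dimensions live in one
  function space.\<close>

definition cell :: "('i \<Rightarrow> int) \<Rightarrow> 'i set \<Rightarrow> ('i \<Rightarrow> real) set" where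
  "cell a S = {x. (\<forall>i\<in>S. of_int (a i) \<le> x i \<and> x i \<le> of_int (a i) + 1) \<and>
                  (\<forall>i. i \<notin> S \<longrightarrow> x i = of_int (a i))}"

definition cell_bd :: "('i \<Rightarrow> int) \<Rightarrow> 'i set \<Rightarrow> ('i \<Rightarrow> real) set" where
  "cell_bd a S = {x \<in> cell a S. \<exists>i\<in>S. x i = of_int (a i) \<or> x i = of_int (a i) + 1}"

definition face :: "('i \<Rightarrow> int) \<times> 'i set \<Rightarrow> ('i \<Rightarrow> int) \<times> 'i set \<Rightarrow> bool" where
  "face = (\<lambda>(b, T) (a, S). T \<subseteq> S \<and> (\<forall>i. i \<notin> S \<or> i \<in> T \<longrightarrow> b i = a i) \<and>
                           (\<forall>i\<in>S - T. b i = a i \<or> b i = a i + 1))"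

abbreviation cl :: "('i \<Rightarrow> int) \<times> 'i set \<Rightarrow> ('i \<Rightarrow> real) set" where
  "cl \<sigma> \<equiv> cell (fst \<sigma>) (snd \<sigma>)"

abbreviation unit_cube :: "nat \<Rightarrow> (nat \<Rightarrow> real) set" where
  "unit_cube d \<equiv> cell (\<lambda>_. 0) {..<d}"

abbreviation unit_cube_bd :: "nat \<Rightarrow> (nat \<Rightarrow> real) set" where
  "unit_cube_bd d \<equiv> cell_bd (\<lambda>_. 0) {..<d}"

text \<open>Fillings keep the boundary values, so fillings of neighbouring cells agree
  automatically. \<open>cube_ext_Suc\<close> gives the translation to spheres.\<close>

definition cube_ext :: "nat \<Rightarrow> 'b::topological_space set \<Rightarrow> bool" where
  "cube_ext d Y \<longleftrightarrow> (\<forall>f. continuous_on (unit_cube_bd d) f \<and> f ` unit_cube_bd d \<subseteq> Y \<longrightarrow>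
     (\<exists>g. continuous_on (unit_cube d) g \<and> g ` unit_cube d \<subseteq> Y \<and> (\<forall>x\<in>unit_cube_bd d. g x = f x)))"

lemma cell_bd_subset: "cell_bd a S \<subseteq> cell a S"
  by (auto simp: cell_bd_def)

lemma closed_cell: "closed (cell a S)"
proof -
  have eq: "cell a S = (\<Inter>i. {x. x i \<in> (if i \<in> S then {of_int (a i)..of_int (a i) + 1} else {of_int (a i)})})"
    by (auto simp: cell_def split: if_splits)
  show ?thesis
    unfolding eq
  proof (intro closed_INT ballI)
    fix i
    let ?I = "if i \<in> S then {real_of_int (a i)..of_int (a i) + 1} else {of_int (a i)}"
    have "closed ((\<lambda>x::'a \<Rightarrow> real. x i) -` ?I)"
      by (rule closed_vimage) (auto)
    then show "closed {x::'a \<Rightarrow> real. x i \<in> ?I}" by (simp add: vimage_def)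
  qed
qed

text \<open>An enumeration of \<open>S\<close> and a translation by \<open>a\<close> identify the
  cell with the unit cube of the same dimension.\<close>

lemma cube_ext_cell:
  fixes f :: "('i \<Rightarrow> real) \<Rightarrow> 'b::topological_space"
  assumes ext: "cube_ext (card S) Y" and "finite S"
    and f: "continuous_on (cell_bd a S) f" "f ` cell_bd a S \<subseteq> Y"
  obtains g where "continuous_on (cell a S) g" "g ` cell a S \<subseteq> Y" "\<And>x. x \<in> cell_bd a S \<Longrightarrow> g x = f x"
proof -
  define d where "d = card S"
  obtain \<beta> where \<beta>: "bij_betw \<beta> {..<d} S"
    unfolding d_def using \<open>finite S\<close> by (metis bij_betw_from_nat_into_finite)
  define \<gamma> where "\<gamma> = inv_into {..<d} \<beta>"
  have \<gamma>: "\<gamma> i < d" "\<beta> (\<gamma> i) = i" if "i \<in> S" for i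
    using \<beta> that unfolding \<gamma>_def
    by (auto simp: bij_betw_inv_into_right dest: bij_betwE[OF bij_betw_inv_into])
  have \<beta>S: "\<beta> j \<in> S" "\<gamma> (\<beta> j) = j" if "j < d" for j
    using \<beta> that unfolding \<gamma>_def by (auto simp: bij_betw_inv_into_left dest: bij_betwE)
  define \<phi> where "\<phi> = (\<lambda>(y::nat \<Rightarrow> real) i. if i \<in> S then of_int (a i) + y (\<gamma> i) else of_int (a i))"
  define \<psi> where "\<psi> = (\<lambda>(x::'i \<Rightarrow> real) j. if j < d then x (\<beta> j) - of_int (a (\<beta> j)) else 0)"
  have c\<phi>: "continuous_on T \<phi>" for T
    unfolding \<phi>_def
    by (intro continuous_on_coordinatewise_then_product continuous_on_If_const continuous_intros)
  have c\<psi>: "continuous_on T \<psi>" for T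
    unfolding \<psi>_def
    by (intro continuous_on_coordinatewise_then_product continuous_on_If_const continuous_intros)
  have \<phi>bd: "\<phi> y \<in> cell_bd a S" if "y \<in> unit_cube_bd d" for y
  proof -
    have "\<exists>j<d. y j = 0 \<or> y j = 1" using that by (auto simp: cell_bd_def)
    then obtain j where "j < d" "y j = 0 \<or> y j = 1" by blast
    then have "\<exists>i\<in>S. \<phi> y i = of_int (a i) \<or> \<phi> y i = of_int (a i) + 1"
      using \<beta>S by (intro bexI[of _ "\<beta> j"]) (auto simp: \<phi>_def)
    moreover have "\<phi> y \<in> cell a S"
      using that \<gamma> by (auto simp: cell_bd_def cell_def \<phi>_def)
    ultimately show ?thesis by (simp add: cell_bd_def)
  qed
  have \<psi>c: "\<psi> x \<in> unit_cube d" if "x \<in> cell a S" for x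
    unfolding cell_def
  proof (intro CollectI conjI ballI allI impI)
    fix j assume "j \<in> {..<d}"
    then have "of_int (a (\<beta> j)) \<le> x (\<beta> j)" "x (\<beta> j) \<le> of_int (a (\<beta> j)) + 1"
      using that \<beta>S[of j] by (auto simp: cell_def)
    then show "of_int 0 \<le> \<psi> x j" "\<psi> x j \<le> of_int 0 + 1"
      using \<open>j \<in> {..<d}\<close> by (auto simp: \<psi>_def)
  qed (auto simp: \<psi>_def)
  have \<psi>bd: "\<psi> x \<in> unit_cube_bd d" if x: "x \<in> cell_bd a S" for x
  proof -
    obtain i where "i \<in> S" "x i = of_int (a i) \<or> x i = of_int (a i) + 1"
      using x unfolding cell_bd_def by blast
    then have "\<exists>j\<in>{..<d}. \<psi> x j = 0 \<or> \<psi> x j = 1"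
      using \<gamma> by (intro bexI[of _ "\<gamma> i"]) (auto simp: \<psi>_def)
    then show ?thesis using \<psi>c x by (auto simp: cell_bd_def)
  qed
  have \<phi>\<psi>: "\<phi> (\<psi> x) = x" if "x \<in> cell a S" for x
    using that \<gamma> by (auto simp: cell_def \<phi>_def \<psi>_def fun_eq_iff)
  have "continuous_on (unit_cube_bd d) (f \<circ> \<phi>)" "(f \<circ> \<phi>) ` unit_cube_bd d \<subseteq> Y"
    using continuous_on_comp[OF f(1) c\<phi> \<phi>bd] f(2) \<phi>bd by auto
  then obtain g where g: "continuous_on (unit_cube d) g" "g ` unit_cube d \<subseteq> Y"
      "\<And>x. x \<in> unit_cube_bd d \<Longrightarrow> g x = f (\<phi> x)"
    using ext unfolding cube_ext_def d_def by (metis comp_apply)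
  show thesis
  proof
    show "continuous_on (cell a S) (g \<circ> \<psi>)"
      by (rule continuous_on_comp[OF g(1) c\<psi> \<psi>c])
    show "(g \<circ> \<psi>) ` cell a S \<subseteq> Y" using \<psi>c g(2) by auto
    show "(g \<circ> \<psi>) x = f x" if "x \<in> cell_bd a S" for x
      using that \<phi>\<psi> \<psi>bd g(3) cell_bd_subset by fastforce
  qed
qed

lemma face_subset: "face \<tau> \<sigma> \<Longrightarrow> cl \<tau> \<subseteq> cl \<sigma>"
  apply (cases \<sigma>; cases \<tau>)
  apply (clarsimp simp: face_def cell_def)
  apply (intro conjI ballI allI impI)
  apply (smt (verit, ccfv_SIG) DiffI of_int_1 of_int_add subsetD)+
  done

lemma cell_bd_proper_face:
  assumes "x \<in> cell_bd a S"
  obtains b T where "T \<subset> S" "face (b, T) (a, S)" "x \<in> cell b T"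
proof -
  obtain i where i: "i \<in> S" "x i = of_int (a i) \<or> x i = of_int (a i + 1)"
    using assms by (auto simp: cell_bd_def)
  then obtain c where c: "c = a i \<or> c = a i + 1" "x i = of_int c" by blast
  show thesis
    by (rule that[of "S - {i}" "a(i := c)"])
       (use assms i c in \<open>auto simp: face_def cell_bd_def cell_def\<close>)
qed

text \<open>At an interior point the coordinates in \<open>S\<close> are not integers, so every cell
  through the point is free there with the same integer part. The other coordinates are integers and
  can only be ends of the larger cell.\<close>

lemma face_of_interior_point:
  assumes "x \<in> cell a S" "x \<notin> cell_bd a S" "x \<in> cell b T"
  shows "face (a, S) (b, T)"
proof -
  have int: "of_int (a i) < x i \<and> x i < of_int (a i) + 1" if "i \<in> S" for i
    using assms(1,2) that by (fastforce simp: cell_def cell_bd_def)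
  have out: "x i = of_int (a i)" if "i \<notin> S" for i
    using assms(1) that by (auto simp: cell_def)
  have b: "i \<in> T \<Longrightarrow> of_int (b i) \<le> x i \<and> x i \<le> of_int (b i) + 1" "i \<notin> T \<Longrightarrow> x i = of_int (b i)" for i
    using assms(3) by (auto simp: cell_def)
  have "S \<subseteq> T"
  proof (rule subsetI, rule ccontr)
    fix i assume "i \<in> S" "i \<notin> T"
    then have "of_int (a i) < (of_int (b i) :: real)" "of_int (b i) < (of_int (a i + 1) :: real)"
      using int[of i] b(2)[of i] by auto
    then have "a i < b i" "b i < a i + 1" by (simp_all only: of_int_less_iff)
    then show False by linarith
  qed
  moreover have "a i = b i" if "i \<notin> T" for i
    using that out b(2) \<open>S \<subseteq> T\<close> by (metis of_int_eq_iff subsetD)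
  moreover have "a i = b i" if "i \<in> S" for i
  proof -
    have "of_int (a i) < (of_int (b i + 1) :: real)" "of_int (b i) < (of_int (a i + 1) :: real)"
      using int[OF that] b(1)[of i] that \<open>S \<subseteq> T\<close> by auto
    then show ?thesis by linarith
  qed
  moreover have "a i = b i \<or> a i = b i + 1" if "i \<in> T - S" for i
  proof -
    have "of_int (b i) \<le> (of_int (a i) :: real)" "of_int (a i) \<le> (of_int (b i + 1) :: real)"
      using that out[of i] b(1)[of i] by auto
    then show ?thesis by linarith
  qed
  ultimately show ?thesis by (auto simp: face_def)
qed

text \<open>The obstruction-theoretic workhorse: \<open>R\<close> is a subcomplex where the map is
  given, and the monotone carrier \<open>T\<close> prescribes where each cell must go. Cells outside
  \<open>R\<close> are filled by increasing dimension; monotonicity puts the boundary of a cell into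
  its carrier before the cell is filled.\<close>

lemma carrier_extension:
  fixes g :: "('i \<Rightarrow> real) \<Rightarrow> 'b::topological_space"
  assumes "finite K" "\<And>\<sigma>. \<sigma> \<in> K \<Longrightarrow> finite (snd \<sigma>)" "R \<subseteq> K"
    and "\<And>\<sigma> \<tau>. \<lbrakk>\<sigma> \<in> K; face \<tau> \<sigma>\<rbrakk> \<Longrightarrow> \<tau> \<in> K"
    and "\<And>\<sigma> \<tau>. \<lbrakk>\<sigma> \<in> R; face \<tau> \<sigma>\<rbrakk> \<Longrightarrow> \<tau> \<in> R"
    and "continuous_on (\<Union>\<sigma>\<in>R. cl \<sigma>) g"
    and "\<And>\<sigma>. \<sigma> \<in> R \<Longrightarrow> g ` cl \<sigma> \<subseteq> T \<sigma>"
    and "\<And>\<sigma>. \<sigma> \<in> K - R \<Longrightarrow> cube_ext (card (snd \<sigma>)) (T \<sigma>)"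
    and "\<And>\<sigma> \<tau>. \<lbrakk>\<sigma> \<in> K; face \<tau> \<sigma>\<rbrakk> \<Longrightarrow> T \<tau> \<subseteq> T \<sigma>"
  shows "\<exists>g'. continuous_on (\<Union>\<sigma>\<in>K. cl \<sigma>) g' \<and> (\<forall>x\<in>\<Union>\<sigma>\<in>R. cl \<sigma>. g' x = g x) \<and>
              (\<forall>\<sigma>\<in>K. g' ` cl \<sigma> \<subseteq> T \<sigma>)"
  using assms
proof (induction "card (K - R)" arbitrary: K)
  case 0
  then have "K = R" by auto
  then show ?case using 0 by blast
next
  case (Suc n)
  have fin: "finite (K - R)" using Suc.prems(1) by auto
  moreover have ne: "K - R \<noteq> {}" using Suc.hyps(2) by (metis card.empty nat.distinct(1))
  ultimately have "Max ((\<lambda>\<sigma>. card (snd \<sigma>)) ` (K - R)) \<in> (\<lambda>\<sigma>. card (snd \<sigma>)) ` (K - R)"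
    by (intro Max_in) auto
  then obtain \<sigma> where \<sigma>_in: "\<sigma> \<in> K - R" and \<sigma>_max: "Max ((\<lambda>\<sigma>. card (snd \<sigma>)) ` (K - R)) = card (snd \<sigma>)"
    by auto
  have \<sigma>: "\<sigma> \<in> K - R" "\<And>\<tau>. \<tau> \<in> K - R \<Longrightarrow> card (snd \<tau>) \<le> card (snd \<sigma>)"
    using \<sigma>_in fin by (auto simp flip: \<sigma>_max intro!: Max_ge)
  define K' where "K' = K - {\<sigma>}"
  \<comment> \<open>A coface of a cell outside \<open>R\<close> is again outside \<open>R\<close>,
    so maximal dimension excludes proper cofaces. Removing \<open>\<sigma>\<close> therefore leaves
    a complex.\<close>
  have cofaces: "\<tau> = \<sigma>" if "\<tau> \<in> K" "face \<sigma> \<tau>" for \<tau>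
  proof -
    have "\<tau> \<notin> R" using \<sigma>(1) Suc.prems(5) that by blast
    then have "card (snd \<tau>) \<le> card (snd \<sigma>)" using \<sigma>(2) that by auto
    moreover have sub: "snd \<sigma> \<subseteq> snd \<tau>" using that(2) by (auto simp: face_def)
    ultimately have "snd \<sigma> = snd \<tau>" using Suc.prems(2)[OF that(1)] card_seteq by blast
    then show ?thesis using that(2) by (auto simp: face_def prod_eq_iff fun_eq_iff)
  qed
  have cardK': "n = card (K' - R)"
  proof -
    have "K' - R = (K - R) - {\<sigma>}" by (auto simp: K'_def)
    then show ?thesis using Suc.hyps(2) \<sigma>(1) fin by simp
  qed
  have RK': "R \<subseteq> K'" using Suc.prems(3) \<sigma>(1) by (auto simp: K'_def)
  have K'face: "\<tau> \<in> K'" if "\<rho> \<in> K'" "face \<tau> \<rho>" for \<rho> \<tau>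
    using that Suc.prems(4)[of \<rho> \<tau>] cofaces[of \<rho>] unfolding K'_def by blast
  have "\<exists>g'. continuous_on (\<Union>\<sigma>\<in>K'. cl \<sigma>) g' \<and> (\<forall>x\<in>\<Union>\<sigma>\<in>R. cl \<sigma>. g' x = g x) \<and>
              (\<forall>\<sigma>\<in>K'. g' ` cl \<sigma> \<subseteq> T \<sigma>)"
  proof (rule Suc.hyps(1)[OF cardK'])
    show "finite K'" using Suc.prems(1) by (simp add: K'_def)
    show "\<And>\<sigma>. \<sigma> \<in> K' \<Longrightarrow> finite (snd \<sigma>)" using Suc.prems(2) by (simp add: K'_def)
    show "\<And>\<sigma>. \<sigma> \<in> K' - R \<Longrightarrow> cube_ext (card (snd \<sigma>)) (T \<sigma>)" using Suc.prems(8) by (simp add: K'_def)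
    show "\<And>\<sigma> \<tau>. \<lbrakk>\<sigma> \<in> K'; face \<tau> \<sigma>\<rbrakk> \<Longrightarrow> T \<tau> \<subseteq> T \<sigma>" using Suc.prems(9) by (simp add: K'_def)
  qed (fact RK' K'face Suc.prems(5-7))+
  then obtain g' where g': "continuous_on (\<Union>\<sigma>\<in>K'. cl \<sigma>) g'" "\<forall>x\<in>\<Union>\<sigma>\<in>R. cl \<sigma>. g' x = g x"
      "\<forall>\<sigma>\<in>K'. g' ` cl \<sigma> \<subseteq> T \<sigma>" by blast
  obtain a S where aS: "\<sigma> = (a, S)" by (cases \<sigma>)
  have bd: "\<exists>\<tau>\<in>K'. face \<tau> \<sigma> \<and> x \<in> cl \<tau>" if x: "x \<in> cell_bd a S" for x
  proof -
    obtain b U where "U \<subset> S" "face (b, U) (a, S)" "x \<in> cell b U"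
      using cell_bd_proper_face[OF x] .
    then show ?thesis
      using Suc.prems(4)[of \<sigma> "(b, U)"] \<sigma>(1)
      by (intro bexI[of _ "(b, U)"]) (auto simp: K'_def aS)
  qed
  have "continuous_on (cell_bd a S) g'"
    by (rule continuous_on_subset[OF g'(1)]) (use bd in auto)
  moreover have "g' ` cell_bd a S \<subseteq> T \<sigma>"
  proof (rule image_subsetI)
    fix x assume "x \<in> cell_bd a S"
    then obtain \<tau> where \<tau>: "\<tau> \<in> K'" "face \<tau> \<sigma>" "x \<in> cl \<tau>" using bd by blast
    then show "g' x \<in> T \<sigma>"
      using g'(3) Suc.prems(9)[OF _ \<tau>(2)] \<sigma>(1) by blast
  qed
  moreover have "cube_ext (card S) (T \<sigma>)" "finite S"
    using Suc.prems(2,8) \<sigma>(1) aS by fastforce+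
  ultimately obtain k where k: "continuous_on (cell a S) k" "k ` cell a S \<subseteq> T \<sigma>"
      "\<And>x. x \<in> cell_bd a S \<Longrightarrow> k x = g' x"
    using cube_ext_cell by metis
  \<comment> \<open>The two maps meet only on the boundary of the new cell: an interior point in
    another cell would make \<open>\<sigma>\<close> a proper face of it.\<close>
  have agree: "k x = g' x" if x: "x \<in> cell a S" "x \<in> (\<Union>\<tau>\<in>K'. cl \<tau>)" for x
  proof (rule k(3), rule ccontr)
    assume "x \<notin> cell_bd a S"
    moreover obtain b U where "(b, U) \<in> K'" "x \<in> cell b U" using x(2) by auto
    ultimately show False
      using face_of_interior_point[OF x(1)] cofaces[of "(b, U)"] by (auto simp: K'_def aS)
  qed
  define g'' where "g'' = (\<lambda>x. if x \<in> cell a S then k x else g' x)"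
  have g''K': "g'' x = g' x" if "x \<in> (\<Union>\<tau>\<in>K'. cl \<tau>)" for x
    using that agree by (auto simp: g''_def)
  have K: "K = insert \<sigma> K'" using \<sigma>(1) by (auto simp: K'_def)
  have "finite K'" using Suc.prems(1) by (simp add: K'_def)
  then have "closed (\<Union>\<tau>\<in>K'. cl \<tau>)" by (auto intro: closed_cell)
  then have "continuous_on ((\<Union>\<tau>\<in>K'. cl \<tau>) \<union> cell a S) g''"
  proof (intro continuous_on_closed_Un closed_cell)
    show "continuous_on (\<Union>\<tau>\<in>K'. cl \<tau>) g''"
      by (rule continuous_on_eq[OF g'(1)]) (rule g''K'[symmetric])
    show "continuous_on (cell a S) g''"
      by (rule continuous_on_eq[OF k(1)]) (simp add: g''_def)
  qed
  then have "continuous_on (\<Union>\<tau>\<in>K. cl \<tau>) g''" by (simp add: K aS Un_commute)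
  moreover have "\<forall>x\<in>\<Union>\<sigma>\<in>R. cl \<sigma>. g'' x = g x"
    using RK' g''K' g'(2) by (metis (no_types, lifting) UN_iff subsetD)
  moreover have "g'' ` cl \<tau> \<subseteq> T \<tau>" if "\<tau> \<in> K'" for \<tau>
    using g'(3) that g''K' by (smt (verit) UN_iff image_subset_iff)
  then have "\<forall>\<tau>\<in>K. g'' ` cl \<tau> \<subseteq> T \<tau>"
    using k(2) by (auto simp: K aS g''_def)
  ultimately show ?case by blast
qed

section \<open>Spheres and cubes\<close>

definition sph :: "nat \<Rightarrow> (nat \<Rightarrow> real) set" where
  "sph i = {x. (\<Sum>j\<le>i. x j ^ 2) = 1 \<and> (\<forall>j>i. x j = 0)}"

lemma nsphere_eq: "nsphere i = top_of_set (sph i)"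
  by (simp add: nsphere sph_def euclidean_product_topology)

definition sup_norm :: "nat \<Rightarrow> (nat \<Rightarrow> real) \<Rightarrow> real" where
  "sup_norm i x = Max ((\<lambda>j. \<bar>x j\<bar>) ` {..i})"

definition l2_norm :: "nat \<Rightarrow> (nat \<Rightarrow> real) \<Rightarrow> real" where
  "l2_norm i x = sqrt (\<Sum>j\<le>i. x j ^ 2)"

definition dilate :: "real \<Rightarrow> (nat \<Rightarrow> real) \<Rightarrow> nat \<Rightarrow> real" where
  "dilate c x = (\<lambda>j. c * x j)"

text \<open>Moves the unit cube to the unit ball of \<open>sup_norm i\<close>, where scaling along
  rays relates its boundary to the sphere.\<close>

definition centre :: "nat \<Rightarrow> (nat \<Rightarrow> real) \<Rightarrow> nat \<Rightarrow> real" where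
  "centre i x = (\<lambda>j. if j \<le> i then 2 * x j - 1 else 0)"

definition uncentre :: "nat \<Rightarrow> (nat \<Rightarrow> real) \<Rightarrow> nat \<Rightarrow> real" where
  "uncentre i u = (\<lambda>j. if j \<le> i then (1 + u j) / 2 else 0)"

lemma continuous_on_sup_norm: "continuous_on S (sup_norm i)"
  unfolding sup_norm_def by (intro continuous_on_Max_family continuous_intros) auto

lemma continuous_on_l2_norm: "continuous_on S (l2_norm i)"
  unfolding l2_norm_def by (intro continuous_intros)

lemma continuous_on_dilate:
  assumes "continuous_on S c" "continuous_on S f"
  shows "continuous_on S (\<lambda>x. dilate (c x) (f x))"
  unfolding dilate_def
  by (intro continuous_on_coordinatewise_then_product continuous_intros assms
        continuous_on_product_then_coordinatewise[OF assms(2)])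

lemma continuous_on_centre: "continuous_on S (centre i)"
  unfolding centre_def
  by (intro continuous_on_coordinatewise_then_product continuous_on_If_const continuous_intros)

lemma continuous_on_uncentre: "continuous_on S (uncentre i)"
  unfolding uncentre_def
  by (intro continuous_on_coordinatewise_then_product continuous_on_If_const continuous_intros) auto

lemma sup_norm_nonneg: "0 \<le> sup_norm i x"
  unfolding sup_norm_def by (rule order_trans[OF abs_ge_zero[of "x 0"]]) (auto intro: Max_ge)

lemma abs_le_sup_norm: "j \<le> i \<Longrightarrow> \<bar>x j\<bar> \<le> sup_norm i x"
  unfolding sup_norm_def by (auto intro: Max_ge)

lemma sup_norm_attained: "\<exists>j\<le>i. \<bar>x j\<bar> = sup_norm i x"
proof -
  have "sup_norm i x \<in> (\<lambda>j. \<bar>x j\<bar>) ` {..i}"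
    unfolding sup_norm_def by (rule Max_in) auto
  then show ?thesis by auto
qed

lemma sup_norm_le_iff: "sup_norm i x \<le> c \<longleftrightarrow> (\<forall>j\<le>i. \<bar>x j\<bar> \<le> c)"
  unfolding sup_norm_def by auto

lemma sup_norm_dilate: "sup_norm i (dilate c x) = \<bar>c\<bar> * sup_norm i x"
proof (rule antisym)
  show "sup_norm i (dilate c x) \<le> \<bar>c\<bar> * sup_norm i x"
    by (auto simp: sup_norm_le_iff dilate_def abs_mult intro: mult_left_mono abs_le_sup_norm)
  obtain j where "j \<le> i" "\<bar>x j\<bar> = sup_norm i x" using sup_norm_attained by blast
  then show "\<bar>c\<bar> * sup_norm i x \<le> sup_norm i (dilate c x)"
    using abs_le_sup_norm[of j i "dilate c x"] by (simp add: dilate_def abs_mult)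
qed

lemma l2_norm_pos: "0 < sup_norm i x \<Longrightarrow> 0 < l2_norm i x"
proof -
  assume a: "0 < sup_norm i x"
  obtain j where j: "j \<le> i" "\<bar>x j\<bar> = sup_norm i x" using sup_norm_attained by blast
  then have "0 < x j ^ 2" using a by auto
  also have "x j ^ 2 \<le> (\<Sum>j\<le>i. x j ^ 2)"
    using j by (intro member_le_sum) auto
  finally show ?thesis by (simp add: l2_norm_def)
qed

lemma dilate_dilate [simp]: "dilate a (dilate b x) = dilate (a * b) x"
  by (simp add: dilate_def mult.assoc)

lemma dilate_1 [simp]: "dilate 1 x = x"
  by (simp add: dilate_def)

lemma dilate_0 [simp]: "dilate 0 x = (\<lambda>_. 0)"
  by (simp add: dilate_def)

lemma sph_sup_norm_pos: "x \<in> sph i \<Longrightarrow> 0 < sup_norm i x"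
proof (rule ccontr)
  assume x: "x \<in> sph i" "\<not> 0 < sup_norm i x"
  then have "x j = 0" if "j \<le> i" for j using abs_le_sup_norm[OF that, of x] by simp
  then have "(\<Sum>j\<le>i. x j ^ 2) = 0" by simp
  with x(1) show False by (simp add: sph_def)
qed

lemma sph_l2_norm: "x \<in> sph i \<Longrightarrow> l2_norm i x = 1"
  by (simp add: sph_def l2_norm_def)

lemma normalize_in_sph:
  assumes "0 < sup_norm i x" "\<And>j. j > i \<Longrightarrow> x j = 0"
  shows "dilate (1 / l2_norm i x) x \<in> sph i"
proof -
  have pos: "0 < (\<Sum>j\<le>i. x j ^ 2)" using l2_norm_pos[OF assms(1)] by (simp add: l2_norm_def)
  have "(\<Sum>j\<le>i. (1 / l2_norm i x * x j) ^ 2) = (1 / l2_norm i x)^2 * (\<Sum>j\<le>i. x j ^ 2)"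
    by (simp only: power_mult_distrib sum_distrib_left)
  also have "\<dots> = 1" using pos by (simp add: l2_norm_def power_divide)
  finally show ?thesis using assms(2) by (simp add: sph_def dilate_def)
qed

lemma centre_in:
  assumes "x \<in> unit_cube (Suc i)"
  shows "sup_norm i (centre i x) \<le> 1" "j > i \<Longrightarrow> centre i x j = 0"
    "uncentre i (centre i x) = x"
  using assms
  by (auto simp: sup_norm_le_iff centre_def cell_def uncentre_def fun_eq_iff abs_le_iff less_Suc_eq_le)

lemma centre_bd: "x \<in> unit_cube_bd (Suc i) \<Longrightarrow> sup_norm i (centre i x) = 1"
proof (rule antisym)
  assume x: "x \<in> unit_cube_bd (Suc i)"
  then show "sup_norm i (centre i x) \<le> 1" using centre_in(1) cell_bd_subset by blast
  obtain j where "j \<le> i" "x j = 0 \<or> x j = 1"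
    using x unfolding cell_bd_def by (fastforce simp: less_Suc_eq_le)
  then have "j \<le> i" "\<bar>centre i x j\<bar> = 1" by (auto simp: centre_def)
  then show "1 \<le> sup_norm i (centre i x)" using abs_le_sup_norm by metis
qed

lemma uncentre_in: "sup_norm i u \<le> 1 \<Longrightarrow> uncentre i u \<in> unit_cube (Suc i)"
  by (auto simp: sup_norm_le_iff cell_def uncentre_def abs_le_iff less_Suc_eq_le)

lemma centre_uncentre: "(\<And>j. j > i \<Longrightarrow> u j = 0) \<Longrightarrow> centre i (uncentre i u) = u"
  by (auto simp: centre_def uncentre_def fun_eq_iff field_simps)

lemma uncentre_bd: "sup_norm i u = 1 \<Longrightarrow> uncentre i u \<in> unit_cube_bd (Suc i)"
proof -
  assume u: "sup_norm i u = 1"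
  obtain j where "j \<le> i" "\<bar>u j\<bar> = 1" using sup_norm_attained u by metis
  then have "\<exists>j\<in>{..<Suc i}. uncentre i u j = 0 \<or> uncentre i u j = 1"
    by (intro bexI[of _ j]) (auto simp: uncentre_def)
  then show ?thesis using uncentre_in u by (simp add: cell_bd_def)
qed

lemma cube_ext_0: "cube_ext 0 Y \<longleftrightarrow> Y \<noteq> {}"
proof
  assume "Y \<noteq> {}"
  then obtain y where "y \<in> Y" by blast
  then show "cube_ext 0 Y" unfolding cube_ext_def
    by (intro allI impI exI[of _ "\<lambda>_. y"]) (auto simp: cell_bd_def)
next
  assume "cube_ext 0 Y"
  then obtain g where "g ` unit_cube 0 \<subseteq> Y"
    unfolding cube_ext_def by (auto simp: cell_bd_def)
  moreover have "(\<lambda>_. 0) \<in> unit_cube 0" by (simp add: cell_def)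
  ultimately show "Y \<noteq> {}" by blast
qed

text \<open>The boundary of the cube is a sphere by radial projection. A filling contracts the
  sphere along its radii; conversely a contraction fills an outer shell of the cube, and its end
  point fills the core.\<close>

lemma cube_ext_Suc:
  fixes Y :: "'b::topological_space set"
  shows "cube_ext (Suc i) Y \<longleftrightarrow>
    (\<forall>f. continuous_map (nsphere i) (top_of_set Y) f \<longrightarrow>
         (\<exists>c. homotopic_with (\<lambda>_. True) (nsphere i) (top_of_set Y) f (\<lambda>_. c)))" (is "?L = ?R")
proof
  assume L: ?L
  show ?R
    unfolding nsphere_eq
  proof (intro allI impI)
    fix f assume "continuous_map (top_of_set (sph i)) (top_of_set Y) f"
    then have f: "continuous_on (sph i) f" "f ` sph i \<subseteq> Y" by auto
    define p where "p = (\<lambda>x. let u = centre i x in dilate (1 / l2_norm i u) u)"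
    have p: "p x \<in> sph i" if "x \<in> unit_cube_bd (Suc i)" for x
      unfolding p_def Let_def
      by (rule normalize_in_sph) (use that centre_bd centre_in(2) cell_bd_subset in \<open>auto, blast\<close>)
    have "continuous_on (unit_cube_bd (Suc i)) (\<lambda>x. l2_norm i (centre i x))"
      using continuous_on_compose2[OF continuous_on_l2_norm continuous_on_centre] by blast
    moreover have "l2_norm i (centre i x) \<noteq> 0" if "x \<in> unit_cube_bd (Suc i)" for x
      using l2_norm_pos[of i "centre i x"] centre_bd[OF that] by auto
    ultimately have "continuous_on (unit_cube_bd (Suc i)) p"
      unfolding p_def Let_def by (intro continuous_on_dilate continuous_on_centre continuous_intros) auto
    then have "continuous_on (unit_cube_bd (Suc i)) (f \<circ> p)" "(f \<circ> p) ` unit_cube_bd (Suc i) \<subseteq> Y"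
      using continuous_on_comp[OF f(1) _ p] p f(2) by auto
    then obtain g where g: "continuous_on (unit_cube (Suc i)) g" "g ` unit_cube (Suc i) \<subseteq> Y"
        "\<And>x. x \<in> unit_cube_bd (Suc i) \<Longrightarrow> g x = f (p x)"
      using L unfolding cube_ext_def by (metis comp_apply)
    \<comment> \<open>At time \<open>t\<close> the point on the ray of \<open>x\<close> with sup
      norm \<open>1 - t\<close>, carried back to the unit cube.\<close>
    define q where "q = (\<lambda>(t, x). uncentre i (dilate ((1 - t) / sup_norm i x) x))"
    have snorm: "sup_norm i (dilate ((1 - t) / sup_norm i x) x) = 1 - t" if "x \<in> sph i" "t \<in> {0..1}" for t x
      using sph_sup_norm_pos[OF that(1)] that(2) by (simp add: sup_norm_dilate)
    have qc: "q (t, x) \<in> unit_cube (Suc i)" if "x \<in> sph i" "t \<in> {0..1}" for t x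
      using snorm[OF that] that(2) by (auto simp: q_def intro: uncentre_in)
    have "continuous_on ({0..1} \<times> sph i) (\<lambda>z. dilate ((1 - fst z) / sup_norm i (snd z)) (snd z))"
    proof (intro continuous_on_dilate continuous_intros)
      show "continuous_on ({0..1} \<times> sph i) (\<lambda>z. sup_norm i (snd z))"
        using continuous_on_compose2[OF continuous_on_sup_norm continuous_on_snd[OF continuous_on_id]] by blast
    qed (use sph_sup_norm_pos in fastforce)
    then have cq: "continuous_on ({0..1} \<times> sph i) q"
      using continuous_on_compose2[OF continuous_on_uncentre[of UNIV i]] by (auto simp: q_def case_prod_unfold)
    have "homotopic_with (\<lambda>_. True) (top_of_set (sph i)) (top_of_set Y) f (\<lambda>_. g (uncentre i (\<lambda>_. 0)))"
    proof (subst homotopic_with, simp, intro exI conjI ballI)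
      show "continuous_map (prod_topology (top_of_set {0..1}) (top_of_set (sph i))) (top_of_set Y) (g \<circ> q)"
        using continuous_on_comp[OF g(1) cq] qc g(2) by auto
      fix x assume "x \<in> topspace (top_of_set (sph i))"
      then have x: "x \<in> sph i" by simp
      let ?u = "dilate (1 / sup_norm i x) x"
      have "sup_norm i ?u = 1" using snorm[OF x, of 0] by simp
      then have bd: "uncentre i ?u \<in> unit_cube_bd (Suc i)" by (rule uncentre_bd)
      have cu: "centre i (uncentre i ?u) = ?u"
        using x by (intro centre_uncentre) (auto simp: sph_def dilate_def)
      have "l2_norm i ?u = 1 / sup_norm i x * l2_norm i x"
        using sph_sup_norm_pos[OF x]
        by (simp add: l2_norm_def dilate_def power_mult_distrib power_divide real_sqrt_divide flip: sum_divide_distrib)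
      then have "p (uncentre i ?u) = x"
        using sph_sup_norm_pos[OF x] sph_l2_norm[OF x] by (simp add: p_def Let_def cu)
      then show "(g \<circ> q) (0, x) = f x" using g(3)[OF bd] by (simp add: q_def)
      show "(g \<circ> q) (1, x) = g (uncentre i (\<lambda>_. 0))" by (simp add: q_def)
    qed auto
    then show "\<exists>c. homotopic_with (\<lambda>_. True) (top_of_set (sph i)) (top_of_set Y) f (\<lambda>_. c)" ..
  qed
next
  assume R: ?R
  show ?L
    unfolding cube_ext_def
  proof (intro allI impI, elim conjE)
    fix F :: "(nat \<Rightarrow> real) \<Rightarrow> 'b"
    assume F: "continuous_on (unit_cube_bd (Suc i)) F" "F ` unit_cube_bd (Suc i) \<subseteq> Y"
    define p where "p = (\<lambda>x. uncentre i (dilate (1 / sup_norm i x) x))"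
    have p: "p x \<in> unit_cube_bd (Suc i)" if "0 < sup_norm i x" for x
      using that unfolding p_def by (intro uncentre_bd) (simp add: sup_norm_dilate)
    have "continuous_on (sph i) (\<lambda>x. dilate (1 / sup_norm i x) x)"
      using sph_sup_norm_pos by (intro continuous_on_dilate continuous_intros continuous_on_sup_norm) fastforce
    then have "continuous_on (sph i) p"
      unfolding p_def using continuous_on_compose2[OF continuous_on_uncentre[of UNIV i]] by auto
    then have "continuous_on (sph i) (F \<circ> p)" "(F \<circ> p) ` sph i \<subseteq> Y"
      using continuous_on_comp[OF F(1), of "sph i" p] p sph_sup_norm_pos F(2) by auto
    then obtain c where "homotopic_with (\<lambda>_. True) (top_of_set (sph i)) (top_of_set Y) (F \<circ> p) (\<lambda>_. c)"
      using R unfolding nsphere_eq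
      by (metis continuous_map_subtopology_eu image_subset_iff_funcset)
    then obtain h where h': "continuous_map (prod_topology (top_of_set {0..1::real}) (top_of_set (sph i))) (top_of_set Y) h \<and>
        (\<forall>x. h (0, x) = (F \<circ> p) x) \<and> (\<forall>x. h (1, x) = c) \<and> (\<forall>t\<in>{0..1::real}. True)"
      unfolding homotopic_with_def ..
    have h: "continuous_on ({0..1::real} \<times> sph i) h" "h ` ({0..1::real} \<times> sph i) \<subseteq> Y"
        "\<And>x. h (0, x) = F (p x)" "\<And>x. h (1, x) = c"
      using h' by auto
    \<comment> \<open>The sphere is nonempty, so the constant \<open>c\<close> is a value of the
      homotopy and lies in \<open>Y\<close>.\<close>
    have "(1, \<lambda>n. if n = 0 then 1 else 0) \<in> {0..1::real} \<times> sph i"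
      using in_topspace_nsphere[of i] by (simp add: nsphere_eq)
    from imageI[OF this, of h] have cY: "c \<in> Y" using h(2,4) by auto
    \<comment> \<open>The shell of sup norms between 1/2 and 1 is read as time running from 1 to 0
      together with a direction. Staying away from the centre keeps the direction defined.\<close>
    define r where "r = (\<lambda>x. let u = centre i x in (2 - 2 * sup_norm i u, dilate (1 / l2_norm i u) u))"
    let ?m = "\<lambda>x. sup_norm i (centre i x)"
    let ?Q = "unit_cube (Suc i)"
    have cm: "continuous_on A ?m" for A
      using continuous_on_compose2[OF continuous_on_sup_norm continuous_on_centre] by blast
    have cl2: "continuous_on A (\<lambda>x. l2_norm i (centre i x))" for A
      using continuous_on_compose2[OF continuous_on_l2_norm continuous_on_centre] by blast
    define A where "A = ?Q \<inter> ?m -` {..1/2}"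
    define B where "B = ?Q \<inter> ?m -` {1/2..}"
    have cA: "closed A" "closed B" unfolding A_def B_def
      by (auto intro!: continuous_closed_preimage cm closed_cell)
    have AB: "A \<union> B = ?Q" by (auto simp: A_def B_def)
    have rB: "r x \<in> {0..1} \<times> sph i" if "x \<in> B" for x
      using that centre_in(1,2)[of x i] unfolding r_def Let_def B_def
      by (auto intro!: normalize_in_sph)
    have "l2_norm i (centre i x) \<noteq> 0" if "x \<in> B" for x
      using l2_norm_pos[of i "centre i x"] that by (auto simp: B_def)
    then have "continuous_on B r"
      unfolding r_def Let_def
      by (intro continuous_on_Pair continuous_on_dilate continuous_on_centre continuous_intros cm cl2) auto
    then have chr: "continuous_on B (h \<circ> r)"
      using rB by (intro continuous_on_comp[OF h(1)])
    define G where "G = (\<lambda>x. if ?m x \<le> 1/2 then c else h (r x))"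
    \<comment> \<open>On the common part of shell and core the time is 1, where the homotopy is
      already constant.\<close>
    have GB: "G x = (h \<circ> r) x" if "x \<in> B" for x
    proof (cases "?m x = 1/2")
      case True
      then have "2 - 2 * ?m x = 1" by simp
      then show ?thesis using True h(4) by (simp only: G_def r_def Let_def comp_apply) simp
    qed (use that in \<open>auto simp: G_def B_def\<close>)
    have "continuous_on (A \<union> B) G"
    proof (intro continuous_on_closed_Un cA)
      show "continuous_on A G" by (rule continuous_on_eq[of _ "\<lambda>_. c"]) (auto simp: A_def G_def)
      show "continuous_on B G" by (rule continuous_on_eq[OF chr]) (simp add: GB)
    qed
    moreover have "G ` ?Q \<subseteq> Y"
      unfolding AB[symmetric] using cY GB h(2) rB by (auto simp: A_def G_def)
    moreover have "G x = F x" if x: "x \<in> unit_cube_bd (Suc i)" for x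
    proof -
      let ?u = "centre i x"
      have xQ: "x \<in> ?Q" using x cell_bd_subset by blast
      have m1: "?m x = 1" using x by (rule centre_bd)
      have l: "0 < l2_norm i ?u" using m1 by (intro l2_norm_pos) simp
      have "p (dilate (1 / l2_norm i ?u) ?u) = x"
        using l by (simp add: p_def sup_norm_dilate m1 centre_in(3)[OF xQ])
      then show ?thesis using h(3) by (simp add: G_def m1 r_def Let_def)
    qed
    ultimately show "\<exists>g. continuous_on ?Q g \<and> g ` ?Q \<subseteq> Y \<and> (\<forall>x\<in>unit_cube_bd (Suc i). g x = F x)"
      using AB by auto
  qed
qed

section \<open>Connectivity of open covers\<close>

lemma compact_unit_cube: "compact (unit_cube d)"
proof -
  define I where "I = (\<lambda>i. if i < d then {0..1::real} else {0})"
  have "compactin (product_topology (\<lambda>_. euclidean) UNIV) (PiE UNIV I)"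
    by (subst compactin_PiE) (auto simp: I_def)
  moreover have "PiE UNIV I = unit_cube d"
    by (auto simp: I_def cell_def PiE_def Pi_def)
  ultimately show ?thesis by (simp add: euclidean_product_topology)
qed

text \<open>The metric on functions is a sum with weights \<open>(1/2)^n\<close>. The factor 2 is
  the total weight, and the tail beyond the first \<open>M\<close> terms is at most
  \<open>(1/2)^M\<close>.\<close>

lemma dist_fun_le:
  fixes x y :: "nat \<Rightarrow> real"
  assumes "\<And>i. \<bar>x i - y i\<bar> \<le> c"
  shows "dist x y \<le> 2 * c"
proof (rule field_le_epsilon)
  fix e :: real assume "0 < e"
  then obtain M :: nat where M: "(1/2) ^ M < e" using real_arch_pow_inv[of e "1/2"] by auto
  have "Max {dist (x (from_nat n)) (y (from_nat n)) |n. n \<le> M} \<le> c"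
    using assms by (subst Max_le_iff) (auto simp: dist_real_def)
  then show "dist x y \<le> 2 * c + e" using dist_fun_le_dist_first_terms[of x y M] M by linarith
qed

text \<open>Lebesgue's number lemma, with the size of \<open>T\<close> measured coordinatewise so
  that it can be applied directly to grid cells.\<close>

lemma fine_mesh:
  fixes f :: "(nat \<Rightarrow> real) \<Rightarrow> 'b::topological_space"
  assumes D: "closed D" "D \<subseteq> unit_cube d" and f: "continuous_on D f" "f ` D \<subseteq> A \<union> B"
    and A: "openin (top_of_set (A \<union> B)) A" and B: "openin (top_of_set (A \<union> B)) B"
  obtains N :: nat where "N > 0"
    "\<And>T. \<lbrakk>T \<subseteq> D; \<And>x y i. \<lbrakk>x \<in> T; y \<in> T\<rbrakk> \<Longrightarrow> \<bar>x i - y i\<bar> \<le> 1 / N\<rbrakk> \<Longrightarrow> f ` T \<subseteq> A \<or> f ` T \<subseteq> B"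
proof -
  have "compact D" using D compact_unit_cube[of d] compact_Int_closed[of "unit_cube d" D]
    by (simp add: Int_absorb1)
  have "openin (top_of_set D) (D \<inter> f -` A)" "openin (top_of_set D) (D \<inter> f -` B)"
    using continuous_openin_preimage[OF f(1) _ A] continuous_openin_preimage[OF f(1) _ B] f(2) by auto
  then obtain U W where UW: "open U" "D \<inter> f -` A = D \<inter> U" "open W" "D \<inter> f -` B = D \<inter> W"
    by (metis openin_open)
  have "D \<subseteq> \<Union>{U, W}"
  proof
    fix x assume "x \<in> D"
    then have "x \<in> D \<inter> f -` A \<or> x \<in> D \<inter> f -` B" using f(2) by auto
    then show "x \<in> \<Union>{U, W}" unfolding UW by auto
  qed
  then obtain \<delta> where \<delta>: "0 < \<delta>" "\<And>T. \<lbrakk>T \<subseteq> D; diameter T < \<delta>\<rbrakk> \<Longrightarrow> \<exists>B \<in> {U, W}. T \<subseteq> B"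
    using Lebesgue_number_lemma[OF \<open>compact D\<close>, of "{U, W}"] UW(1,3) by (metis empty_not_insert insertE singletonD)
  obtain n :: nat where n: "2 / real (Suc n) < \<delta>"
    using reals_Archimedean[of "\<delta> / 2"] \<delta>(1) by (auto simp: field_simps)
  show thesis
  proof (rule that[of "Suc n"])
    fix T :: "(nat \<Rightarrow> real) set"
    assume T: "T \<subseteq> D" "\<And>x y i. \<lbrakk>x \<in> T; y \<in> T\<rbrakk> \<Longrightarrow> \<bar>x i - y i\<bar> \<le> 1 / real (Suc n)"
    have "diameter T \<le> 2 * (1 / real (Suc n))"
    proof (cases "T = {}")
      case False
      have "dist x y \<le> 2 * (1 / real (Suc n))" if "x \<in> T" "y \<in> T" for x y
        by (rule dist_fun_le) (use T(2) that in blast)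
      then have "(SUP (x, y)\<in>T \<times> T. dist x y) \<le> 2 * (1 / real (Suc n))"
        using False by (intro cSUP_least) auto
      then show ?thesis using False by (simp add: diameter_def)
    qed (simp add: diameter_def)
    then have "diameter T < \<delta>" using n by simp
    then show "f ` T \<subseteq> A \<or> f ` T \<subseteq> B"
      using \<delta>(2)[OF T(1)] UW(2,4) T(1) by auto
  qed simp
qed

section \<open>Subdivision of a cube into small cubes\<close>

text \<open>The cells of the cube of side \<open>N\<close>. The unit cube is enlarged by
  \<open>N\<close> instead of being cut into fractions, so corners stay integral and
  \<open>carrier_extension\<close> applies.\<close>

definition grid :: "nat \<Rightarrow> nat \<Rightarrow> ((nat \<Rightarrow> int) \<times> nat set) set" where
  "grid N d = {(a, S). S \<subseteq> {..<d} \<and> (\<forall>i\<ge>d. a i = 0) \<and> (\<forall>i<d. 0 \<le> a i \<and> a i \<le> int N) \<and>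
                       (\<forall>i\<in>S. a i < int N)}"

lemma finite_int_functions: "finite {a::nat \<Rightarrow> int. (\<forall>i\<ge>d. a i = 0) \<and> (\<forall>i<d. 0 \<le> a i \<and> a i \<le> m)}"
proof -
  have "{a::nat \<Rightarrow> int. (\<forall>i\<ge>d. a i = 0) \<and> (\<forall>i<d. 0 \<le> a i \<and> a i \<le> m)} =
        {a. \<forall>i. (i \<in> {..<d} \<longrightarrow> a i \<in> {0..m}) \<and> (i \<notin> {..<d} \<longrightarrow> a i = 0)}"
    by (auto simp: not_less)
  then show ?thesis by (simp only: finite_set_of_finite_funs finite_lessThan finite_atLeastAtMost_int)
qed

lemma finite_grid: "finite (grid N d)"
proof (rule finite_subset)
  show "grid N d \<subseteq> {a. (\<forall>i\<ge>d. a i = 0) \<and> (\<forall>i<d. 0 \<le> a i \<and> a i \<le> int N)} \<times> Pow {..<d}"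
    by (auto simp: grid_def)
qed (auto intro: finite_int_functions)

lemma grid_subset: "\<sigma> \<in> grid N d \<Longrightarrow> snd \<sigma> \<subseteq> {..<d}"
  by (auto simp: grid_def)

lemma grid_face:
  assumes "\<sigma> \<in> grid N d" "face \<tau> \<sigma>"
  shows "\<tau> \<in> grid N d"
proof -
  obtain a S b T where [simp]: "\<sigma> = (a, S)" "\<tau> = (b, T)" by (cases \<sigma>; cases \<tau>)
  have f: "T \<subseteq> S" "\<And>i. i \<notin> S \<or> i \<in> T \<Longrightarrow> b i = a i" "\<And>i. i \<in> S \<Longrightarrow> b i = a i \<or> b i = a i + 1"
    using assms(2) unfolding face_def by auto
  have g: "S \<subseteq> {..<d}" "\<And>i. i \<ge> d \<Longrightarrow> a i = 0" "\<And>i. i < d \<Longrightarrow> 0 \<le> a i \<and> a i \<le> int N"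
      "\<And>i. i \<in> S \<Longrightarrow> a i < int N"
    using assms(1) by (auto simp: grid_def)
  have "b i = 0" if "i \<ge> d" for i using that f(2)[of i] g(1,2) by force
  moreover have "0 \<le> b i \<and> b i \<le> int N" if "i < d" for i
    using f(2)[of i] f(3)[of i] g(3)[OF that] g(4)[of i] by (cases "i \<in> S") auto
  moreover have "b i < int N" if "i \<in> T" for i
    using f(1) f(2)[of i] g(4)[of i] that by auto
  ultimately show ?thesis using f(1) g(1) by (auto simp: grid_def)
qed

lemma grid_cell_scaled:
  assumes "(a, S) \<in> grid N d" "N > 0" "x \<in> cell a S"
  shows "dilate (1 / N) x \<in> unit_cube d"
proof -
  have g: "S \<subseteq> {..<d}" "\<And>i. i \<ge> d \<Longrightarrow> a i = 0" "\<And>i. i < d \<Longrightarrow> 0 \<le> a i \<and> a i \<le> int N"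
      "\<And>i. i \<in> S \<Longrightarrow> a i < int N"
    using assms(1) by (auto simp: grid_def)
  have c: "\<And>i. i \<in> S \<Longrightarrow> of_int (a i) \<le> x i \<and> x i \<le> of_int (a i) + 1" "\<And>i. i \<notin> S \<Longrightarrow> x i = of_int (a i)"
    using assms(3) by (auto simp: cell_def)
  have "0 \<le> x i \<and> x i \<le> real N" if "i < d" for i
  proof (cases "i \<in> S")
    case True
    have "0 \<le> real_of_int (a i)" "real_of_int (a i) + 1 \<le> real N"
      using g(3)[OF that] g(4)[OF True] by linarith+
    then show ?thesis using c(1)[OF True] by linarith
  next
    case False
    then show ?thesis using c(2) g(3)[OF that] by simp
  qed
  moreover have "x i = 0" if "i \<ge> d" for i using c(2)[of i] g(1,2) that by fastforce
  ultimately show ?thesis using assms(2) by (auto simp: cell_def dilate_def)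
qed

lemma cell_width: "\<lbrakk>x \<in> cell a S; y \<in> cell a S\<rbrakk> \<Longrightarrow> \<bar>x i - y i\<bar> \<le> 1"
  by (cases "i \<in> S") (force simp: cell_def abs_le_iff)+

lemma grid_cover:
  assumes "N > 0" "x \<in> unit_cube d"
  obtains a S where "(a, S) \<in> grid N d" "dilate N x \<in> cell a S"
proof -
  \<comment> \<open>A coordinate equal to 1 has floor \<open>N\<close> after scaling, where no cube
    of the grid starts; the minimum assigns it to the last cube.\<close>
  define a where "a = (\<lambda>i. if i < d then min \<lfloor>N * x i\<rfloor> (int N - 1) else 0)"
  have x: "0 \<le> x i" "x i \<le> 1" if "i < d" for i using assms(2) that by (auto simp: cell_def)
  have x0: "x i = 0" if "\<not> i < d" for i using assms(2) that by (auto simp: cell_def)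
  have up: "N * x i \<le> N" if "i < d" for i using x[OF that] assms(1) by simp
  have fl: "0 \<le> \<lfloor>N * x i\<rfloor>" if "i < d" for i using x[OF that] by simp
  show thesis
  proof (rule that[of a "{..<d}"])
    show "(a, {..<d}) \<in> grid N d"
      using fl assms(1) by (auto simp: grid_def a_def min_less_iff_disj)
    have "of_int (a i) \<le> N * x i \<and> N * x i \<le> of_int (a i) + 1" if "i < d" for i
      using that up[OF that] by (simp add: a_def min_def) linarith
    then show "dilate N x \<in> cell a {..<d}"
      using x0 by (auto simp: cell_def dilate_def a_def)
  qed
qed

text \<open>Such a cell has a coordinate frozen at 0 or \<open>N\<close>, hence lies in the boundary
  of the big cube.\<close>

definition on_side :: "nat \<Rightarrow> nat \<Rightarrow> (nat \<Rightarrow> int) \<times> nat set \<Rightarrow> bool" where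
  "on_side N d = (\<lambda>(a, S). \<exists>i<d. i \<notin> S \<and> (a i = 0 \<or> a i = int N))"

lemma on_side_face: "\<lbrakk>on_side N d \<sigma>; face \<tau> \<sigma>\<rbrakk> \<Longrightarrow> on_side N d \<tau>"
  by (cases \<sigma>; cases \<tau>) (force simp: on_side_def face_def)

lemma grid_cover_bd:
  assumes "N > 0" "x \<in> unit_cube_bd d"
  obtains a S where "(a, S) \<in> grid N d" "on_side N d (a, S)" "dilate N x \<in> cell a S"
proof -
  have xc: "x \<in> unit_cube d" using assms(2) cell_bd_subset by blast
  obtain a S where aS: "(a, S) \<in> grid N d" "dilate N x \<in> cell a S"
    using grid_cover[OF assms(1) xc] .
  have "\<exists>i<d. x i = 0 \<or> x i = 1" using assms(2) by (auto simp: cell_bd_def)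
  then obtain i where i: "i < d" "x i = 0 \<or> x i = 1" by blast
  define c where "c = (if x i = 0 then 0 else int N)"
  show thesis
  proof (rule that[of "a(i := c)" "S - {i}"])
    show "(a(i := c), S - {i}) \<in> grid N d"
      using aS(1) i(1) by (auto simp: grid_def c_def)
    show "on_side N d (a(i := c), S - {i})" using i(1) by (auto simp: on_side_def c_def)
    show "dilate N x \<in> cell (a(i := c)) (S - {i})"
      using aS(2) i(2) by (auto simp: cell_def c_def dilate_def)
  qed
qed

lemma on_side_scaled:
  assumes "(a, S) \<in> grid N d" "N > 0" "x \<in> cell a S" "on_side N d (a, S)"
  shows "dilate (1 / N) x \<in> unit_cube_bd d"
proof -
  obtain i where "i < d" "i \<notin> S" "a i = 0 \<or> a i = int N" using assms(4) by (auto simp: on_side_def)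
  then have "\<exists>i\<in>{..<d}. dilate (1 / N) x i = 0 \<or> dilate (1 / N) x i = 1"
    using assms(2,3) by (intro bexI[of _ i]) (auto simp: cell_def dilate_def)
  then show ?thesis using grid_cell_scaled[OF assms(1-3)] by (simp add: cell_bd_def)
qed

lemma closed_cell_bd: "finite S \<Longrightarrow> closed (cell_bd a S)"
proof -
  assume "finite S"
  have "cell_bd a S = cell a S \<inter> (\<Union>i\<in>S. (\<lambda>x. x i) -` {of_int (a i), of_int (a i) + 1})"
    by (auto simp: cell_bd_def)
  moreover have "closed ((\<lambda>x::'a \<Rightarrow> real. x i) -` {of_int (a i), of_int (a i) + 1})" for i
    by (rule closed_vimage) auto
  ultimately show ?thesis using \<open>finite S\<close> by (auto intro!: closed_Int closed_cell)
qed

lemma continuous_on_dilate_const: "continuous_on S (dilate c)"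
  using continuous_on_dilate[OF continuous_on_const continuous_on_id] by simp

text \<open>Push an extension over the whole union off \<open>B - A\<close>: the cells mapped into
  \<open>B\<close> but not into \<open>A\<close> are redefined with values in the intersection.\<close>
lemma cube_ext_cover_part:
  fixes A B :: "'b::topological_space set"
  assumes "openin (top_of_set (A \<union> B)) A" "openin (top_of_set (A \<union> B)) B"
    and "cube_ext d (A \<union> B)" and int: "\<And>j. j \<le> d \<Longrightarrow> cube_ext j (A \<inter> B)"
  shows "cube_ext d A"
  unfolding cube_ext_def
proof (intro allI impI, elim conjE)
  fix f :: "(nat \<Rightarrow> real) \<Rightarrow> 'b"
  assume f: "continuous_on (unit_cube_bd d) f" "f ` unit_cube_bd d \<subseteq> A"
  then obtain g where g: "continuous_on (unit_cube d) g" "g ` unit_cube d \<subseteq> A \<union> B"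
      "\<And>x. x \<in> unit_cube_bd d \<Longrightarrow> g x = f x"
    using assms(3) unfolding cube_ext_def by (metis (no_types, lifting) le_supI1)
  obtain N :: nat where N: "N > 0" "\<And>T. \<lbrakk>T \<subseteq> unit_cube d; \<And>x y i. \<lbrakk>x \<in> T; y \<in> T\<rbrakk> \<Longrightarrow> \<bar>x i - y i\<bar> \<le> 1 / N\<rbrakk>
      \<Longrightarrow> g ` T \<subseteq> A \<or> g ` T \<subseteq> B"
    using fine_mesh[OF closed_cell order_refl g(1,2) assms(1,2)] by blast
  define G where "G = g \<circ> dilate (1 / N)"
  define R where "R = {\<sigma> \<in> grid N d. G ` cl \<sigma> \<subseteq> A}"
  \<comment> \<open>Being mapped into \<open>B\<close> passes to faces, which makes \<open>T\<close>
    monotone. A cell outside \<open>R\<close> lies over \<open>B\<close>, so it is refilled in the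
    intersection; as its dimension can be \<open>d\<close>, the intersection is assumed to extend up
    to and including \<open>d\<close>.\<close>
  define T where "T = (\<lambda>\<sigma>. if G ` cl \<sigma> \<subseteq> B then A \<inter> B else A)"
  have sc: "dilate (1 / N) x \<in> unit_cube d" if "\<sigma> \<in> grid N d" "x \<in> cl \<sigma>" for \<sigma> x
    using grid_cell_scaled[of "fst \<sigma>" "snd \<sigma>"] that N(1) by auto
  have AB: "G ` cl \<sigma> \<subseteq> A \<or> G ` cl \<sigma> \<subseteq> B" if \<sigma>: "\<sigma> \<in> grid N d" for \<sigma>
  proof -
    have "g ` dilate (1 / N) ` cl \<sigma> \<subseteq> A \<or> g ` dilate (1 / N) ` cl \<sigma> \<subseteq> B"
    proof (rule N(2))
      show "\<bar>x i - y i\<bar> \<le> 1 / real N" if "x \<in> dilate (1 / N) ` cl \<sigma>" "y \<in> dilate (1 / N) ` cl \<sigma>" for x y i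
        using that cell_width[of _ "fst \<sigma>" "snd \<sigma>"] N(1)
        by (auto simp: dilate_def abs_mult divide_right_mono simp flip: diff_divide_distrib)
      show "dilate (1 / N) ` cl \<sigma> \<subseteq> unit_cube d" using sc[OF \<sigma>] by blast
    qed
    then show ?thesis by (simp add: G_def image_comp)
  qed
  have mono: "G ` cl \<tau> \<subseteq> G ` cl \<sigma>" if "face \<tau> \<sigma>" for \<sigma> \<tau>
    using face_subset[OF that] by (rule image_mono)
  have "\<exists>g'. continuous_on (\<Union>\<sigma>\<in>grid N d. cl \<sigma>) g' \<and> (\<forall>x\<in>\<Union>\<sigma>\<in>R. cl \<sigma>. g' x = G x) \<and>
              (\<forall>\<sigma>\<in>grid N d. g' ` cl \<sigma> \<subseteq> T \<sigma>)"
  proof (rule carrier_extension)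
    show "finite (snd \<sigma>)" if "\<sigma> \<in> grid N d" for \<sigma>
      by (rule finite_subset[OF grid_subset[OF that] finite_lessThan])
    show "\<tau> \<in> R" if "\<sigma> \<in> R" "face \<tau> \<sigma>" for \<sigma> \<tau>
      using that(1) grid_face[OF _ that(2)] mono[OF that(2)] unfolding R_def by blast
    show "continuous_on (\<Union>\<sigma>\<in>R. cl \<sigma>) G"
      unfolding G_def by (rule continuous_on_comp[OF g(1) continuous_on_dilate_const])
        (use sc in \<open>auto simp: R_def\<close>)
    show "cube_ext (card (snd \<sigma>)) (T \<sigma>)" if "\<sigma> \<in> grid N d - R" for \<sigma>
    proof -
      have "card (snd \<sigma>) \<le> card {..<d}"
        using that by (intro card_mono) (auto simp: grid_def)
      then show ?thesis using that AB[of \<sigma>] int by (auto simp: T_def R_def)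
    qed
    show "T \<tau> \<subseteq> T \<sigma>" if "face \<tau> \<sigma>" for \<sigma> \<tau>
      using mono[OF that] by (auto simp: T_def)
    show "G ` cl \<sigma> \<subseteq> T \<sigma>" if "\<sigma> \<in> R" for \<sigma>
      using that by (auto simp: T_def R_def)
    show "finite (grid N d)" by (rule finite_grid)
    show "R \<subseteq> grid N d" by (auto simp: R_def)
  qed (fact grid_face)
  then obtain g' where ext: "continuous_on (\<Union>\<sigma>\<in>grid N d. cl \<sigma>) g'" "\<forall>x\<in>\<Union>\<sigma>\<in>R. cl \<sigma>. g' x = G x"
      "\<forall>\<sigma>\<in>grid N d. g' ` cl \<sigma> \<subseteq> T \<sigma>"
    by blast
  note g' = ext(1) ext(2)[rule_format] ext(3)[rule_format]
  have cov: "\<exists>\<sigma>\<in>grid N d. dilate N x \<in> cl \<sigma>" if x: "x \<in> unit_cube d" for x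
  proof -
    obtain a S where "(a, S) \<in> grid N d" "dilate N x \<in> cell a S"
      using grid_cover[OF N(1) x] .
    then show ?thesis by (intro bexI[of _ "(a, S)"]) auto
  qed
  show "\<exists>g. continuous_on (unit_cube d) g \<and> g ` unit_cube d \<subseteq> A \<and> (\<forall>x\<in>unit_cube_bd d. g x = f x)"
  proof (intro exI conjI ballI)
    show "continuous_on (unit_cube d) (g' \<circ> dilate N)"
      by (rule continuous_on_comp[OF g'(1) continuous_on_dilate_const]) (use cov in auto)
    show "(g' \<circ> dilate N) ` unit_cube d \<subseteq> A"
    proof (rule image_subsetI)
      fix x assume "x \<in> unit_cube d"
      then obtain \<sigma> where \<sigma>: "\<sigma> \<in> grid N d" "dilate N x \<in> cl \<sigma>" using cov by blast
      have "T \<sigma> \<subseteq> A" by (auto simp: T_def)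
      then show "(g' \<circ> dilate N) x \<in> A" using g'(3)[OF \<sigma>(1)] \<sigma>(2) by auto
    qed
    fix x assume x: "x \<in> unit_cube_bd d"
    obtain a S where aS: "(a, S) \<in> grid N d" "on_side N d (a, S)" "dilate N x \<in> cell a S"
      using grid_cover_bd[OF N(1) x] .
    \<comment> \<open>Boundary cells are mapped into \<open>A\<close> from the start, so they belong
      to \<open>R\<close> and keep their values.\<close>
    have "G ` cell a S \<subseteq> A"
      using on_side_scaled[OF aS(1) N(1) _ aS(2)] f(2) g(3) by (auto simp: G_def)
    then have "(a, S) \<in> R" using aS(1) by (simp add: R_def)
    then have "g' (dilate N x) = G (dilate N x)" using aS(3) by (intro g'(2)) force
    then show "(g' \<circ> dilate N) x = f x" using g(3)[OF x] N(1) by (simp add: G_def)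
  qed
qed

section \<open>Extension over an open box\<close>

definition drop_last :: "nat \<Rightarrow> (nat \<Rightarrow> int) \<times> nat set \<Rightarrow> (nat \<Rightarrow> int) \<times> nat set" where
  "drop_last d = (\<lambda>(a, S). (a(d := 0), S - {d}))"

text \<open>The open box \<open>\<partial>I\<^sup>d \<times> I \<union> I\<^sup>d \<times> {1}\<close>; its base is subdivided into \<open>N\<^sup>d\<close> cubes,
  the last coordinate is not subdivided.\<close>
definition open_box :: "nat \<Rightarrow> nat \<Rightarrow> ((nat \<Rightarrow> int) \<times> nat set) set" where
  "open_box N d = {\<sigma>. drop_last d \<sigma> \<in> grid N d \<and> (d \<in> snd \<sigma> \<longrightarrow> fst \<sigma> d = 0) \<and>
     (d \<notin> snd \<sigma> \<longrightarrow> fst \<sigma> d \<in> {0, 1}) \<and>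
     (on_side N d \<sigma> \<or> d \<notin> snd \<sigma> \<and> fst \<sigma> d = 1)}"

lemma on_side_drop_last: "on_side N d (drop_last d \<sigma>) \<longleftrightarrow> on_side N d \<sigma>"
  by (cases \<sigma>) (auto simp: on_side_def drop_last_def)

lemma face_drop_last: "face \<tau> \<sigma> \<Longrightarrow> face (drop_last d \<tau>) (drop_last d \<sigma>)"
  by (cases \<sigma>; cases \<tau>) (auto simp: face_def drop_last_def)

lemma cell_drop_last: "x \<in> cl \<sigma> \<Longrightarrow> x(d := 0) \<in> cl (drop_last d \<sigma>)"
  by (cases \<sigma>) (auto simp: cell_def drop_last_def)



lemma finite_open_box: "finite (open_box N d)"
proof (rule finite_subset)
  show "open_box N d \<subseteq> (\<lambda>((b, T), c, e). (b(d := c), if e then insert d T else T)) `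
          (grid N d \<times> {0, 1} \<times> UNIV)"
  proof
    fix \<sigma> assume "\<sigma> \<in> open_box N d"
    then have "drop_last d \<sigma> \<in> grid N d" "fst \<sigma> d \<in> {0, 1}" by (auto simp: open_box_def)
    then show "\<sigma> \<in> (\<lambda>((b, T), c, e). (b(d := c), if e then insert d T else T)) `
          (grid N d \<times> {0, 1} \<times> UNIV)"
      by (intro image_eqI[of _ _ "(drop_last d \<sigma>, fst \<sigma> d, d \<in> snd \<sigma>)"])
         (auto simp: drop_last_def case_prod_unfold prod_eq_iff)
  qed
qed (simp add: finite_grid)

lemma open_box_face:
  assumes "\<sigma> \<in> open_box N d" "face \<tau> \<sigma>"
  shows "\<tau> \<in> open_box N d"
proof -
  have "drop_last d \<tau> \<in> grid N d"
    using grid_face[OF _ face_drop_last[OF assms(2)]] assms(1) by (simp add: open_box_def)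
  moreover have "on_side N d \<sigma> \<Longrightarrow> on_side N d \<tau>" using on_side_face assms(2) by blast
  moreover obtain a S b T where [simp]: "\<sigma> = (a, S)" "\<tau> = (b, T)" by (cases \<sigma>; cases \<tau>)
  have ab: "T \<subseteq> S" "d \<notin> S \<or> d \<in> T \<Longrightarrow> b d = a d" "d \<in> S \<Longrightarrow> b d = a d \<or> b d = a d + 1"
    using assms(2) unfolding face_def by auto
  ultimately show ?thesis
    using assms(1) by (cases "d \<in> S") (auto simp: open_box_def)
qed

text \<open>Extending \<open>f\<close> over the open box amounts to a homotopy from \<open>f\<close> to a map into \<open>A\<close>,
  stationary on the cells which \<open>f\<close> already maps into \<open>A\<close>, followed by an extension in \<open>A\<close>.\<close>
lemma cube_ext_cover_union:
  fixes A B :: "'b::topological_space set"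
  assumes oA: "openin (top_of_set (A \<union> B)) A" and oB: "openin (top_of_set (A \<union> B)) B"
    and extA: "\<And>j. j \<le> d \<Longrightarrow> cube_ext j A" and extB: "\<And>j. j \<le> d \<Longrightarrow> cube_ext j B"
    and int: "\<And>j. j < d \<Longrightarrow> cube_ext j (A \<inter> B)"
  shows "cube_ext d (A \<union> B)"
proof (cases d)
  case 0
  then show ?thesis using extA[of 0] by (auto simp: cube_ext_0)
next
  case (Suc n)
  show ?thesis
    unfolding cube_ext_def
  proof (intro allI impI, elim conjE)
    fix f :: "(nat \<Rightarrow> real) \<Rightarrow> 'b"
    assume f: "continuous_on (unit_cube_bd d) f" "f ` unit_cube_bd d \<subseteq> A \<union> B"
    obtain N :: nat where N: "N > 0" "\<And>T. \<lbrakk>T \<subseteq> unit_cube_bd d; \<And>x y i. \<lbrakk>x \<in> T; y \<in> T\<rbrakk> \<Longrightarrow> \<bar>x i - y i\<bar> \<le> 1 / N\<rbrakk>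
        \<Longrightarrow> f ` T \<subseteq> A \<or> f ` T \<subseteq> B"
      using fine_mesh[OF closed_cell_bd cell_bd_subset f oA oB] by blast
    \<comment> \<open>Projection to the base, scaled back to the unit cube; \<open>F\<close> is thus
      the homotopy that is constant in the last coordinate.\<close>
    define \<pi> where "\<pi> = (\<lambda>x::nat \<Rightarrow> real. dilate (1 / N) (x(d := 0)))"
    define F where "F = f \<circ> \<pi>"
    define top where "top = (\<lambda>\<sigma>::(nat \<Rightarrow> int) \<times> nat set. d \<notin> snd \<sigma> \<and> fst \<sigma> d = 1)"
    define bot where "bot = (\<lambda>\<sigma>::(nat \<Rightarrow> int) \<times> nat set. d \<notin> snd \<sigma> \<and> fst \<sigma> d = 0)"
    \<comment> \<open>Prescribed cells: the bottom edge of the walls, where the map must be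
      \<open>f\<close>, and the wall cells over which \<open>f\<close> already lies in
      \<open>A\<close>.\<close>
    define R where "R = {\<sigma> \<in> open_box N d. on_side N d \<sigma> \<and> (bot \<sigma> \<or> F ` cl \<sigma> \<subseteq> A)}"
    \<comment> \<open>A wall cell that is not prescribed lies over \<open>B\<close>. It moves inside
      \<open>B\<close>, its upper end must land in \<open>A \<inter> B\<close>, and the rest of the
      lid is then filled inside \<open>A\<close>.\<close>
    define T where "T = (\<lambda>\<sigma>. if on_side N d \<sigma> then
       (if top \<sigma> then (if F ` cl \<sigma> \<subseteq> B then A \<inter> B else A)
        else (if F ` cl \<sigma> \<subseteq> B then B else A \<union> B)) else A)"
    have \<pi>bd: "\<pi> x \<in> unit_cube_bd d" if "\<sigma> \<in> open_box N d" "on_side N d \<sigma>" "x \<in> cl \<sigma>" for \<sigma> x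
      unfolding \<pi>_def
      by (rule on_side_scaled[of "fst (drop_last d \<sigma>)" "snd (drop_last d \<sigma>)"])
         (use that N(1) cell_drop_last in \<open>auto simp: open_box_def on_side_drop_last\<close>)
    have AB: "F ` cl \<sigma> \<subseteq> A \<or> F ` cl \<sigma> \<subseteq> B" if \<sigma>: "\<sigma> \<in> open_box N d" "on_side N d \<sigma>" for \<sigma>
    proof -
      have "f ` \<pi> ` cl \<sigma> \<subseteq> A \<or> f ` \<pi> ` cl \<sigma> \<subseteq> B"
      proof (rule N(2))
        show "\<pi> ` cl \<sigma> \<subseteq> unit_cube_bd d" using \<pi>bd[OF \<sigma>] by blast
        show "\<bar>x i - y i\<bar> \<le> 1 / real N" if "x \<in> \<pi> ` cl \<sigma>" "y \<in> \<pi> ` cl \<sigma>" for x y i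
          using that cell_width[of _ "fst \<sigma>" "snd \<sigma>"] N(1)
          by (auto simp: \<pi>_def dilate_def abs_mult divide_right_mono simp flip: diff_divide_distrib)
      qed
      then show ?thesis by (simp add: F_def image_comp)
    qed
    have mono: "F ` cl \<tau> \<subseteq> F ` cl \<sigma>" if "face \<tau> \<sigma>" for \<sigma> \<tau>
      using face_subset[OF that] by (rule image_mono)
    have topface: "top \<tau>" if "top \<sigma>" "face \<tau> \<sigma>" for \<sigma> \<tau>
      using that by (cases \<sigma>; cases \<tau>) (auto simp: top_def face_def)
    have botface: "bot \<tau>" if "bot \<sigma>" "face \<tau> \<sigma>" for \<sigma> \<tau>
      using that by (cases \<sigma>; cases \<tau>) (auto simp: bot_def face_def)
    have c\<pi>: "continuous_on S \<pi>" for S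
    proof -
      have "continuous_on S (\<lambda>x i. if i = d then 0 else (1 / real N) * x i)"
        by (intro continuous_on_coordinatewise_then_product continuous_on_If_const continuous_intros)
      also have "(\<lambda>x i. if i = d then 0 else (1 / real N) * x i) = \<pi>"
        by (auto simp: \<pi>_def dilate_def fun_eq_iff)
      finally show ?thesis .
    qed
    have fin: "finite (snd \<sigma>)" "snd \<sigma> \<subseteq> {..d}" if "\<sigma> \<in> open_box N d" for \<sigma>
    proof -
      have "snd \<sigma> - {d} \<subseteq> {..<d}"
        using grid_subset[of "drop_last d \<sigma>"] that by (auto simp: open_box_def drop_last_def case_prod_unfold)
      then show "snd \<sigma> \<subseteq> {..d}" by (auto simp: subset_iff less_le)
      then show "finite (snd \<sigma>)" by (rule finite_subset) simp
    qed
    have sideT: "\<not> {..<d} \<subseteq> snd \<sigma>" if "on_side N d \<sigma>" for \<sigma>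
      using that by (auto simp: on_side_def)
    have "\<exists>g'. continuous_on (\<Union>\<sigma>\<in>open_box N d. cl \<sigma>) g' \<and> (\<forall>x\<in>\<Union>\<sigma>\<in>R. cl \<sigma>. g' x = F x) \<and>
                (\<forall>\<sigma>\<in>open_box N d. g' ` cl \<sigma> \<subseteq> T \<sigma>)"
    proof (rule carrier_extension)
      show "\<tau> \<in> R" if "\<sigma> \<in> R" "face \<tau> \<sigma>" for \<sigma> \<tau>
        using that(1) open_box_face[OF _ that(2)] on_side_face[OF _ that(2)] mono[OF that(2)]
          botface[OF _ that(2)] unfolding R_def by blast
      show "continuous_on (\<Union>\<sigma>\<in>R. cl \<sigma>) F"
        unfolding F_def by (rule continuous_on_comp[OF f(1) c\<pi>]) (use \<pi>bd in \<open>auto simp: R_def\<close>)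
      show "F ` cl \<sigma> \<subseteq> T \<sigma>" if "\<sigma> \<in> R" for \<sigma>
      proof -
        have "F ` cl \<sigma> \<subseteq> A \<union> B" using AB[of \<sigma>] that by (auto simp: R_def)
        moreover have "top \<sigma> \<Longrightarrow> F ` cl \<sigma> \<subseteq> A" using that by (auto simp: R_def top_def bot_def)
        moreover have "on_side N d \<sigma>" using that by (simp add: R_def)
        ultimately show ?thesis by (auto simp: T_def)
      qed
      show "cube_ext (card (snd \<sigma>)) (T \<sigma>)" if \<sigma>: "\<sigma> \<in> open_box N d - R" for \<sigma>
      proof (cases "on_side N d \<sigma>")
        case True
        then have B: "F ` cl \<sigma> \<subseteq> B" using AB[of \<sigma>] \<sigma> by (auto simp: R_def)
        show ?thesis
        proof (cases "top \<sigma>")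
          case t: True
          \<comment> \<open>A wall cell misses at least one of the first \<open>d\<close>
            directions, and a top cell also misses the last. Hence the intersection is only asked to
            extend in dimensions below \<open>d\<close>.\<close>
          have "snd \<sigma> \<subset> {..<d}"
            using sideT[OF True] fin(2)[of \<sigma>] \<sigma> t by (auto simp: top_def subset_iff less_le)
          then have "card (snd \<sigma>) < card {..<d}" by (intro psubset_card_mono) auto
          then show ?thesis using B t True int by (simp add: T_def)
        next
          case False
          have "snd \<sigma> \<subset> {..d}"
            using sideT[OF True] fin(2)[of \<sigma>] \<sigma> by auto
          then have "card (snd \<sigma>) < card {..d}" by (intro psubset_card_mono) auto
          then show ?thesis using B False True extB by (simp add: T_def)
        qed
      next
        case False
        then have "snd \<sigma> \<subseteq> {..<d}"
          using \<sigma> fin(2)[of \<sigma>] by (auto simp: open_box_def subset_iff less_le)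
        then have "card (snd \<sigma>) \<le> card {..<d}" by (intro card_mono) auto
        then show ?thesis using False extA by (simp add: T_def)
      qed
      show "T \<tau> \<subseteq> T \<sigma>" if "\<sigma> \<in> open_box N d" "face \<tau> \<sigma>" for \<sigma> \<tau>
      proof (cases "on_side N d \<sigma>")
        case True
        then have "on_side N d \<tau>" using on_side_face that(2) by blast
        then show ?thesis using True mono[OF that(2)] topface[OF _ that(2)] by (auto simp: T_def)
      next
        case False
        then have "top \<sigma>" using that(1) by (auto simp: open_box_def top_def)
        then have "top \<tau>" using topface that(2) by blast
        then show ?thesis using False by (auto simp: T_def)
      qed
      show "R \<subseteq> open_box N d" by (auto simp: R_def)
    qed (fact finite_open_box fin(1) open_box_face)+
    then obtain g where ext: "continuous_on (\<Union>\<sigma>\<in>open_box N d. cl \<sigma>) g" "\<forall>x\<in>\<Union>\<sigma>\<in>R. cl \<sigma>. g x = F x"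
        "\<forall>\<sigma>\<in>open_box N d. g ` cl \<sigma> \<subseteq> T \<sigma>"
      by blast
    note g = ext(1) ext(2)[rule_format] ext(3)[rule_format]
    have gAB: "g x \<in> A \<union> B" if x: "x \<in> (\<Union>\<sigma>\<in>open_box N d. cl \<sigma>)" for x
    proof -
      obtain \<sigma> where \<sigma>: "\<sigma> \<in> open_box N d" "x \<in> cl \<sigma>" using x by blast
      have "T \<sigma> \<subseteq> A \<union> B" by (auto simp: T_def)
      then show ?thesis using g(3)[OF \<sigma>(1)] \<sigma>(2) by blast
    qed
    define m where "m = (\<lambda>x. sup_norm n (centre n x))"
    \<comment> \<open>The map \<open>\<phi>\<close> folds the cube onto the open box: the core of
      sup norm at most 1/2 is doubled and becomes the lid, and the shell becomes the walls, with
      height falling from 1 to 0 towards the boundary. The maxima and minima merge the two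
      formulas.\<close>
    define w where "w = (\<lambda>x. uncentre n (dilate (1 / max (m x) (1/2)) (centre n x)))"
    define \<phi> where "\<phi> = (\<lambda>x. (dilate N (w x))(d := min 1 (2 - 2 * m x)))"
    have cm: "continuous_on S m" for S
      unfolding m_def using continuous_on_compose2[OF continuous_on_sup_norm continuous_on_centre] by blast
    have c0: "continuous_on S (\<lambda>x. dilate (1 / max (m x) (1/2)) (centre n x))" for S
      by (intro continuous_on_dilate continuous_intros continuous_on_centre continuous_on_max cm)
         (auto simp: max_def)
    have cw: "continuous_on S (\<lambda>x. dilate N (w x))" for S
      using continuous_on_dilate[OF continuous_on_const continuous_on_compose2[OF continuous_on_uncentre[of UNIV n] c0]]
      by (simp add: w_def)
    have c\<phi>: "continuous_on S \<phi>" for S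
      unfolding \<phi>_def fun_upd_def
      by (intro continuous_on_coordinatewise_then_product continuous_on_If_const continuous_intros
            continuous_on_min cm continuous_on_product_then_coordinatewise[OF cw])
    have sw: "sup_norm n (dilate (1 / max (m x) (1/2)) (centre n x)) = m x / max (m x) (1/2)" for x
      by (simp add: sup_norm_dilate m_def max_def)
    have m1: "0 \<le> m x" "m x \<le> 1" if "x \<in> unit_cube d" for x
      using that centre_in(1)[of x n] sup_norm_nonneg by (auto simp: m_def Suc)
    have wc: "w x \<in> unit_cube d" for x
      unfolding w_def Suc by (rule uncentre_in, subst sw) (simp add: max_def)
    have wb: "w x \<in> unit_cube_bd d" if "1/2 \<le> m x" for x
      unfolding w_def Suc by (rule uncentre_bd, subst sw) (use that in \<open>simp add: max_def\<close>)
    have w0: "w x = x" if "x \<in> unit_cube_bd d" for x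
      using centre_bd[of x n] centre_in(3)[of x n] subsetD[OF cell_bd_subset that] that
      unfolding w_def m_def Suc by simp
    have \<phi>c: "\<phi> x \<in> (\<Union>\<sigma>\<in>open_box N d. cl \<sigma>)" if x: "x \<in> unit_cube d" for x
    proof (cases "1/2 \<le> m x")
      case True
      obtain a S where aS: "(a, S) \<in> grid N d" "on_side N d (a, S)" "dilate N (w x) \<in> cell a S"
        using grid_cover_bd[OF N(1) wb[OF True]] .
      have S: "d \<notin> S" "a d = 0" using aS(1) by (auto simp: grid_def)
      then have "drop_last d (a, insert d S) = (a, S)" by (auto simp: drop_last_def)
      moreover have "on_side N d (a, insert d S)" using aS(2) by (auto simp: on_side_def)
      ultimately have "(a, insert d S) \<in> open_box N d" using aS(1) S by (simp add: open_box_def)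
      moreover have "\<phi> x \<in> cell a (insert d S)"
        using aS(3) S m1[OF x] True by (auto simp: \<phi>_def cell_def)
      ultimately show ?thesis by force
    next
      case False
      obtain a S where aS: "(a, S) \<in> grid N d" "dilate N (w x) \<in> cell a S"
        using grid_cover[OF N(1) wc] .
      have S: "d \<notin> S" "a d = 0" using aS(1) by (auto simp: grid_def)
      then have "drop_last d (a(d := 1), S) = (a, S)" by (auto simp: drop_last_def)
      then have "(a(d := 1), S) \<in> open_box N d" using aS(1) S by (simp add: open_box_def)
      moreover have "\<phi> x \<in> cell (a(d := 1)) S"
        using aS(2) S False by (auto simp: \<phi>_def cell_def)
      ultimately show ?thesis by force
    qed
    have "g (\<phi> x) = f x" if x: "x \<in> unit_cube_bd d" for x
    proof -
      obtain a S where aS: "(a, S) \<in> grid N d" "on_side N d (a, S)" "dilate N x \<in> cell a S"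
        using grid_cover_bd[OF N(1) x] .
      have S: "d \<notin> S" "a d = 0" using aS(1) by (auto simp: grid_def)
      then have "drop_last d (a, S) = (a, S)" by (auto simp: drop_last_def)
      then have "(a, S) \<in> R" using aS S by (simp add: R_def open_box_def bot_def)
      moreover have "m x = 1" using x centre_bd[of x n] by (simp add: m_def Suc)
      then have \<phi>x: "\<phi> x = (dilate N x)(d := 0)" by (simp add: \<phi>_def w0[OF x])
      moreover have xd: "x d = 0" using x by (auto simp: cell_bd_def cell_def)
      then have "(dilate N x)(d := 0) = dilate N x" by (auto simp: dilate_def)
      ultimately have "g (\<phi> x) = F (dilate N x)" using aS(3) by (force intro!: g(2))
      also have "\<dots> = f x"
        using \<open>(dilate N x)(d := 0) = dilate N x\<close> N(1) by (simp add: F_def \<pi>_def)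
      finally show ?thesis .
    qed
    moreover have "continuous_on (unit_cube d) (g \<circ> \<phi>)"
      by (rule continuous_on_comp[OF g(1) c\<phi> \<phi>c])
    moreover have "(g \<circ> \<phi>) ` unit_cube d \<subseteq> A \<union> B" using gAB[OF \<phi>c] by auto
    ultimately show "\<exists>g. continuous_on (unit_cube d) g \<and> g ` unit_cube d \<subseteq> A \<union> B \<and> (\<forall>x\<in>unit_cube_bd d. g x = f x)"
      by (intro exI[of _ "g \<circ> \<phi>"]) simp
  qed
qed

text \<open>The index is shifted by two: \<open>cconn n Y\<close> says that \<open>conn Y\<close> is at least \<open>n - 2\<close>, and extending a
  map from the empty boundary of the \<open>0\<close>-cube means that \<open>Y\<close> is nonempty.
  The same shift is used for \<open>hconn\<close> below.\<close>
definition cconn :: "nat \<Rightarrow> 'b::topological_space set \<Rightarrow> bool" where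
  "cconn n Y \<longleftrightarrow> (\<forall>d<n. cube_ext d Y)"

section \<open>Homotopy invariance of the extension property\<close>

text \<open>A homotopy alters boundary values, so the argument passes to spheres:
  \<open>k \<circ> f\<close> contracts in \<open>Z\<close>, hence \<open>f\<close>, being homotopic
  to \<open>l \<circ> k \<circ> f\<close>, contracts in \<open>Y\<close>.\<close>

lemma cube_ext_homotopy_equivalent:
  assumes eq: "top_of_set Y homotopy_equivalent_space top_of_set Z" and Z: "cube_ext d Z"
  shows "cube_ext d Y"
proof -
  obtain k l where k: "continuous_map (top_of_set Y) (top_of_set Z) k"
    and l: "continuous_map (top_of_set Z) (top_of_set Y) l"
    and lk: "homotopic_with (\<lambda>x. True) (top_of_set Y) (top_of_set Y) (l \<circ> k) id"
    using eq unfolding homotopy_equivalent_space_def by blast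
  show ?thesis
  proof (cases d)
    case 0
    have "Z \<noteq> {}" using Z 0 by (simp add: cube_ext_0)
    then show ?thesis using l 0 by (auto simp: cube_ext_0 image_subset_iff)
  next
    case (Suc i)
    show ?thesis
      unfolding Suc cube_ext_Suc
    proof (intro allI impI)
      fix f assume f: "continuous_map (nsphere i) (top_of_set Y) f"
      obtain c where "homotopic_with (\<lambda>_. True) (nsphere i) (top_of_set Z) (k \<circ> f) (\<lambda>_. c)"
        using Z continuous_map_compose[OF f k] unfolding Suc cube_ext_Suc by blast
      then have "homotopic_with (\<lambda>_. True) (nsphere i) (top_of_set Y) (l \<circ> (k \<circ> f)) (l \<circ> (\<lambda>_. c))"
        by (rule homotopic_with_compose_continuous_map_left[OF _ l]) simp
      moreover have "homotopic_with (\<lambda>_. True) (nsphere i) (top_of_set Y) ((l \<circ> k) \<circ> f) (id \<circ> f)"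
        by (rule homotopic_with_compose_continuous_map_right[OF lk f]) simp
      then have "homotopic_with (\<lambda>_. True) (nsphere i) (top_of_set Y) f (l \<circ> (k \<circ> f))"
        by (simp add: comp_assoc homotopic_with_sym)
      ultimately have "homotopic_with (\<lambda>_. True) (nsphere i) (top_of_set Y) f (l \<circ> (\<lambda>_. c))"
        by (rule homotopic_with_trans[rotated])
      then have "homotopic_with (\<lambda>_. True) (nsphere i) (top_of_set Y) f (\<lambda>_. l c)"
        by (simp add: comp_def)
      then show "\<exists>c. homotopic_with (\<lambda>_. True) (nsphere i) (top_of_set Y) f (\<lambda>_. c)" ..
    qed
  qed
qed

lemma cube_ext_contractible:
  assumes "contractible_space (top_of_set Y)" "Y \<noteq> {}"
  shows "cube_ext d Y"
proof (cases d)
  case (Suc i)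
  show ?thesis
    unfolding Suc cube_ext_Suc
  proof (intro allI impI)
    fix f assume f: "continuous_map (nsphere i) (top_of_set Y) f"
    obtain c where "homotopic_with (\<lambda>_. True) (nsphere i) (top_of_set Y) f (\<lambda>_. c)"
      using nullhomotopic_into_contractible_space[OF f assms(1)] by meson
    then show "\<exists>c. homotopic_with (\<lambda>_. True) (nsphere i) (top_of_set Y) f (\<lambda>_. c)" ..
  qed
next
  case 0
  with assms(2) show ?thesis by (simp add: cube_ext_0)
qed

section \<open>Geometric realizations\<close>

lemma straight_line_homotopic:
  fixes f g :: "'x::topological_space \<Rightarrow> 'i \<Rightarrow> real"
  assumes "continuous_on S f" "continuous_on S g"
    and "\<And>x t. \<lbrakk>x \<in> S; 0 \<le> t; t \<le> 1\<rbrakk> \<Longrightarrow> (\<lambda>i. (1 - t) * f x i + t * g x i) \<in> T"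
  shows "homotopic_with_canon (\<lambda>_. True) S T f g"
  unfolding homotopic_with_def
proof (intro exI conjI allI ballI)
  let ?h = "\<lambda>z i. (1 - fst z) * f (snd z) i + fst z * g (snd z) i"
  have fg: "continuous_on ({0..1::real} \<times> S) (\<lambda>z. f (snd z))" "continuous_on ({0..1::real} \<times> S) (\<lambda>z. g (snd z))"
    by (rule continuous_on_compose2[OF assms(1) continuous_on_snd[OF continuous_on_id]], force)
       (rule continuous_on_compose2[OF assms(2) continuous_on_snd[OF continuous_on_id]], force)
  have "continuous_on ({0..1} \<times> S) ?h"
    by (intro continuous_on_coordinatewise_then_product continuous_intros
          continuous_on_product_then_coordinatewise[OF fg(1)] continuous_on_product_then_coordinatewise[OF fg(2)])
  then show "continuous_map (prod_topology (top_of_set {0..1}) (top_of_set S)) (top_of_set T) ?h"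
    using assms(3) by auto
qed auto

definition simplicial :: "'a set \<Rightarrow> 'a set set \<Rightarrow> bool" where
  "simplicial V K \<longleftrightarrow> finite V \<and> K \<subseteq> Pow V \<and> (\<forall>S\<in>K. \<forall>T. T \<subseteq> S \<longrightarrow> T \<in> K)"

definition supp :: "('a \<Rightarrow> real) \<Rightarrow> 'a set" where
  "supp x = {v. x v \<noteq> 0}"

definition comb :: "real \<Rightarrow> ('a \<Rightarrow> real) \<Rightarrow> ('a \<Rightarrow> real) \<Rightarrow> 'a \<Rightarrow> real" where
  "comb t x y = (\<lambda>v. (1 - t) * x v + t * y v)"

lemma geom_eq: "geom V K = top_of_set (realization V K)"
  by (simp add: geom_def euclidean_product_topology)

lemma realization_iff:
  "simplicial V K \<Longrightarrow> x \<in> realization V K \<longleftrightarrow> (\<forall>v. 0 \<le> x v) \<and> (\<Sum>v\<in>V. x v) = 1 \<and> supp x \<in> K"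
  by (auto simp: realization_def simplicial_def supp_def)

lemma realization_mono: "K \<subseteq> L \<Longrightarrow> realization V K \<subseteq> realization V L"
  by (auto simp: realization_def)

lemma supp_comb: "supp (comb t x y) \<subseteq> supp x \<union> supp y"
  by (auto simp: supp_def comb_def)

lemma comb_0 [simp]: "comb 0 x y = x" and comb_1 [simp]: "comb 1 x y = y"
  by (auto simp: comb_def)

lemma realization_comb:
  assumes K: "simplicial V K" and x: "x \<in> realization V K" and y: "y \<in> realization V L"
    and "simplicial V L" "supp x \<union> supp y \<in> K" "0 \<le> t" "t \<le> 1"
  shows "comb t x y \<in> realization V K"
proof -
  have "(\<Sum>v\<in>V. comb t x y v) = (1 - t) * (\<Sum>v\<in>V. x v) + t * (\<Sum>v\<in>V. y v)"
    by (simp add: comb_def sum.distrib sum_distrib_left)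
  then have "(\<Sum>v\<in>V. comb t x y v) = 1"
    using x y K assms(4) by (simp add: realization_iff)
  moreover have "supp (comb t x y) \<in> K"
    using K assms(5) supp_comb[of t x y] by (auto simp: simplicial_def)
  ultimately show ?thesis
    using x y K assms(4,6,7) by (auto simp: realization_iff) (simp add: comb_def)
qed

lemma continuous_on_comb:
  assumes "continuous_on S t" "continuous_on S f" "continuous_on S g"
  shows "continuous_on S (\<lambda>x. comb (t x) (f x) (g x))"
  unfolding comb_def
  by (intro continuous_on_coordinatewise_then_product continuous_intros assms(1)
        continuous_on_product_then_coordinatewise[OF assms(2)] continuous_on_product_then_coordinatewise[OF assms(3)])

lemma comb_homotopic:
  assumes "continuous_on S f" "continuous_on S g"
    and "\<And>x t. \<lbrakk>x \<in> S; 0 \<le> t; t \<le> 1\<rbrakk> \<Longrightarrow> comb t (f x) (g x) \<in> T"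
  shows "homotopic_with_canon (\<lambda>_. True) S T f g"
  by (rule straight_line_homotopic) (use assms in \<open>auto simp: comb_def\<close>)

lemma simplicial_Pow: "finite V \<Longrightarrow> simplicial V (Pow V)"
  by (auto simp: simplicial_def)

text \<open>Every face can be enlarged by \<open>w\<close>, so the segment from any point to the
  vertex \<open>w\<close> stays inside.\<close>

lemma contractible_cone:
  assumes K: "simplicial V K" and w: "w \<in> V" "\<And>S. S \<in> K \<Longrightarrow> insert w S \<in> K" "K \<noteq> {}"
  shows "contractible_space (top_of_set (realization V K))" "realization V K \<noteq> {}"
proof -
  define e where "e = (\<lambda>v. if v = w then 1 else 0 :: real)"
  have supp_e: "supp e = {w}" by (auto simp: supp_def e_def)
  have "{w} \<in> K" using w(2,3) K by (fastforce simp: simplicial_def)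
  then have e: "e \<in> realization V K"
    using K w(1) supp_e by (simp add: realization_iff) (simp add: e_def simplicial_def)
  then show "realization V K \<noteq> {}" by blast
  have "homotopic_with_canon (\<lambda>_. True) (realization V K) (realization V K) id (\<lambda>_. e)"
  proof (rule comb_homotopic)
    fix x t assume x: "x \<in> realization V K" and t: "0 \<le> t" "t \<le> (1::real)"
    have "supp x \<union> supp e \<in> K" using w(2) x K by (simp add: realization_iff supp_e)
    then show "comb t (id x) e \<in> realization V K"
      using realization_comb[OF K x e K _ t] by simp
  qed (auto intro: continuous_on_id)
  then show "contractible_space (top_of_set (realization V K))"
    unfolding contractible_space_def by blast
qed

section \<open>The open cover of a complex at one of its faces\<close>

locale face_star =
  fixes V :: "'a set" and K :: "'a set set" and F :: "'a set"
  assumes K: "simplicial V K" and FK: "F \<in> K" and F_ne: "F \<noteq> {}"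
begin

text \<open>Measures closeness to the barycentre of \<open>F\<close>: it is positive exactly when
  the support contains \<open>F\<close>, and \<open>m * height x\<close> reaches its maximum 1 only
  at the barycentre.\<close>

definition height :: "('a \<Rightarrow> real) \<Rightarrow> real" where "height x = Min (x ` F)"
definition m :: real where "m = real (card F)"
definition bary :: "'a \<Rightarrow> real" where "bary v = (if v \<in> F then 1 / m else 0)"
definition X :: "('a \<Rightarrow> real) set" where "X = realization V K"
definition del :: "'a set set" where "del = {S \<in> K. \<not> F \<subseteq> S}"
text \<open>The intersection of \<open>del\<close> with the closed star of \<open>F\<close>, that is
  the join of the boundary of \<open>F\<close> with the link of \<open>F\<close>.\<close>

definition rim :: "'a set set" where "rim = {S \<in> K. \<not> F \<subseteq> S \<and> S \<union> F \<in> K}"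
text \<open>The complex without the barycentre of \<open>F\<close>; the set \<open>B\<close> below
  is the open star of \<open>F\<close>.\<close>

definition A :: "('a \<Rightarrow> real) set" where "A = {x \<in> X. m * height x < 1}"
definition B :: "('a \<Rightarrow> real) set" where "B = {x \<in> X. 0 < height x}"
text \<open>Projection from the barycentre: the multiple of \<open>bary\<close> contained in
  \<open>x\<close> is subtracted and the remaining mass is normalised to 1.\<close>

definition retr :: "('a \<Rightarrow> real) \<Rightarrow> 'a \<Rightarrow> real" where
  "retr x = (\<lambda>v. (x v - (if v \<in> F then height x else 0)) / (1 - m * height x))"

lemma finF: "finite F"
  using K FK finite_subset by (auto simp: simplicial_def)

lemma FV: "F \<subseteq> V" and finV: "finite V"
  using K FK by (auto simp: simplicial_def)

lemma m_ge_1: "1 \<le> m"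
  using finF F_ne card_gt_0_iff[of F] by (simp add: m_def)

lemma simplicial_del: "simplicial V del" and simplicial_rim: "simplicial V rim"
proof -
  show "simplicial V del" using K by (auto simp: simplicial_def del_def)
  have "T \<union> F \<in> K" if "S \<union> F \<in> K" "T \<subseteq> S" for S T
  proof -
    have "T \<union> F \<subseteq> S \<union> F" using that by auto
    then show ?thesis using that(1) K unfolding simplicial_def by blast
  qed
  then show "simplicial V rim" using K by (auto simp: simplicial_def rim_def)
qed

lemma height_le: "v \<in> F \<Longrightarrow> height x \<le> x v"
  unfolding height_def using finF by (auto intro: Min_le)

lemma height_attained: obtains v where "v \<in> F" "height x = x v"
proof -
  have "height x \<in> x ` F" unfolding height_def using finF F_ne by (intro Min_in) auto
  then show thesis using that by auto
qed

lemma height_eqI: "\<lbrakk>\<And>v. v \<in> F \<Longrightarrow> c \<le> x v; v \<in> F; x v = c\<rbrakk> \<Longrightarrow> height x = c"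
  by (metis height_le height_attained order_antisym)

lemma continuous_on_height: "continuous_on S height"
  unfolding height_def by (intro continuous_on_Min_family finF F_ne continuous_intros)

lemma X_iff: "x \<in> X \<longleftrightarrow> (\<forall>v. 0 \<le> x v) \<and> (\<Sum>v\<in>V. x v) = 1 \<and> supp x \<in> K"
  by (simp add: X_def realization_iff[OF K])

lemma height_nonneg: "x \<in> X \<Longrightarrow> 0 \<le> height x"
  by (metis height_attained X_iff)

lemma height_pos_iff: "x \<in> X \<Longrightarrow> 0 < height x \<longleftrightarrow> F \<subseteq> supp x"
proof
  assume x: "x \<in> X" "0 < height x"
  show "F \<subseteq> supp x"
  proof
    fix v assume "v \<in> F"
    then have "0 < x v" using height_le[of v x] x(2) by linarith
    then show "v \<in> supp x" by (simp add: supp_def)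
  qed
next
  assume x: "x \<in> X" "F \<subseteq> supp x"
  obtain v where v: "v \<in> F" "height x = x v" by (rule height_attained)
  then have "x v \<noteq> 0" using x by (auto simp: supp_def)
  then show "0 < height x" using v x(1) X_iff by (simp add: less_le)
qed

lemma del_iff: "x \<in> realization V del \<longleftrightarrow> x \<in> X \<and> height x = 0"
  unfolding realization_iff[OF simplicial_del]
  using height_pos_iff[of x] height_nonneg[of x] X_iff[of x] by (auto simp: del_def)

lemma rim_iff: "x \<in> realization V rim \<longleftrightarrow> x \<in> X \<and> height x = 0 \<and> supp x \<union> F \<in> K"
  unfolding realization_iff[OF simplicial_rim]
  using height_pos_iff[of x] height_nonneg[of x] X_iff[of x] by (auto simp: rim_def)

lemma supp_bary: "supp bary = F"
  using m_ge_1 by (auto simp: supp_def bary_def)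

lemma bary_X: "bary \<in> X"
proof -
  have "(\<Sum>v\<in>V. bary v) = (\<Sum>v\<in>F. 1 / m)"
    using finV FV by (simp add: bary_def sum.If_cases Int_absorb1)
  also have "\<dots> = 1" using m_ge_1 by (simp add: m_def)
  finally show ?thesis using supp_bary FK m_ge_1 by (simp add: X_iff) (simp add: bary_def)
qed

lemma height_comb:
  assumes "x \<in> X" "height x = 0" "0 \<le> u" "u \<le> 1"
  shows "height (comb u x bary) = u / m"
proof -
  obtain v where v: "v \<in> F" "height x = x v" by (rule height_attained)
  show ?thesis
  proof (rule height_eqI[OF _ v(1)])
    show "comb u x bary v = u / m" using v assms(2) by (simp add: comb_def bary_def)
    show "u / m \<le> comb u x bary w" if "w \<in> F" for w
      using that assms X_iff[of x] by (simp add: comb_def bary_def)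
  qed
qed

text \<open>Together with \<open>retr_comb\<close> this makes \<open>retr x\<close> and
  \<open>m * height x\<close> polar coordinates about the barycentre, the second being 0 on
  \<open>del\<close> and 1 at the centre.\<close>

lemma comb_retr:
  assumes "m * height x < 1" shows "comb (m * height x) (retr x) bary = x"
  using assms m_ge_1 by (auto simp: comb_def retr_def bary_def fun_eq_iff)

lemma retr_comb:
  assumes "x \<in> X" "height x = 0" "0 \<le> u" "u < 1"
  shows "retr (comb u x bary) = x"
  using assms(3,4) m_ge_1 height_comb[OF assms(1-3)]
  by (auto simp: retr_def comb_def bary_def fun_eq_iff)

lemma supp_retr: "supp (retr x) \<subseteq> supp x \<union> F"
  by (auto simp: supp_def retr_def)

text \<open>Subtracting the minimum over \<open>F\<close> kills a coordinate where it is attained,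
  so the support no longer contains \<open>F\<close>. At positive height \<open>F\<close> was part
  of the support, so \<open>supp (retr x) \<union> F\<close> is still a face.\<close>

lemma retr_del:
  assumes x: "x \<in> A" shows "retr x \<in> realization V del" "0 < height x \<Longrightarrow> retr x \<in> realization V rim"
proof -
  have xX: "x \<in> X" and h: "m * height x < 1" using x by (auto simp: A_def)
  have sub: "supp (retr x) \<subseteq> supp x"
  proof (cases "height x = 0")
    case True
    then show ?thesis by (auto simp: retr_def supp_def)
  next
    case False
    then have "F \<subseteq> supp x" using height_pos_iff[OF xX] height_nonneg[OF xX] by simp
    then show ?thesis using supp_retr by blast
  qed
  then have "supp (retr x) \<in> K" using xX K unfolding X_iff simplicial_def by blast
  moreover have "0 \<le> retr x v" for v
    using h height_le[of v x] xX unfolding X_iff by (auto simp: retr_def)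
  moreover have "(\<Sum>v\<in>V. retr x v) = 1"
  proof -
    have "(\<Sum>v\<in>V. retr x v) = ((\<Sum>v\<in>V. x v) - (\<Sum>v\<in>V. if v \<in> F then height x else 0)) / (1 - m * height x)"
      by (simp add: retr_def sum_subtractf flip: sum_divide_distrib)
    also have "(\<Sum>v\<in>V. if v \<in> F then height x else 0) = m * height x"
      using finV FV by (simp add: sum.If_cases Int_absorb1 m_def)
    finally show ?thesis using xX h by (simp add: X_iff)
  qed
  ultimately have rX: "retr x \<in> X" by (simp add: X_iff)
  obtain v where v: "v \<in> F" "height x = x v" by (rule height_attained)
  have h0: "height (retr x) = 0"
  proof (rule height_eqI[OF _ v(1)])
    show "retr x v = 0" using v by (simp add: retr_def)
  qed (use rX X_iff in auto)
  then show "retr x \<in> realization V del" using rX by (simp add: del_iff)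
  assume "0 < height x"
  then have "F \<subseteq> supp x" using height_pos_iff[OF xX] by simp
  then have "supp (retr x) \<union> F \<subseteq> supp x" using sub by blast
  then have "supp (retr x) \<union> F \<in> K" using xX K unfolding X_iff simplicial_def by blast
  then show "retr x \<in> realization V rim" using rX h0 by (simp add: rim_iff)
qed

lemma comb_rim:
  assumes "x \<in> realization V rim" "0 \<le> u" "u \<le> 1"
  shows "comb u x bary \<in> X" "height (comb u x bary) = u / m"
proof -
  have x: "x \<in> X" "height x = 0" "supp x \<union> F \<in> K" using assms(1) by (auto simp: rim_iff)
  show "comb u x bary \<in> X"
    unfolding X_def
    by (rule realization_comb[OF K _ _ K]) (use x assms supp_bary bary_X in \<open>auto simp: X_def\<close>)
  show "height (comb u x bary) = u / m" using height_comb[OF x(1,2)] assms by simp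
qed

lemma comb_rim_AB: "\<lbrakk>x \<in> realization V rim; 0 < u; u < 1\<rbrakk> \<Longrightarrow> comb u x bary \<in> A \<inter> B"
  using comb_rim[of x u] m_ge_1 by (auto simp: A_def B_def)

lemma continuous_on_retr: "continuous_on A retr"
  unfolding retr_def
  by (intro continuous_on_coordinatewise_then_product continuous_intros continuous_on_height
       continuous_on_If_const) (auto simp: A_def)

lemma X_eq: "X = A \<union> B"
  using height_nonneg m_ge_1 by (force simp: A_def B_def)

lemma openin_A: "openin (top_of_set X) A" and openin_B: "openin (top_of_set X) B"
proof -
  have "A = X \<inter> {x. m * height x < 1}" "B = X \<inter> {x. 0 < height x}" by (auto simp: A_def B_def)
  moreover have "open {x. m * height x < 1}" "open {x. 0 < height x}"
    by (intro open_Collect_less continuous_intros continuous_on_height)+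
  ultimately show "openin (top_of_set X) A" "openin (top_of_set X) B" by (auto simp: openin_open)
qed

lemma comb_comb: "comb t (comb u x b) (comb w x b) = comb ((1 - t) * u + t * w) x b"
  by (auto simp: comb_def fun_eq_iff algebra_simps)

lemma del_A: "realization V del \<subseteq> A"
  by (auto simp: del_iff A_def)

lemma retr_id: "height x = 0 \<Longrightarrow> retr x = x"
  by (auto simp: retr_def fun_eq_iff)

text \<open>The segment from \<open>retr x\<close> to \<open>x\<close> lies on the ray towards the
  barycentre, so only the radial coordinate changes.\<close>

lemma retr_homotopic_id: "homotopic_with (\<lambda>x. True) (top_of_set A) (top_of_set A) (id \<circ> retr) id"
proof (rule comb_homotopic)
  fix x t assume x: "x \<in> A" and t: "0 \<le> t" "t \<le> (1::real)"
  let ?u = "m * height x"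
  have u: "?u < 1" "0 \<le> ?u" using x m_ge_1 height_nonneg by (auto simp: A_def)
  have eq: "comb t (retr x) x = comb (t * ?u) (retr x) bary"
    using comb_comb[of t 0 "retr x" bary ?u] comb_retr[OF u(1)] by simp
  show "comb t ((id \<circ> retr) x) (id x) \<in> A"
  proof (cases "height x = 0")
    case True
    then show ?thesis using retr_del(1)[OF x] del_A by (auto simp: eq)
  next
    case False
    then have "0 < height x" using x height_nonneg by (force simp: A_def)
    then have r: "retr x \<in> realization V rim" using retr_del(2) x by blast
    have "t * ?u \<le> ?u" using t u by (simp add: mult_left_le_one_le)
    then have tu: "0 \<le> t * ?u" "t * ?u < 1" using t u by auto
    then show ?thesis
      using comb_rim[OF r, of "t * ?u"] m_ge_1 by (simp add: eq A_def mult.left_commute)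
  qed
qed (auto simp: continuous_on_retr continuous_on_id)

lemma A_equiv: "top_of_set A homotopy_equivalent_space top_of_set (realization V del)"
  unfolding homotopy_equivalent_space_def
proof (intro exI conjI)
  show "continuous_map (top_of_set A) (top_of_set (realization V del)) retr"
    using continuous_on_retr retr_del by auto
  show "continuous_map (top_of_set (realization V del)) (top_of_set A) id"
    using del_A by auto
  show "homotopic_with (\<lambda>x. True) (top_of_set (realization V del)) (top_of_set (realization V del)) (retr \<circ> id) id"
    by (rule homotopic_with_equal)
       (use retr_id in \<open>auto simp: del_iff intro: continuous_on_subset[OF continuous_on_retr del_A]\<close>)
  show "homotopic_with (\<lambda>x. True) (top_of_set A) (top_of_set A) (id \<circ> retr) id"
    by (rule retr_homotopic_id)
qed

text \<open>In polar coordinates \<open>A \<inter> B\<close> is the product of \<open>rim\<close>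
  with the open interval from 0 to 1; the value 1/2 selects a middle slice.\<close>

lemma AB_equiv: "top_of_set (A \<inter> B) homotopy_equivalent_space top_of_set (realization V rim)"
  unfolding homotopy_equivalent_space_def
proof (intro exI conjI)
  let ?s = "\<lambda>y. comb (1/2) y bary"
  have cs: "continuous_on S ?s" for S
    by (intro continuous_on_comb continuous_on_const continuous_on_id)
  have cr: "continuous_on (A \<inter> B) retr" using continuous_on_subset[OF continuous_on_retr] by blast
  have r: "retr x \<in> realization V rim" if "x \<in> A \<inter> B" for x
    using retr_del(2) that by (auto simp: B_def)
  have s: "?s y \<in> A \<inter> B" if "y \<in> realization V rim" for y
    using comb_rim_AB[OF that, of "1/2"] by simp
  show "continuous_map (top_of_set (A \<inter> B)) (top_of_set (realization V rim)) retr"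
    using cr r by auto
  show "continuous_map (top_of_set (realization V rim)) (top_of_set (A \<inter> B)) ?s"
    using cs s by auto
  have "(retr \<circ> ?s) y = y" if "y \<in> realization V rim" for y
    using retr_comb[of y "1/2"] that by (simp add: rim_iff)
  moreover have "continuous_on (realization V rim) (retr \<circ> ?s)"
    by (rule continuous_on_comp[OF cr cs s])
  ultimately show "homotopic_with (\<lambda>x. True) (top_of_set (realization V rim)) (top_of_set (realization V rim)) (retr \<circ> ?s) id"
    by (intro homotopic_with_equal) auto
  show "homotopic_with (\<lambda>x. True) (top_of_set (A \<inter> B)) (top_of_set (A \<inter> B)) (?s \<circ> retr) id"
  proof (rule comb_homotopic)
    fix x t assume x: "x \<in> A \<inter> B" and t: "0 \<le> t" "t \<le> (1::real)"
    let ?u = "m * height x"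
    have u: "?u < 1" "0 < ?u" using x m_ge_1 by (auto simp: A_def B_def)
    have eq: "comb t ((?s \<circ> retr) x) (id x) = comb ((1 - t) * (1/2) + t * ?u) (retr x) bary"
      using comb_comb[of t "1/2" "retr x" bary ?u] comb_retr[OF u(1)] by simp
    have "0 < (1 - t) * (1/2) + t * ?u" "(1 - t) * (1/2) + t * ?u < 1"
      using t u by (smt (verit, best) mult_nonneg_nonneg mult_pos_pos mult_less_cancel_left2 mult_left_le field_sum_of_halves divide_pos_pos)+
    then show "comb t ((?s \<circ> retr) x) (id x) \<in> A \<inter> B"
      using comb_rim_AB[OF r[OF x]] eq by simp
  qed (use continuous_on_compose[OF cr cs] in \<open>auto simp: continuous_on_id\<close>)
qed

text \<open>The open star is star-shaped about the barycentre: on a segment towards it all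
  coordinates in \<open>F\<close> stay positive.\<close>

lemma contractible_B: "contractible_space (top_of_set B)" "B \<noteq> {}"
proof -
  have hb: "height bary = 1 / m"
  proof -
    obtain v where v: "v \<in> F" using F_ne by blast
    then show ?thesis by (intro height_eqI[of _ _ v]) (auto simp: bary_def)
  qed
  then show "B \<noteq> {}" using bary_X m_ge_1 by (auto simp: B_def)
  have "homotopic_with_canon (\<lambda>_. True) B B id (\<lambda>_. bary)"
  proof (rule comb_homotopic)
    fix x t assume xB: "x \<in> B" and t: "0 \<le> t" "t \<le> (1::real)"
    have x: "x \<in> X" "0 < height x" "F \<subseteq> supp x" using xB height_pos_iff by (auto simp: B_def)
    have "comb t x bary \<in> X"
      unfolding X_def
      by (rule realization_comb[OF K _ _ K])
         (use x t supp_bary bary_X X_iff in \<open>auto simp: X_def Un_absorb2\<close>)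
    moreover obtain v where v: "v \<in> F" "height (comb t x bary) = comb t x bary v" by (rule height_attained)
    have "0 < x v" using x(2) height_le[OF v(1), of x] by linarith
    then have "0 < comb t x bary v"
      using t m_ge_1 v(1) by (cases "t = 1") (auto simp: comb_def bary_def intro!: add_pos_nonneg)
    ultimately show "comb t (id x) bary \<in> B" using v(2) by (simp add: B_def)
  qed (auto simp: continuous_on_id)
  then show "contractible_space (top_of_set B)"
    unfolding contractible_space_def by blast
qed

text \<open>Attaching a cone raises degrees by one, hence \<open>n - 1\<close> for the rim.\<close>

lemma cconn_add_face:
  assumes "cconn n (realization V del)" "cconn (n - 1) (realization V rim)"
  shows "cconn n (realization V K)"
  unfolding cconn_def
proof (intro allI impI)
  fix d assume d: "d < n"
  have "cube_ext d (A \<union> B)"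
  proof (rule cube_ext_cover_union)
    show "cube_ext j A" if "j \<le> d" for j
      using cube_ext_homotopy_equivalent[OF A_equiv] assms(1) that d by (simp add: cconn_def)
    show "cube_ext j B" for j by (rule cube_ext_contractible[OF contractible_B])
    show "cube_ext j (A \<inter> B)" if "j < d" for j
      using cube_ext_homotopy_equivalent[OF AB_equiv] assms(2) that d by (simp add: cconn_def)
  qed (use openin_A openin_B X_eq in auto)
  then show "cube_ext d (realization V K)" by (simp add: X_def flip: X_eq)
qed

text \<open>The converse direction fills cells of full dimension inside \<open>A \<inter> B\<close>,
  so the rim is needed at \<open>n\<close> itself.\<close>

lemma cconn_remove_face:
  assumes "cconn n (realization V K)" "cconn n (realization V rim)"
  shows "cconn n (realization V del)"
  unfolding cconn_def
proof (intro allI impI)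
  fix d assume d: "d < n"
  have "cube_ext d A"
  proof (rule cube_ext_cover_part)
    show "cube_ext d (A \<union> B)" using assms(1) d by (simp add: cconn_def X_def flip: X_eq)
    show "cube_ext j (A \<inter> B)" if "j \<le> d" for j
      using cube_ext_homotopy_equivalent[OF AB_equiv] assms(2) that d by (simp add: cconn_def)
  qed (use openin_A openin_B X_eq in auto)
  then show "cube_ext d (realization V del)"
    using cube_ext_homotopy_equivalent A_equiv homotopy_equivalent_space_sym by blast
qed

end

section \<open>Homological connectivity\<close>

text \<open>Reduced homology is a kernel of the map to a point and vanishes for the empty space even
  in degree -1, so nonemptiness is stated separately.\<close>

definition hconn :: "nat \<Rightarrow> 'b::topological_space set \<Rightarrow> bool" where
  "hconn n Y \<longleftrightarrow> n = 0 \<or> Y \<noteq> {} \<and>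
     (\<forall>i::int. i \<le> int n - 2 \<longrightarrow> trivial_group (reduced_homology_group i (top_of_set Y)))"

lemma trivial_reduced_homology_cong:
  assumes "top_of_set Y homotopy_equivalent_space top_of_set Z"
    and "trivial_group (reduced_homology_group i (top_of_set Z))"
  shows "trivial_group (reduced_homology_group i (top_of_set Y))"
  using isomorphic_group_triviality[OF
      homotopy_equivalent_space_imp_isomorphic_reduced_homology_groups[OF assms(1), of i]] assms(2)
  by simp

lemma hconn_contractible:
  "\<lbrakk>contractible_space (top_of_set Y); Y \<noteq> {}\<rbrakk> \<Longrightarrow> hconn n Y"
  by (simp add: hconn_def trivial_reduced_homology_group_contractible_space del: contractible_space_top_of_set)

lemma subtopology_top_of_set: "T \<subseteq> S \<Longrightarrow> subtopology (top_of_set S) T = top_of_set T"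
  by (simp add: subtopology_subtopology Int_absorb1)

context face_star
begin

text \<open>Excising \<open>X - B\<close> leaves the pair of \<open>B\<close> and
  \<open>A \<inter> B\<close>. Contractibility of \<open>B\<close> turns its homology in degree
  \<open>i\<close> into reduced homology of the rim in degree \<open>i - 1\<close>, which is at most
  \<open>n - 2\<close>. Nonnegative \<open>i\<close> forces \<open>n > 0\<close> and hence a
  nonempty rim.\<close>

lemma trivial_relative_homology:
  assumes rim: "hconn n (realization V rim)" and i: "i \<le> int n - 1"
  shows "trivial_group (relative_homology_group i (top_of_set X) A)"
proof (cases "i < 0")
  case False
  then have n: "n \<noteq> 0" using i by auto
  then obtain x where "x \<in> realization V rim" using rim by (auto simp: hconn_def)
  then have ne: "A \<inter> B \<noteq> {}" using comb_rim_AB[of x "1/2"] by auto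
  have BX: "B \<subseteq> X" "A \<subseteq> X" by (auto simp: A_def B_def)
  have "closedin (top_of_set X) (X - B)" using openin_B by (simp add: closedin_def Diff_Diff_Int Int_absorb1 BX)
  then have "top_of_set X closure_of (X - B) \<subseteq> top_of_set X interior_of A"
    using openin_A X_eq by (auto simp: closure_of_closedin interior_of_openin)
  moreover have "X - (X - B) = B" "A - (X - B) = A \<inter> B" using BX by auto
  ultimately have "hom_induced i (top_of_set B) (A \<inter> B) (top_of_set X) A id
      \<in> iso (relative_homology_group i (top_of_set B) (A \<inter> B)) (relative_homology_group i (top_of_set X) A)"
    using homology_excision_axiom[of "top_of_set X" "X - B" A X i] BX
    by (simp add: subtopology_top_of_set)
  then have iso1: "relative_homology_group i (top_of_set B) (A \<inter> B) \<cong> relative_homology_group i (top_of_set X) A"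
    by (rule is_isoI)
  have iso2: "relative_homology_group i (top_of_set B) (A \<inter> B) \<cong> reduced_homology_group (i - 1) (top_of_set (A \<inter> B))"
  proof -
    have "topspace (top_of_set B) \<inter> (A \<inter> B) \<noteq> {}" using ne by auto
    from isomorphic_group_relative_homology_of_contractible[OF contractible_B(1) this, of i]
    show ?thesis by (simp add: subtopology_top_of_set)
  qed
  have "trivial_group (reduced_homology_group (i - 1) (top_of_set (A \<inter> B)))"
    using trivial_reduced_homology_cong[OF AB_equiv] rim n i by (simp add: hconn_def)
  then show ?thesis
    using isomorphic_group_triviality[OF iso2] isomorphic_group_triviality[OF iso1] by simp
qed simp

text \<open>Exactness at the homology of \<open>X\<close>: the image is the kernel of a map into a
  trivial group.\<close>

lemma reduced_homology_surj_A:
  assumes rim: "hconn n (realization V rim)" and i: "i \<le> int n - 1"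
  shows "hom_induced i (top_of_set A) {} (top_of_set X) {} id ` carrier (reduced_homology_group i (top_of_set A))
       = carrier (reduced_homology_group i (top_of_set X))"
proof -
  have AX: "A \<subseteq> X" by (auto simp: A_def)
  let ?G = "reduced_homology_group i (top_of_set X)" and ?H = "relative_homology_group i (top_of_set X) A"
  let ?f = "hom_induced i (top_of_set X) {} (top_of_set X) A id"
  have ex: "kernel ?G ?H ?f
      = hom_induced i (top_of_set A) {} (top_of_set X) {} id ` carrier (reduced_homology_group i (top_of_set A))"
    and "?f \<in> hom ?G ?H"
    using homology_exactness_reduced_3[of i "top_of_set X" A]
    by (simp_all add: subtopology_top_of_set[OF AX] group_hom_def group_hom_axioms_def)
  then have "?f x \<in> carrier ?H" if "x \<in> carrier ?G" for x using that by (auto simp: hom_def)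
  then have "kernel ?G ?H ?f = carrier ?G"
    using trivial_relative_homology[OF assms] by (auto simp: kernel_def trivial_group_def)
  then show ?thesis using ex by simp
qed

lemma hconn_add_face:
  assumes del: "hconn n (realization V del)" and rim: "hconn (n - 1) (realization V rim)"
  shows "hconn n (realization V K)"
proof (cases "n = 0")
  case False
  then have "X \<noteq> {}" using bary_X by blast
  moreover have "trivial_group (reduced_homology_group i (top_of_set X))" if i: "i \<le> int n - 2" for i
  proof -
    have "trivial_group (reduced_homology_group i (top_of_set A))"
      using trivial_reduced_homology_cong[OF A_equiv] del i False by (simp add: hconn_def)
    then have cA: "carrier (reduced_homology_group i (top_of_set A)) = {\<one>\<^bsub>reduced_homology_group i (top_of_set A)\<^esub>}"
      by (simp add: trivial_group_def)
    have i': "i \<le> int (n - 1) - 1" using i False by linarith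
    have "\<exists>z. carrier (reduced_homology_group i (top_of_set X)) = {z}"
      unfolding reduced_homology_surj_A[OF rim i', symmetric] cA by simp
    moreover have "\<one>\<^bsub>reduced_homology_group i (top_of_set X)\<^esub> \<in> carrier (reduced_homology_group i (top_of_set X))"
      by (intro monoid.one_closed group.is_monoid group_reduced_homology_group)
    ultimately show ?thesis by (auto simp: trivial_group_def)
  qed
  ultimately show ?thesis by (simp add: hconn_def X_def)
qed (simp add: hconn_def)

text \<open>The form used for skeleta, where a top-dimensional face is removed; \<open>del\<close>
  replaces \<open>A\<close> because its inclusion is a homotopy equivalence.\<close>

lemma reduced_homology_surj_del:
  assumes rim: "hconn n (realization V rim)" and i: "i \<le> int n - 1"
  shows "hom_induced i (top_of_set (realization V del)) {} (top_of_set (realization V K)) {} id `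
           carrier (reduced_homology_group i (top_of_set (realization V del)))
       = carrier (reduced_homology_group i (top_of_set (realization V K)))"
proof -
  let ?D = "realization V del"
  have cid: "continuous_map (top_of_set ?D) (top_of_set A) id" "continuous_map (top_of_set A) (top_of_set X) id"
    using del_A by (auto simp: A_def)
  have retr: "continuous_map (top_of_set A) (top_of_set ?D) retr"
    using continuous_on_retr retr_del by auto
  have "hom_induced i (top_of_set ?D) {} (top_of_set A) {} id
      \<in> iso (reduced_homology_group i (top_of_set ?D)) (reduced_homology_group i (top_of_set A))"
  proof (rule homotopy_equivalence_reduced_homology_group_isomorphism[OF cid(1) retr])
    show "homotopic_with (\<lambda>x. True) (top_of_set ?D) (top_of_set ?D) (retr \<circ> id) id"
      by (rule homotopic_with_equal)
         (use retr_id in \<open>auto simp: del_iff intro: continuous_on_subset[OF continuous_on_retr del_A]\<close>)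
    show "homotopic_with (\<lambda>x. True) (top_of_set A) (top_of_set A) (id \<circ> retr) id"
      by (rule retr_homotopic_id)
  qed
  then have "hom_induced i (top_of_set ?D) {} (top_of_set A) {} id ` carrier (reduced_homology_group i (top_of_set ?D))
      = carrier (reduced_homology_group i (top_of_set A))"
    by (simp add: iso_iff)
  moreover have "hom_induced i (top_of_set ?D) {} (top_of_set X) {} id
      = hom_induced i (top_of_set A) {} (top_of_set X) {} id \<circ> hom_induced i (top_of_set ?D) {} (top_of_set A) {} id"
    using hom_induced_compose_empty[OF cid, of i] by simp
  ultimately show ?thesis
    using reduced_homology_surj_A[OF assms] by (simp only: image_comp[symmetric] X_def)
qed

end

section \<open>Joins with the boundary of a simplex\<close>

text \<open>For \<open>L\<close> on vertices off \<open>F\<close> this is the join of the boundary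
  of \<open>F\<close> with \<open>L\<close>: a face is a proper subset of \<open>F\<close> together
  with a face of \<open>L\<close>.\<close>

definition bd_join :: "'a set \<Rightarrow> 'a set \<Rightarrow> 'a set set \<Rightarrow> 'a set set" where
  "bd_join V F L = {S. S \<subseteq> V \<and> \<not> F \<subseteq> S \<and> S - F \<in> L}"

lemma simplicial_bd_join:
  assumes "simplicial V L"
  shows "simplicial V (bd_join V F L)"
proof -
  have "T - F \<in> L" if "S - F \<in> L" "T \<subseteq> S" for S T
    using assms that by (meson Diff_mono order_refl simplicial_def)
  then show ?thesis using assms by (auto simp: simplicial_def bd_join_def)
qed

text \<open>Stated for an abstract \<open>Q\<close> so that homotopy and homology share one
  induction. Adding a vertex to \<open>F\<close> suspends the join: deleting the new vertex leaves a
  cone and its link is the previous join, so each vertex gains one degree. For a single vertex the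
  join is \<open>L\<close>.\<close>

lemma bd_join_connected:
  fixes Q :: "nat \<Rightarrow> ('a \<Rightarrow> real) set \<Rightarrow> bool"
  assumes cone: "\<And>n K w. \<lbrakk>simplicial V K; w \<in> V; \<And>S. S \<in> K \<Longrightarrow> insert w S \<in> K; K \<noteq> {}\<rbrakk> \<Longrightarrow> Q n (realization V K)"
    and add: "\<And>n K F. \<lbrakk>face_star V K F; Q n (realization V (face_star.del K F));
        Q (n - 1) (realization V (face_star.rim K F))\<rbrakk> \<Longrightarrow> Q n (realization V K)"
    and "finite F" "F \<noteq> {}" "F \<subseteq> V" "simplicial V L" "L \<subseteq> Pow (V - F)" "{} \<in> L" "Q k (realization V L)"
  shows "Q (k + card F - 1) (realization V (bd_join V F L))"
  using assms(3-)
proof (induction F rule: finite_ne_induct)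
  case (singleton v)
  have "bd_join V {v} L = L"
  proof (rule equalityI; rule subsetI)
    fix S assume "S \<in> L"
    moreover from this have "S - {v} = S" "S \<subseteq> V" "v \<notin> S" using singleton by auto
    ultimately show "S \<in> bd_join V {v} L" by (simp add: bd_join_def)
  next
    fix S assume "S \<in> bd_join V {v} L"
    moreover from this have "S - {v} = S" by (auto simp: bd_join_def)
    ultimately show "S \<in> L" by (simp add: bd_join_def)
  qed
  then show ?case using singleton by simp
next
  case (insert v F)
  let ?J = "bd_join V (insert v F) L"
  obtain w where w: "w \<in> F" using insert.hyps(2) by blast
  have vJ: "{v} \<in> ?J" using insert.prems insert.hyps w by (auto simp: bd_join_def)
  interpret face_star V ?J "{v}"
    by standard (use simplicial_bd_join insert.prems vJ in auto)
  \<comment> \<open>Without \<open>v\<close> no face contains all of \<open>insert v F\<close>, so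
    the old vertices \<open>F\<close> span a full simplex and any \<open>w\<close> in
    \<open>F\<close> is an apex.\<close>
  have "Q (k + card F) (realization V del)"
  proof (rule cone[OF simplicial_del, of w])
    show "w \<in> V" using w insert.prems by auto
    have "{} \<in> del" unfolding del_def using insert.prems by (auto simp: bd_join_def)
    then show "del \<noteq> {}" by blast
    fix S assume "S \<in> del"
    moreover have "insert w S - insert v F = S - insert v F" using w by auto
    ultimately show "insert w S \<in> del"
      unfolding del_def using w insert.hyps insert.prems by (auto simp: bd_join_def)
  qed
  moreover have "rim = bd_join V F L"
  proof (rule equalityI; rule subsetI)
    fix S assume "S \<in> rim"
    then have S: "S \<subseteq> V" "v \<notin> S" "\<not> insert v F \<subseteq> insert v S" "S - insert v F \<in> L"
      unfolding rim_def by (auto simp: bd_join_def)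
    moreover have "S - insert v F = S - F" using S(2) by auto
    ultimately show "S \<in> bd_join V F L" by (auto simp: bd_join_def)
  next
    fix S assume S: "S \<in> bd_join V F L"
    then have "S - F \<in> L" by (simp add: bd_join_def)
    then have v: "v \<notin> S" using insert.prems insert.hyps by auto
    then have "S - insert v F = S - F" "insert v S - insert v F = S - F" "F \<subseteq> insert v S \<longleftrightarrow> F \<subseteq> S"
      using insert.hyps by auto
    then show "S \<in> rim" unfolding rim_def using S v insert.prems by (auto simp: bd_join_def)
  qed
  moreover have "Q (k + card F - 1) (realization V (bd_join V F L))"
    using insert.IH insert.prems by auto
  ultimately have "Q (k + card F) (realization V ?J)"
    using add[OF face_star_axioms] by simp
  then show ?case using insert.hyps by simp
qed

lemma cconn_bd_join:
  assumes "F \<noteq> {}" "F \<subseteq> V" "simplicial V L" "L \<subseteq> Pow (V - F)" "{} \<in> L" "cconn k (realization V L)"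
  shows "cconn (k + card F - 1) (realization V (bd_join V F L))"
proof (rule bd_join_connected)
  show "cconn n (realization V K)"
    if "simplicial V K" "w \<in> V" "\<And>S. S \<in> K \<Longrightarrow> insert w S \<in> K" "K \<noteq> {}" for n K w
    using cube_ext_contractible[OF contractible_cone[OF that]] by (simp add: cconn_def)
  show "finite F" using assms(2,3) finite_subset by (auto simp: simplicial_def)
qed (fact face_star.cconn_add_face assms)+

lemma hconn_bd_join:
  assumes "F \<noteq> {}" "F \<subseteq> V" "simplicial V L" "L \<subseteq> Pow (V - F)" "{} \<in> L" "hconn k (realization V L)"
  shows "hconn (k + card F - 1) (realization V (bd_join V F L))"
proof (rule bd_join_connected)
  show "hconn n (realization V K)"
    if "simplicial V K" "w \<in> V" "\<And>S. S \<in> K \<Longrightarrow> insert w S \<in> K" "K \<noteq> {}" for n K w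
    using hconn_contractible[OF contractible_cone[OF that]] .
  show "finite F" using assms(2,3) finite_subset by (auto simp: simplicial_def)
qed (fact face_star.hconn_add_face assms)+

section \<open>The easy half of the Hurewicz theorem\<close>

text \<open>Here \<open>k\<close> bounds the number of vertices, so the dimension is at most
  \<open>k - 1\<close>.\<close>

definition skeleton :: "nat \<Rightarrow> 'a set set \<Rightarrow> 'a set set" where
  "skeleton k K = {S \<in> K. card S \<le> k}"

lemma simplicial_skeleton: "simplicial V K \<Longrightarrow> simplicial V (skeleton k K)"
  unfolding simplicial_def skeleton_def
  by (auto intro: order_trans[OF card_mono] dest: finite_subset)

lemma obtain_max_card:
  assumes "finite C" "C \<noteq> {}"
  obtains F where "F \<in> C" "\<And>S. S \<in> C \<Longrightarrow> card S \<le> card F"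
proof -
  have "Max (card ` C) \<in> card ` C" using assms by (intro Max_in) auto
  then obtain F where F: "F \<in> C" "Max (card ` C) = card F" by auto
  show thesis
  proof (rule that[OF F(1)])
    show "card S \<le> card F" if "S \<in> C" for S
      using that assms(1) by (auto simp flip: F(2) intro: Max_ge)
  qed
qed

text \<open>Faces with more than \<open>k\<close> vertices are removed one at a time, largest first.
  Each is a facet, so its rim is the boundary sphere, connected enough for surjectivity in degrees
  up to \<open>card F - 2 \<ge> k - 1\<close>.\<close>

lemma skeleton_reduced_homology_surj:
  assumes "simplicial V K" "i \<le> int k - 1"
  shows "hom_induced i (top_of_set (realization V (skeleton k K))) {} (top_of_set (realization V K)) {} id `
           carrier (reduced_homology_group i (top_of_set (realization V (skeleton k K))))
       = carrier (reduced_homology_group i (top_of_set (realization V K)))"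
  using assms
proof (induction "card (K - skeleton k K)" arbitrary: K)
  case 0
  have "finite (K - skeleton k K)"
    using 0(2) by (auto simp: simplicial_def intro: finite_subset)
  then have "skeleton k K = K" using 0(1) by (auto simp: skeleton_def)
  moreover have "hom_induced i (top_of_set (realization V K)) {} (top_of_set (realization V K)) {} id c = c"
    if "c \<in> carrier (reduced_homology_group i (top_of_set (realization V K)))" for c
    using that carrier_reduced_homology_group_subset by (intro hom_induced_id) blast
  ultimately show ?case by (metis (no_types, lifting) image_cong image_ident)
next
  case (Suc l)
  have fin: "finite K" using Suc.prems(1) by (auto simp: simplicial_def intro: finite_subset)
  have "K - skeleton k K \<noteq> {}" using Suc.hyps(2) by (metis card.empty nat.distinct(1))
  then obtain F where F: "F \<in> K - skeleton k K" "\<And>S. S \<in> K - skeleton k K \<Longrightarrow> card S \<le> card F"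
    using obtain_max_card[of "K - skeleton k K"] fin by auto
  have cF: "k < card F" using F(1) by (auto simp: skeleton_def)
  have max: "S \<subseteq> F" if "S \<union> F \<in> K" for S
  proof -
    have f: "finite (S \<union> F)" using that Suc.prems(1) by (auto simp: simplicial_def intro: finite_subset)
    then have "card F \<le> card (S \<union> F)" by (intro card_mono) auto
    then have "card (S \<union> F) \<le> card F" using F(2)[of "S \<union> F"] that cF by (auto simp: skeleton_def)
    then have "F = S \<union> F" using card_seteq[OF f] by blast
    then show ?thesis by blast
  qed
  interpret face_star V K F
    by standard (use Suc.prems(1) F(1) cF in auto)
  have K_down: "S \<in> K" if "S \<subseteq> T" "T \<in> K" for S T using that K by (auto simp: simplicial_def)
  have rim_eq: "rim = bd_join V F {{}}"
  proof (rule equalityI; rule subsetI)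
    fix S assume "S \<in> rim"
    then have "S \<in> K" "\<not> F \<subseteq> S" "S \<subseteq> F" using max by (auto simp: rim_def)
    then show "S \<in> bd_join V F {{}}" using FV by (auto simp: bd_join_def)
  next
    fix S assume "S \<in> bd_join V F {{}}"
    then have "S \<subseteq> F" "\<not> F \<subseteq> S" by (auto simp: bd_join_def)
    then show "S \<in> rim" using K_down[OF _ FK] by (auto simp: rim_def Un_absorb1)
  qed
  \<comment> \<open>The boundary sphere of \<open>F\<close> is its join with the complex
    \<open>{{}}\<close>, about which \<open>hconn 0\<close> demands nothing.\<close>
  have "hconn (0 + card F - 1) (realization V rim)"
    unfolding rim_eq
    by (rule hconn_bd_join[OF F_ne FV]) (use finV in \<open>auto simp: simplicial_def hconn_def\<close>)
  then have surj1: "hom_induced i (top_of_set (realization V del)) {} (top_of_set (realization V K)) {} id `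
           carrier (reduced_homology_group i (top_of_set (realization V del)))
       = carrier (reduced_homology_group i (top_of_set (realization V K)))"
    by (rule reduced_homology_surj_del) (use Suc.prems(2) cF in linarith)
  have del_eq: "del = K - {F}"
  proof -
    have "S = F" if "S \<in> K" "F \<subseteq> S" for S using max[of S] that by (simp add: Un_absorb2)
    then show ?thesis by (auto simp: del_def)
  qed
  have sk: "skeleton k del = skeleton k K" using cF by (auto simp: del_eq skeleton_def)
  have "del - skeleton k del = (K - skeleton k K) - {F}" unfolding sk unfolding del_eq by auto
  then have "l = card (del - skeleton k del)" using Suc.hyps(2) F(1) fin by simp
  then have surj2: "hom_induced i (top_of_set (realization V (skeleton k K))) {} (top_of_set (realization V del)) {} id `
           carrier (reduced_homology_group i (top_of_set (realization V (skeleton k K))))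
       = carrier (reduced_homology_group i (top_of_set (realization V del)))"
    using Suc.hyps(1)[of del] simplicial_del Suc.prems(2) by (simp add: sk)
  have "skeleton k K \<subseteq> del" unfolding del_eq skeleton_def using cF by auto
  then have "continuous_map (top_of_set (realization V (skeleton k K))) (top_of_set (realization V del)) id"
    using realization_mono[of "skeleton k K" del V] by auto
  moreover have "del \<subseteq> K" by (auto simp: del_def)
  then have "continuous_map (top_of_set (realization V del)) (top_of_set (realization V K)) id"
    using realization_mono[of del K V] by auto
  ultimately have "hom_induced i (top_of_set (realization V (skeleton k K))) {} (top_of_set (realization V K)) {} id
      = hom_induced i (top_of_set (realization V del)) {} (top_of_set (realization V K)) {} id
        \<circ> hom_induced i (top_of_set (realization V (skeleton k K))) {} (top_of_set (realization V del)) {} id"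
    using hom_induced_compose_empty[of _ _ id _ id i] by (metis comp_id)
  then show ?case using surj1 surj2 by (simp only: image_comp[symmetric])
qed

text \<open>After projecting the simplices radially to the faces of a cube, the cone over the skeleton
  becomes a union of cubes with a vertex at the origin, over which the inclusion extends.\<close>
lemma skeleton_nullhomotopic:
  fixes V :: "'a set"
  assumes K: "simplicial V K" and k: "cconn (Suc k) (realization V K)"
  shows "\<exists>c. homotopic_with_canon (\<lambda>_. True) (realization V (skeleton k K)) (realization V K) id (\<lambda>_. c)"
proof -
  define X where "X = realization V K"
  define P where "P = realization V (skeleton k K)"
  define chi where "chi = (\<lambda>T (v::'a). if v \<in> T then 1 else 0 :: int)"
  \<comment> \<open>The cell has coordinates 1 on \<open>T\<close>, free in \<open>U - T\<close> and
    0 off \<open>U\<close>. These cubes form the cone over the skeleton with the origin as apex;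
    \<open>\<R>\<close> is its outer side, where some coordinate is 1, and \<open>g\<close> projects
    that side back to the simplices.\<close>
  define \<C> where "\<C> = {(chi T, U - T) |T U. T \<subseteq> U \<and> U \<in> skeleton k K}"
  define \<R> where "\<R> = {(chi T, U - T) |T U. T \<subseteq> U \<and> U \<in> skeleton k K \<and> T \<noteq> {}}"
  define g where "g = (\<lambda>(x::'a \<Rightarrow> real) v. x v / (\<Sum>w\<in>V. x w))"
  note skel = simplicial_skeleton[OF K, of k]
  have finV: "finite V" using K by (simp add: simplicial_def)
  have down: "S \<in> skeleton k K" if "U \<in> skeleton k K" "S \<subseteq> U" for S U
    using skel that by (auto simp: simplicial_def)
  have "X \<noteq> {}" using k by (auto simp: cconn_def cube_ext_0 X_def)
  then have "V \<noteq> {}" by (auto simp: X_def realization_def)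
  have mem: "0 \<le> x v" "supp x \<subseteq> U" "v \<in> T \<Longrightarrow> x v = 1"
    if "T \<subseteq> U" "x \<in> cell (chi T) (U - T)" for T U x v
  proof -
    have x: "\<And>v. v \<in> U - T \<Longrightarrow> 0 \<le> x v" "\<And>v. v \<notin> U - T \<Longrightarrow> x v = (if v \<in> T then 1 else 0)"
      using that(2) by (auto simp: cell_def chi_def)
    show "0 \<le> x v" using x by (cases "v \<in> U - T") auto
    show "v \<in> T \<Longrightarrow> x v = 1" using x(2)[of v] by auto
    show "supp x \<subseteq> U"
    proof
      fix v assume "v \<in> supp x"
      then show "v \<in> U" using x(2)[of v] that(1) by (cases "v \<in> T") (auto simp: supp_def)
    qed
  qed
  have cell_mem: "\<exists>\<sigma>\<in>\<C>. x \<in> cl \<sigma> \<and> ((\<exists>v. x v = 1) \<longrightarrow> \<sigma> \<in> \<R>)"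
    if x: "\<And>v. 0 \<le> x v" "\<And>v. x v \<le> 1" "supp x \<in> skeleton k K" for x :: "'a \<Rightarrow> real"
  proof -
    define T where "T = {v. x v = 1}"
    have T: "T \<subseteq> supp x" by (auto simp: T_def supp_def)
    have "x \<in> cell (chi T) (supp x - T)"
      using x(1,2) by (auto simp: cell_def chi_def T_def supp_def)
    moreover have "(chi T, supp x - T) \<in> \<C>" using T x(3) by (auto simp: \<C>_def)
    moreover have "(chi T, supp x - T) \<in> \<R>" if "\<exists>v. x v = 1"
    proof -
      have "T \<noteq> {}" using that by (auto simp: T_def)
      then show ?thesis using T x(3) by (auto simp: \<R>_def)
    qed
    ultimately show ?thesis by force
  qed
  \<comment> \<open>A face freezes coordinates of \<open>U - T\<close>: those at 1 join
    \<open>T\<close>, those at 0 leave \<open>U\<close>. Since \<open>T\<close> only grows,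
    \<open>\<R>\<close> is closed under faces.\<close>
  have face: "\<exists>T' U'. \<tau> = (chi T', U' - T') \<and> T \<subseteq> T' \<and> T' \<subseteq> U' \<and> U' \<subseteq> U"
    if "face \<tau> (chi T, U - T)" "T \<subseteq> U" for \<tau> T U
  proof -
    obtain b W where bW: "\<tau> = (b, W)" by (cases \<tau>)
    have f: "W \<subseteq> U - T" "\<And>v. v \<notin> U - T \<or> v \<in> W \<Longrightarrow> b v = chi T v"
      "\<And>v. v \<in> U - T \<Longrightarrow> b v = chi T v \<or> b v = chi T v + 1"
      using that(1) unfolding bW face_def by auto
    define T' where "T' = {v. b v = 1}"
    have b: "b v \<in> {0, 1}" for v using f(2,3)[of v] by (cases "v \<in> U - T") (auto simp: chi_def)
    then have "b = chi T'" by (fastforce simp: chi_def T'_def fun_eq_iff)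
    moreover have "T \<subseteq> T'" using f(2) by (auto simp: T'_def chi_def)
    moreover have TU: "T' \<subseteq> U"
    proof
      fix v assume "v \<in> T'"
      then show "v \<in> U" using f(2)[of v] that(2) by (cases "v \<in> T") (auto simp: T'_def chi_def)
    qed
    moreover have "W \<inter> T' = {}" using f(1,2) by (fastforce simp: T'_def chi_def)
    then have "W = (W \<union> T') - T'" by blast
    ultimately show ?thesis using f(1) bW by (intro exI[of _ T'] exI[of _ "W \<union> T'"]) auto
  qed
  have sum_pos: "0 < (\<Sum>v\<in>V. x v)" if "\<sigma> \<in> \<R>" "x \<in> cl \<sigma>" for \<sigma> x
  proof -
    obtain T U where TU: "\<sigma> = (chi T, U - T)" "T \<subseteq> U" "U \<in> skeleton k K" "T \<noteq> {}"
      using \<open>\<sigma> \<in> \<R>\<close> by (auto simp: \<R>_def)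
    obtain v where "v \<in> T" using TU(4) by blast
    moreover have "U \<subseteq> V" using TU(3) skel by (auto simp: simplicial_def)
    ultimately show ?thesis
      using mem[OF TU(2), of x] that(2) TU(1,2) by (intro sum_pos2[OF finV, of v]) auto
  qed
  have gX: "g x \<in> X" if x: "\<And>v. 0 \<le> x v" "supp x \<in> K" "0 < (\<Sum>v\<in>V. x v)" for x
  proof -
    have "supp (g x) = supp x" using x(3) by (auto simp: supp_def g_def)
    then show ?thesis
      using x by (simp add: X_def realization_iff[OF K]) (simp add: g_def sum_nonneg flip: sum_divide_distrib)
  qed
  have g\<R>: "g ` cl \<sigma> \<subseteq> X" if \<sigma>: "\<sigma> \<in> \<R>" for \<sigma>
  proof (rule image_subsetI)
    fix x assume x: "x \<in> cl \<sigma>"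
    obtain T U where TU: "\<sigma> = (chi T, U - T)" "T \<subseteq> U" "U \<in> skeleton k K"
      using \<sigma> by (auto simp: \<R>_def)
    have m: "\<And>v. 0 \<le> x v" "supp x \<subseteq> U" using mem[OF TU(2)] x TU(1) by auto
    have "supp x \<in> K" using down[OF TU(3) m(2)] by (simp add: skeleton_def)
    then show "g x \<in> X" using gX m(1) sum_pos[OF \<sigma> x] by blast
  qed
  have "\<exists>g'. continuous_on (\<Union>\<sigma>\<in>\<C>. cl \<sigma>) g' \<and> (\<forall>x\<in>\<Union>\<sigma>\<in>\<R>. cl \<sigma>. g' x = g x) \<and>
              (\<forall>\<sigma>\<in>\<C>. g' ` cl \<sigma> \<subseteq> X)"
  proof (rule carrier_extension)
    show "\<R> \<subseteq> \<C>" by (auto simp: \<R>_def \<C>_def)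
    have "\<C> \<subseteq> (\<lambda>(T, U). (chi T, U - T)) ` (Pow V \<times> Pow V)"
    proof
      fix \<sigma> assume "\<sigma> \<in> \<C>"
      then obtain T U where "\<sigma> = (chi T, U - T)" "T \<subseteq> U" "U \<subseteq> V"
        using skel by (auto simp: \<C>_def simplicial_def)
      then show "\<sigma> \<in> (\<lambda>(T, U). (chi T, U - T)) ` (Pow V \<times> Pow V)" by (intro image_eqI[of _ _ "(T, U)"]) auto
    qed
    then show "finite \<C>" by (rule finite_subset) (simp add: finV)
    show "finite (snd \<sigma>)" if "\<sigma> \<in> \<C>" for \<sigma>
    proof -
      have "skeleton k K \<subseteq> Pow V" using skel by (simp add: simplicial_def)
      then have "snd \<sigma> \<subseteq> V" using that unfolding \<C>_def by fastforce
      then show ?thesis by (rule finite_subset) (fact finV)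
    qed
    show "\<tau> \<in> \<C>" if "\<sigma> \<in> \<C>" "face \<tau> \<sigma>" for \<sigma> \<tau>
    proof -
      obtain T U where TU: "\<sigma> = (chi T, U - T)" "T \<subseteq> U" "U \<in> skeleton k K"
        using \<open>\<sigma> \<in> \<C>\<close> unfolding \<C>_def by blast
      then obtain T' U' where "\<tau> = (chi T', U' - T')" "T' \<subseteq> U'" "U' \<subseteq> U"
        using face[of \<tau> T U] \<open>face \<tau> \<sigma>\<close> by auto
      then show ?thesis using TU(3) down[of U U'] unfolding \<C>_def by blast
    qed
    show "\<tau> \<in> \<R>" if "\<sigma> \<in> \<R>" "face \<tau> \<sigma>" for \<sigma> \<tau>
    proof -
      obtain T U where TU: "\<sigma> = (chi T, U - T)" "T \<subseteq> U" "U \<in> skeleton k K" "T \<noteq> {}"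
        using \<open>\<sigma> \<in> \<R>\<close> unfolding \<R>_def by blast
      then obtain T' U' where "\<tau> = (chi T', U' - T')" "T \<subseteq> T'" "T' \<subseteq> U'" "U' \<subseteq> U"
        using face[of \<tau> T U] \<open>face \<tau> \<sigma>\<close> by auto
      then show ?thesis using TU down[of U U'] unfolding \<R>_def by blast
    qed
    have "continuous_on (\<Union>\<sigma>\<in>\<R>. cl \<sigma>) (\<lambda>x. \<Sum>w\<in>V. x w)"
      by (intro continuous_intros)
    moreover have "\<forall>x\<in>\<Union>\<sigma>\<in>\<R>. cl \<sigma>. (\<Sum>w\<in>V. x w) \<noteq> 0"
    proof
      fix x assume x: "x \<in> (\<Union>\<sigma>\<in>\<R>. cl \<sigma>)"
      obtain \<sigma> where "\<sigma> \<in> \<R>" "x \<in> cl \<sigma>" using x by blast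
      then show "(\<Sum>w\<in>V. x w) \<noteq> 0" using sum_pos[of \<sigma> x] by simp
    qed
    ultimately show "continuous_on (\<Union>\<sigma>\<in>\<R>. cl \<sigma>) g"
      unfolding g_def
      by (intro continuous_on_coordinatewise_then_product continuous_on_divide continuous_on_coordinate)
    \<comment> \<open>Only cubes with \<open>T = {}\<close> remain to be filled. Their dimension is
      \<open>card U \<le> k\<close>, which \<open>cconn (Suc k)\<close> covers.\<close>
    show "cube_ext (card (snd \<sigma>)) X" if "\<sigma> \<in> \<C> - \<R>" for \<sigma>
    proof -
      obtain T U where TU: "\<sigma> = (chi T, U - T)" "T \<subseteq> U" "U \<in> skeleton k K"
        using \<open>\<sigma> \<in> \<C> - \<R>\<close> unfolding \<C>_def by blast
      then have "T = {}" using that by (auto simp: \<R>_def)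
      then show ?thesis using k TU by (auto simp: skeleton_def cconn_def X_def)
    qed
  qed (use g\<R> in auto)
  then obtain g' where ext: "continuous_on (\<Union>\<sigma>\<in>\<C>. cl \<sigma>) g'" "\<forall>x\<in>\<Union>\<sigma>\<in>\<R>. cl \<sigma>. g' x = g x"
      "\<forall>\<sigma>\<in>\<C>. g' ` cl \<sigma> \<subseteq> X"
    by blast
  define mx where "mx = (\<lambda>x::'a \<Rightarrow> real. Max ((\<lambda>v. x v) ` V))"
  have cmx: "continuous_on S mx" for S
    unfolding mx_def by (intro continuous_on_Max_family finV \<open>V \<noteq> {}\<close> continuous_on_coordinate)
  have mx_ge: "x v \<le> mx x" if "v \<in> V" for x v
    unfolding mx_def using that finV by (auto intro: Max_ge)
  have mx_in: "\<exists>v\<in>V. x v = mx x" for x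
  proof -
    have "mx x \<in> (\<lambda>v. x v) ` V" unfolding mx_def using finV \<open>V \<noteq> {}\<close> by (intro Max_in) auto
    then show ?thesis by auto
  qed
  have P: "0 \<le> x v" "supp x \<in> skeleton k K" "(\<Sum>v\<in>V. x v) = 1" "0 < mx x" "x v \<le> mx x" if "x \<in> P" for x v
  proof -
    show 1: "\<And>v. 0 \<le> x v" "supp x \<in> skeleton k K" "(\<Sum>v\<in>V. x v) = 1"
      using that by (auto simp: P_def realization_iff[OF skel])
    show 2: "0 < mx x"
    proof (rule ccontr)
      assume "\<not> 0 < mx x"
      then have "x v = 0" if "v \<in> V" for v using mx_ge[OF that, of x] 1(1)[of v] by linarith
      then have "(\<Sum>v\<in>V. x v) = 0" by simp
      with 1(3) show False by simp
    qed
    have "supp x \<subseteq> V" using 1(2) skel by (auto simp: simplicial_def)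
    then have "v \<notin> V \<Longrightarrow> x v = 0" by (auto simp: supp_def)
    then show "x v \<le> mx x" using mx_ge[of v x] 2 by (cases "v \<in> V") auto
  qed
  \<comment> \<open>Dividing by the largest coordinate moves a simplex point to the outer side of
    the cone; the factor \<open>1 - t\<close> then slides it to the origin.\<close>
  define q where "q = (\<lambda>z v. (1 - fst z) * (snd z v / mx (snd z)) :: real)"
  have q\<C>: "\<exists>\<sigma>\<in>\<C>. q (t, x) \<in> cl \<sigma> \<and> ((\<exists>v. q (t, x) v = 1) \<longrightarrow> \<sigma> \<in> \<R>)" if x: "x \<in> P" and t: "0 \<le> t" "t \<le> 1" for t x
  proof (rule cell_mem)
    fix v
    have "0 \<le> x v / mx x" "x v / mx x \<le> 1" using P[OF x] by (auto simp: divide_le_eq_1 order.strict_implies_order)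
    then have "0 \<le> (1 - t) * (x v / mx x)" "(1 - t) * (x v / mx x) \<le> 1"
      using t by (auto simp del: times_divide_eq_right intro!: mult_nonneg_nonneg mult_le_one)
    then show "0 \<le> q (t, x) v" "q (t, x) v \<le> 1" by (simp_all add: q_def)
  next
    have "supp (q (t, x)) \<subseteq> supp x" by (auto simp: supp_def q_def)
    then show "supp (q (t, x)) \<in> skeleton k K" using down P(2)[OF x] by blast
  qed
  have cq: "continuous_on ({0..1} \<times> P) q"
  proof -
    have c: "continuous_on ({0..1::real} \<times> P) (\<lambda>z. snd z v)" for v
      by (rule continuous_on_product_then_coordinatewise) (rule continuous_on_snd[OF continuous_on_id])
    have cm: "continuous_on ({0..1::real} \<times> P) (\<lambda>z. mx (snd z))"
      by (rule continuous_on_compose2[OF cmx[of UNIV] continuous_on_snd[OF continuous_on_id]]) auto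
    show ?thesis
      unfolding q_def
      by (intro continuous_on_coordinatewise_then_product continuous_on_mult continuous_on_divide c cm
            continuous_intros)
         (use P(4) in force)
  qed
  have "homotopic_with_canon (\<lambda>_. True) P X id (\<lambda>_. g' (\<lambda>_. 0))"
  proof (subst homotopic_with, simp, intro exI conjI ballI)
    have c: "continuous_on ({0..1} \<times> P) (g' \<circ> q)"
      by (rule continuous_on_comp[OF ext(1) cq]) (use q\<C> in fastforce)
    have "(g' \<circ> q) z \<in> X" if z: "z \<in> {0..1} \<times> P" for z
    proof -
      obtain t x where tx: "z = (t, x)" "x \<in> P" "0 \<le> t" "t \<le> 1" using z by auto
      then obtain \<sigma> where "\<sigma> \<in> \<C>" "q z \<in> cl \<sigma>" using q\<C> by blast
      then show ?thesis using ext(3) by auto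
    qed
    then show "continuous_map (prod_topology (top_of_set {0..1}) (top_of_set P)) (top_of_set X) (g' \<circ> q)"
      using c by auto
    fix x assume "x \<in> topspace (top_of_set P)"
    then have x: "x \<in> P" by simp
    obtain v where v: "v \<in> V" "x v = mx x" using mx_in by blast
    \<comment> \<open>At time 0 a coordinate equals 1, so the extension agrees with
      \<open>g\<close>, which restores the total mass 1 and returns \<open>x\<close>.\<close>
    have "\<exists>v. q (0, x) v = 1" using v P(4)[OF x] by (intro exI[of _ v]) (simp add: q_def)
    then have "g' (q (0, x)) = g (q (0, x))" using q\<C>[OF x, of 0] ext(2) by auto
    also have "\<dots> = x"
      using P(3,4)[OF x] by (simp add: g_def q_def fun_eq_iff flip: sum_divide_distrib)
    finally show "(g' \<circ> q) (0, x) = id x" by simp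
    have "q (1, x) = (\<lambda>_. 0)" by (simp add: q_def)
    then show "(g' \<circ> q) (1, x) = g' (\<lambda>_. 0)" by simp
  qed auto
  then show ?thesis unfolding P_def X_def by blast
qed

text \<open>For \<open>n = Suc k\<close> the skeleton reaches surjectivity up to degree
  \<open>k - 1 = n - 2\<close>. Its inclusion factors through a point up to homotopy, so it also
  vanishes on reduced homology.\<close>

lemma cconn_imp_hconn:
  assumes K: "simplicial V K" and n: "cconn n (realization V K)"
  shows "hconn n (realization V K)"
proof (cases n)
  case (Suc k)
  define X where "X = top_of_set (realization V K)"
  define P where "P = top_of_set (realization V (skeleton k K))"
  have "realization V K \<noteq> {}" using n Suc by (auto simp: cconn_def cube_ext_0)
  moreover have "trivial_group (reduced_homology_group i X)" if i: "i \<le> int n - 2" for i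
  proof -
    obtain c where c: "homotopic_with (\<lambda>_. True) P X id (\<lambda>_. c)"
      using skeleton_nullhomotopic[OF K] n Suc unfolding P_def X_def by blast
    let ?pt = "discrete_topology {()}"
    have surj: "hom_induced i P {} X {} id ` carrier (reduced_homology_group i P) = carrier (reduced_homology_group i X)"
      unfolding P_def X_def by (rule skeleton_reduced_homology_surj[OF K]) (use i Suc in simp)
    have "hom_induced i P {} X {} id z = \<one>\<^bsub>homology_group i X\<^esub>" if z: "z \<in> carrier (reduced_homology_group i P)" for z
    \<comment> \<open>For empty \<open>P\<close> the constant \<open>c\<close> need not be a point
      of \<open>X\<close>, so the factorisation through a point is only available otherwise.\<close>
    proof (cases "topspace P = {}")
      case True
      then have "z = \<one>\<^bsub>reduced_homology_group i P\<^esub>"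
        using z trivial_reduced_homology_group_empty by (auto simp: trivial_group_def)
      then show ?thesis
        using hom_one[OF hom_induced_empty_hom[of i P X id]]
        by (simp add: one_reduced_homology_group)
    next
      case False
      then have "c \<in> topspace X"
        using homotopic_with_imp_continuous_maps[OF c] by (auto simp: continuous_map_def)
      then have cont: "continuous_map P ?pt (\<lambda>_. ())" "continuous_map ?pt X (\<lambda>_. c)" by auto
      have "hom_induced i P {} X {} id = hom_induced i P {} X {} ((\<lambda>_. c) \<circ> (\<lambda>_. ()))"
        using homology_homotopy_empty[OF c, of i] by (simp add: comp_def)
      also have "\<dots> = hom_induced i ?pt {} X {} (\<lambda>_. c) \<circ> hom_induced i P {} ?pt {} (\<lambda>_. ())"
        by (rule hom_induced_compose_empty[OF cont])
      finally have "hom_induced i P {} X {} id z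
          = hom_induced i ?pt {} X {} (\<lambda>_. c) (hom_induced i P {} ?pt {} (\<lambda>_. ()) z)" by simp
      also have "hom_induced i P {} ?pt {} (\<lambda>_. ()) z = \<one>\<^bsub>homology_group i ?pt\<^esub>"
        using z by (simp add: carrier_reduced_homology_group kernel_def)
      also have "hom_induced i ?pt {} X {} (\<lambda>_. c) \<one>\<^bsub>homology_group i ?pt\<^esub> = \<one>\<^bsub>homology_group i X\<^esub>"
        by (intro hom_one hom_induced_empty_hom) auto
      finally show ?thesis .
    qed
    then have "carrier (reduced_homology_group i X) \<subseteq> {\<one>\<^bsub>reduced_homology_group i X\<^esub>}"
      unfolding surj[symmetric] one_reduced_homology_group by blast
    then show ?thesis by (auto simp: group.trivial_group_alt)
  qed
  ultimately show ?thesis by (simp add: hconn_def X_def)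
qed (simp add: hconn_def)

section \<open>The numerical connectivities\<close>

lemma cconn_mono: "\<lbrakk>cconn n Y; k \<le> n\<rbrakk> \<Longrightarrow> cconn k Y"
  by (auto simp: cconn_def)

lemma hconn_mono: "\<lbrakk>hconn n Y; k \<le> n\<rbrakk> \<Longrightarrow> hconn k Y"
  by (auto simp: hconn_def)

text \<open>Degrees 0 to \<open>k\<close> correspond to cubes of dimension 1 to
  \<open>k + 1\<close>; dimension 0 is nonemptiness. This accounts for \<open>k + 2\<close>.\<close>

lemma conn_top_of_set:
  assumes "Y \<noteq> {}"
  shows "conn (top_of_set Y) = Sup {ereal (real_of_int k) |k. - 1 \<le> k \<and> cconn (nat (k + 2)) Y}"
proof -
  have "(\<forall>i::nat. int i \<le> k \<longrightarrow> (\<forall>f. continuous_map (nsphere i) (top_of_set Y) f \<longrightarrow>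
           (\<exists>c. homotopic_with (\<lambda>_. True) (nsphere i) (top_of_set Y) f (\<lambda>_. c)))) \<longleftrightarrow>
        cconn (nat (k + 2)) Y" (is "?L \<longleftrightarrow> ?R") if k: "- 1 \<le> k" for k :: int
  proof -
    have "?L \<longleftrightarrow> (\<forall>i::nat. int i \<le> k \<longrightarrow> cube_ext (Suc i) Y)"
      unfolding cube_ext_Suc ..
    also have "\<dots> \<longleftrightarrow> ?R"
    proof
      assume l: "\<forall>i::nat. int i \<le> k \<longrightarrow> cube_ext (Suc i) Y"
      show ?R
        unfolding cconn_def
      proof (intro allI impI)
        fix d assume "d < nat (k + 2)"
        then show "cube_ext d Y" using l assms by (cases d) (auto simp: cube_ext_0)
      qed
    next
      assume ?R
      then show "\<forall>i::nat. int i \<le> k \<longrightarrow> cube_ext (Suc i) Y" by (auto simp: cconn_def)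
    qed
    finally show ?thesis .
  qed
  then have "{ereal (real_of_int k) | k. -1 \<le> k \<and>
        (\<forall>i::nat. int i \<le> k \<longrightarrow> (\<forall>f. continuous_map (nsphere i) (top_of_set Y) f \<longrightarrow>
           (\<exists>c. homotopic_with (\<lambda>_. True) (nsphere i) (top_of_set Y) f (\<lambda>_. c))))}
      = {ereal (real_of_int k) |k. - 1 \<le> k \<and> cconn (nat (k + 2)) Y}" by blast
  then show ?thesis using assms unfolding conn_def by simp
qed

lemma conn_eq_infinity:
  assumes "\<And>n. cconn n Y"
  shows "conn (top_of_set Y) + 2 = \<infinity>"
proof -
  have "Y \<noteq> {}" using assms[of 1] by (simp add: cconn_def cube_ext_0)
  have "ereal (real n) \<le> conn (top_of_set Y)" for n
    unfolding conn_top_of_set[OF \<open>Y \<noteq> {}\<close>] using assms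
    by (intro Sup_upper CollectI exI[of _ "int n"]) auto
  then have "conn (top_of_set Y) = \<infinity>"
    by (intro ereal_top) (meson ereal_less_eq(3) order_trans real_arch_simple)
  then show ?thesis by simp
qed

lemma conn_eq_nat:
  assumes "cconn p Y" "\<not> cconn (Suc p) Y"
  shows "conn (top_of_set Y) + 2 = ereal (real p)"
proof (cases "Y = {}")
  case True
  have "p = 0"
  proof (rule ccontr)
    assume "p \<noteq> 0"
    then show False using assms(1) True by (auto simp: cconn_def cube_ext_0)
  qed
  then show ?thesis using True by (simp add: conn_def)
next
  case False
  then have "p \<noteq> 0" using assms(2) by (auto simp: cconn_def cube_ext_0)
  have "conn (top_of_set Y) = ereal (real_of_int (int p - 2))"
    unfolding conn_top_of_set[OF False]
  proof (rule antisym)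
    show "Sup {ereal (real_of_int k) |k. - 1 \<le> k \<and> cconn (nat (k + 2)) Y} \<le> ereal (real_of_int (int p - 2))"
    proof (rule Sup_least)
      fix y assume "y \<in> {ereal (real_of_int k) |k. - 1 \<le> k \<and> cconn (nat (k + 2)) Y}"
      then obtain k where k: "y = ereal (real_of_int k)" "cconn (nat (k + 2)) Y" by auto
      have "nat (k + 2) \<le> p" using assms(2) cconn_mono[OF k(2), of "Suc p"] by (meson not_less_eq_eq)
      then have "k \<le> int p - 2" by linarith
      then show "y \<le> ereal (real_of_int (int p - 2))" unfolding k(1) ereal_less_eq(3) of_int_le_iff .
    qed
    show "ereal (real_of_int (int p - 2)) \<le> Sup {ereal (real_of_int k) |k. - 1 \<le> k \<and> cconn (nat (k + 2)) Y}"
      using assms(1) \<open>p \<noteq> 0\<close> by (intro Sup_upper CollectI exI[of _ "int p - 2"]) auto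
  qed
  then show ?thesis by simp
qed

lemma hconn_imp_conn_h: "hconn n Y \<Longrightarrow> ereal (real n) \<le> conn_h (top_of_set Y) + 2"
proof (cases "Y = {}")
  case True
  moreover assume "hconn n Y"
  ultimately show ?thesis by (simp add: hconn_def conn_h_def)
next
  case False
  assume n: "hconn n Y"
  have "trivial_group (reduced_homology_group i (top_of_set Y))" if "i \<le> int n - 2" for i
    using n that by (cases "n = 0") (auto simp: hconn_def intro: trivial_reduced_homology_group)
  then have "ereal (real_of_int (int n - 2)) \<le> conn_h (top_of_set Y)"
    unfolding conn_h_def using False by (auto intro!: Sup_upper exI[of _ "int n - 2"])
  then have "ereal (real_of_int (int n - 2)) + 2 \<le> conn_h (top_of_set Y) + 2"
    by (rule add_right_mono)
  then show ?thesis by simp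
qed

lemma conn_h_imp_hconn:
  assumes "ereal (real n) \<le> conn_h (top_of_set Y) + 2"
  shows "hconn n Y"
proof (cases "n = 0 \<or> Y = {}")
  case True
  then show ?thesis using assms by (auto simp: hconn_def conn_h_def)
next
  case False
  let ?S = "{ereal (real_of_int k) |k. \<forall>i::int. i \<le> k \<longrightarrow> trivial_group (reduced_homology_group i (top_of_set Y))}"
  have "ereal (real n) \<le> Sup ?S + 2" using assms False by (simp add: conn_h_def)
  \<comment> \<open>An integer above \<open>n - 3\<close> is at least \<open>n - 2\<close>, so a
    member of the set suffices and the supremum need not be attained.\<close>
  then have "ereal (real_of_int (int n - 3)) < Sup ?S" by (cases "Sup ?S") auto
  then obtain y where "y \<in> ?S" "ereal (real_of_int (int n - 3)) < y" unfolding less_Sup_iff by blast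
  then obtain k where k: "ereal (real_of_int (int n - 3)) < ereal (real_of_int k)"
      "\<And>i. i \<le> k \<Longrightarrow> trivial_group (reduced_homology_group i (top_of_set Y))" by blast
  have "int n - 3 < k" using k(1) by (simp only: less_ereal.simps of_int_less_iff)
  then show ?thesis using k(2) False by (simp add: hconn_def)
qed

section \<open>Deletion and contraction of an edge\<close>

lemma finite_edges: "hypergraph V E \<Longrightarrow> finite E"
  by (rule finite_subset[of E "Pow V"]) (auto simp: hypergraph_def)

lemma hypergraph_Diff: "hypergraph V E \<Longrightarrow> hypergraph V (E - D)"
  by (auto simp: hypergraph_def)

lemma simplicial_Ind: "finite V \<Longrightarrow> simplicial V (Ind V E)"
  unfolding simplicial_def Ind_def by blast

lemma empty_in_Ind: "hypergraph V E \<Longrightarrow> {} \<in> Ind V E"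
  by (auto simp: Ind_def hypergraph_def)

lemma minimal_subset:
  assumes "finite M" "T \<in> M"
  obtains T' where "T' \<in> M" "T' \<subseteq> T" "\<And>U. \<lbrakk>U \<in> M; U \<subseteq> T'\<rbrakk> \<Longrightarrow> U = T'"
  using finite_has_minimal2[OF assms] by (metis order_antisym)

text \<open>A neighbour \<open>v\<close> of \<open>F\<close> contributes the member
  \<open>{v}\<close>, so no minimal member of size at least 2 contains \<open>v\<close>; the new
  edges avoid the deleted vertices.\<close>

lemma hypergraph_colon:
  assumes E: "hypergraph V E" and F: "F \<in> E"
  shows "hypergraph (colon_V V E F) (colon_E E F)"
proof -
  have sub: "T \<subseteq> colon_V V E F" if T: "T \<in> colon_E E F" for T
  proof -
    obtain e where e: "e \<in> E - {F}" "T = e - F" and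
      min: "\<And>U. \<lbrakk>U \<in> (\<lambda>e. e - F) ` (E - {F}); U \<subseteq> T\<rbrakk> \<Longrightarrow> U = T" and "2 \<le> card T"
      using T by (auto simp: colon_E_def Let_def)
    have "v \<notin> nbhd E F" if "v \<in> T" for v
    proof
      assume "v \<in> nbhd E F"
      then obtain d where d: "d \<in> E" "v \<in> d - F" "card (d - F) = 1" by (auto simp: nbhd_def)
      then have "d - F = {v}" by (metis card_1_singletonE singletonD)
      moreover have "d \<noteq> F" using d(2) by auto
      ultimately have "{v} = T" using min[of "{v}"] d(1) that by (metis (no_types, lifting) DiffI empty_subsetI image_eqI insert_subset singletonD)
      then show False using \<open>2 \<le> card T\<close> by auto
    qed
    moreover have "T \<subseteq> V - F" using e E by (auto simp: hypergraph_def)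
    ultimately show ?thesis by (auto simp: colon_V_def)
  qed
  show ?thesis
    unfolding hypergraph_def
  proof (intro conjI ballI impI)
    show "finite (colon_V V E F)" using E by (simp add: hypergraph_def colon_V_def)
    show "e \<subseteq> colon_V V E F" if "e \<in> colon_E E F" for e using sub that .
    show "2 \<le> card e" if "e \<in> colon_E E F" for e using that by (simp add: colon_E_def Let_def)
    show "e1 = e2" if "e1 \<in> colon_E E F" "e2 \<in> colon_E E F" "e1 \<subseteq> e2" for e1 e2
      using that unfolding colon_E_def Let_def by blast
  qed
qed

lemma card_colon: "hypergraph V E \<Longrightarrow> card (colon_E E F) \<le> card (E - {F})"
proof -
  assume "hypergraph V E"
  then have "finite (E - {F})" by (simp add: finite_edges)
  moreover have "colon_E E F \<subseteq> (\<lambda>e. e - F) ` (E - {F})" by (auto simp: colon_E_def Let_def)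
  ultimately show ?thesis by (meson card_image_le card_mono finite_imageI order_trans)
qed

text \<open>The right side is the link of \<open>F\<close> in \<open>Ind(C - F)\<close>. Passing to
  minimal members does not change which sets are avoided, and avoiding a singleton member amounts to
  deleting its vertex.\<close>

lemma Ind_colon:
  assumes E: "hypergraph V E" and F: "F \<in> E"
  shows "Ind (colon_V V E F) (colon_E E F) = {S. S \<subseteq> V - F \<and> S \<union> F \<in> Ind V (E - {F})}"
proof -
  let ?M = "(\<lambda>e. e - F) ` (E - {F})"
  have fin: "finite ?M" using finite_edges[OF E] by simp
  have FV: "F \<subseteq> V" using E F by (auto simp: hypergraph_def)
  show ?thesis
  proof (rule equalityI; rule subsetI)
    fix S assume S: "S \<in> Ind (colon_V V E F) (colon_E E F)"
    have "\<not> e \<subseteq> S \<union> F" if e: "e \<in> E - {F}" for e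
    proof
      assume "e \<subseteq> S \<union> F"
      obtain T where T: "T \<in> ?M" "T \<subseteq> e - F" "\<And>U. \<lbrakk>U \<in> ?M; U \<subseteq> T\<rbrakk> \<Longrightarrow> U = T"
        using minimal_subset[OF fin, of "e - F"] e by blast
      have TS: "T \<subseteq> S" using T(2) \<open>e \<subseteq> S \<union> F\<close> by auto
      obtain d where d: "d \<in> E" "d \<noteq> F" "T = d - F" using T(1) by auto
      \<comment> \<open>Edges are incomparable, so \<open>d\<close> is not contained in
        \<open>F\<close>.\<close>
      have "T \<noteq> {}" using d E F by (auto simp: hypergraph_def)
      moreover have "finite T" using d(1,3) E by (auto simp: hypergraph_def intro: finite_subset)
      ultimately have "card T \<noteq> 0" by simp
      moreover have "card T \<noteq> 1"
      proof
        assume "card T = 1"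
        then have "T \<subseteq> nbhd E F" using d unfolding nbhd_def by blast
        then show False using TS S \<open>T \<noteq> {}\<close> by (auto simp: Ind_def colon_V_def)
      qed
      ultimately have "2 \<le> card T" by linarith
      then have "T \<in> colon_E E F" using T(1,3) by (auto simp: colon_E_def Let_def)
      then show False using S TS by (auto simp: Ind_def)
    qed
    moreover have "S \<subseteq> V - F" using S by (auto simp: Ind_def colon_V_def)
    ultimately show "S \<in> {S. S \<subseteq> V - F \<and> S \<union> F \<in> Ind V (E - {F})}"
      using FV by (auto simp: Ind_def)
  next
    fix S assume "S \<in> {S. S \<subseteq> V - F \<and> S \<union> F \<in> Ind V (E - {F})}"
    then have S: "S \<subseteq> V - F" "\<And>e. e \<in> E - {F} \<Longrightarrow> \<not> e \<subseteq> S \<union> F" by (auto simp: Ind_def)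
    have "v \<notin> nbhd E F" if v: "v \<in> S" for v
    proof
      assume "v \<in> nbhd E F"
      then obtain e where e: "e \<in> E" "v \<in> e - F" "card (e - F) = 1" by (auto simp: nbhd_def)
      then have "e - F = {v}" by (metis card_1_singletonE singletonD)
      then have "e \<subseteq> S \<union> F" using v by auto
      moreover have "e \<in> E - {F}" using e by auto
      ultimately show False using S(2) by blast
    qed
    moreover have "\<not> T \<subseteq> S" if T: "T \<in> colon_E E F" for T
    proof
      assume "T \<subseteq> S"
      obtain e where "e \<in> E - {F}" "T = e - F" using T by (auto simp: colon_E_def Let_def)
      then show False using S(2)[of e] \<open>T \<subseteq> S\<close> by auto
    qed
    ultimately show "S \<in> Ind (colon_V V E F) (colon_E E F)"
      using S(1) by (auto simp: Ind_def colon_V_def)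
  qed
qed

lemma realization_restrict_vertices:
  assumes "finite V" "W \<subseteq> V" "L \<subseteq> Pow W"
  shows "realization W L = realization V L"
proof -
  have "(\<forall>v. v \<notin> W \<longrightarrow> x v = 0) \<and> (\<Sum>v\<in>W. x v) = 1 \<longleftrightarrow> (\<forall>v. v \<notin> V \<longrightarrow> x v = 0) \<and> (\<Sum>v\<in>V. x v) = 1"
    if "{v. x v \<noteq> 0} \<in> L" for x :: "'a \<Rightarrow> real"
  proof -
    have "x v = 0" if "v \<notin> W" for v using \<open>{v. x v \<noteq> 0} \<in> L\<close> that assms(3) by blast
    moreover from this have "(\<Sum>v\<in>W. x v) = (\<Sum>v\<in>V. x v)"
      using assms by (intro sum.mono_neutral_left) auto
    ultimately show ?thesis using assms(2) by auto
  qed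
  then show ?thesis unfolding realization_def by blast
qed

text \<open>The edge \<open>F\<close> is a face of \<open>Ind(C - F)\<close> but not of
  \<open>Ind(C)\<close>, so the cover at a face is used in the larger complex, with
  \<open>Ind(C)\<close> as the deletion.\<close>

locale hyperedge =
  fixes V :: "'a set" and E F
  assumes E: "hypergraph V E" and F: "F \<in> E"
begin

abbreviation "L \<equiv> Ind (colon_V V E F) (colon_E E F)"

sublocale face_star V "Ind V (E - {F})" F
proof
  show "simplicial V (Ind V (E - {F}))" using E by (simp add: simplicial_Ind hypergraph_def)
  show "F \<in> Ind V (E - {F})" using E F by (auto simp: Ind_def hypergraph_def)
  show "F \<noteq> {}" using E F by (auto simp: hypergraph_def)
qed

lemma del_eq: "del = Ind V E"
  unfolding del_def using F by (auto simp: Ind_def)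

lemma L_sub: "L \<subseteq> Pow (V - F)"
  using Ind_colon[OF E F] by auto

lemma rim_eq: "rim = bd_join V F L"
proof (rule equalityI; rule subsetI)
  fix S assume "S \<in> rim"
  then have S: "S \<in> Ind V (E - {F})" "\<not> F \<subseteq> S" "S \<union> F \<in> Ind V (E - {F})" by (auto simp: rim_def)
  then have "S \<subseteq> V" "S - F \<in> L" unfolding Ind_colon[OF E F] by (auto simp: Ind_def)
  then show "S \<in> bd_join V F L" using S(2) by (simp add: bd_join_def)
next
  fix S assume S: "S \<in> bd_join V F L"
  then have "S \<union> F \<in> Ind V (E - {F})" by (simp add: bd_join_def Ind_colon[OF E F])
  moreover from this have "S \<in> Ind V (E - {F})" by (auto simp: Ind_def)
  ultimately show "S \<in> rim" using S by (simp add: rim_def bd_join_def)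
qed

lemma realization_L: "realization (colon_V V E F) L = realization V L"
  using finV by (intro realization_restrict_vertices) (auto simp: colon_V_def Ind_def)

lemma simplicial_L: "simplicial V L"
proof -
  have "simplicial (colon_V V E F) L" using finV by (intro simplicial_Ind) (simp add: colon_V_def)
  then show ?thesis using L_sub finV by (auto simp: simplicial_def)
qed

lemma empty_in_L: "{} \<in> L"
  by (rule empty_in_Ind[OF hypergraph_colon[OF E F]])

text \<open>Truncated subtraction voids the second condition once \<open>card F > n\<close>; the
  boundary of \<open>F\<close> alone then makes the rim connected enough. In all cases
  \<open>Suc n - card F + card F - 1 \<ge> n\<close>.\<close>

lemma cconn_delete_contract:
  assumes "cconn n (realization V (Ind V (E - {F})))"
    and "cconn (Suc n - card F) (realization (colon_V V E F) L)"
  shows "cconn n (realization V (Ind V E))"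
  unfolding del_eq[symmetric]
proof (rule cconn_remove_face[OF assms(1)])
  have "cconn (Suc n - card F + card F - 1) (realization V rim)"
    unfolding rim_eq
    by (rule cconn_bd_join[OF F_ne FV simplicial_L L_sub empty_in_L]) (use assms(2) realization_L in simp)
  then show "cconn n (realization V rim)" by (rule cconn_mono) simp
qed

lemma hconn_delete:
  assumes "hconn n (realization V (Ind V E))"
    and "hconn (Suc n - card F) (realization (colon_V V E F) L)"
  shows "hconn n (realization V (Ind V (E - {F})))"
proof (rule hconn_add_face)
  show "hconn n (realization V del)" using assms(1) by (simp add: del_eq)
  have "hconn (Suc n - card F + card F - 1) (realization V rim)"
    unfolding rim_eq
    by (rule hconn_bd_join[OF F_ne FV simplicial_L L_sub empty_in_L]) (use assms(2) realization_L in simp)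
  then show "hconn (n - 1) (realization V rim)" by (rule hconn_mono) simp
qed

end

section \<open>The recursion for the invariant\<close>

text \<open>Nonnegativity justifies truncated subtraction in the recursion. Integrality lets the
  thresholds \<open>p\<close> and \<open>Suc p\<close> pin down the final value.\<close>

definition enat_valued :: "ereal \<Rightarrow> bool" where
  "enat_valued y \<longleftrightarrow> y = \<infinity> \<or> (\<exists>k::nat. y = ereal (real k))"

lemma enat_valued_shift_le_iff:
  assumes "enat_valued y"
  shows "ereal (real m) \<le> y + ereal (real c) - 1 \<longleftrightarrow> ereal (real (Suc m - c)) \<le> y"
proof (cases "y = \<infinity>")
  case False
  then obtain k :: nat where "y = ereal (real k)" using assms by (auto simp: enat_valued_def)
  then show ?thesis by (simp add: one_ereal_def) linarith
qed simp

lemma psi_fuel_enat_valued: "hypergraph V E \<Longrightarrow> enat_valued (psi_fuel n V E)"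
proof (induction n arbitrary: V E)
  case 0
  show ?case by (auto simp: enat_valued_def intro: exI[of _ "0::nat"])
next
  case (Suc n)
  show ?case
  proof (cases "V = {} \<or> E = {}")
    case True
    then show ?thesis by (auto simp: enat_valued_def intro: exI[of _ "0::nat"])
  next
    case False
    let ?h = "\<lambda>F. min (psi_fuel n V (E - {F})) (psi_fuel n (colon_V V E F) (colon_E E F) + ereal (real (card F)) - 1)"
    have "Max (?h ` E) \<in> ?h ` E" using finite_edges[OF Suc.prems] False by (intro Max_in) auto
    then obtain F where F: "F \<in> E" "Max (?h ` E) = ?h F" by auto
    have 1: "enat_valued (psi_fuel n V (E - {F}))"
      using Suc.IH hypergraph_Diff[OF Suc.prems] by blast
    have "enat_valued (psi_fuel n (colon_V V E F) (colon_E E F))"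
      using Suc.IH hypergraph_colon[OF Suc.prems F(1)] by blast
    moreover have "2 \<le> card F" using F(1) Suc.prems by (auto simp: hypergraph_def)
    ultimately have "enat_valued (psi_fuel n (colon_V V E F) (colon_E E F) + ereal (real (card F)) - 1)"
      unfolding enat_valued_def
    proof (elim disjE exE)
      fix k :: nat assume "psi_fuel n (colon_V V E F) (colon_E E F) = ereal (real k)"
      then have "psi_fuel n (colon_V V E F) (colon_E E F) + ereal (real (card F)) - 1 = ereal (real (k + card F - 1))"
        using \<open>2 \<le> card F\<close> by (simp add: one_ereal_def of_nat_diff)
      then show "psi_fuel n (colon_V V E F) (colon_E E F) + ereal (real (card F)) - 1 = \<infinity> \<or>
          (\<exists>k::nat. psi_fuel n (colon_V V E F) (colon_E E F) + ereal (real (card F)) - 1 = ereal (real k))"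
        by blast
    qed simp
    with 1 show ?thesis using False F(2) by (simp add: min_def)
  qed
qed

lemma le_psi_fuel_iff:
  assumes E: "hypergraph V E" and "E \<noteq> {}"
  shows "ereal (real m) \<le> psi_fuel (Suc n) V E \<longleftrightarrow>
    (\<exists>F\<in>E. ereal (real m) \<le> psi_fuel n V (E - {F}) \<and>
            ereal (real (Suc m - card F)) \<le> psi_fuel n (colon_V V E F) (colon_E E F))"
proof -
  have "V \<noteq> {}" using assms by (auto simp: hypergraph_def)
  then have "ereal (real m) \<le> psi_fuel (Suc n) V E \<longleftrightarrow>
    (\<exists>F\<in>E. ereal (real m) \<le> psi_fuel n V (E - {F}) \<and>
            ereal (real m) \<le> psi_fuel n (colon_V V E F) (colon_E E F) + ereal (real (card F)) - 1)"
    using \<open>E \<noteq> {}\<close> finite_edges[OF E] by (simp add: Max_ge_iff)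
  also have "\<dots> \<longleftrightarrow> (\<exists>F\<in>E. ereal (real m) \<le> psi_fuel n V (E - {F}) \<and>
            ereal (real (Suc m - card F)) \<le> psi_fuel n (colon_V V E F) (colon_E E F))"
    using enat_valued_shift_le_iff[OF psi_fuel_enat_valued[OF hypergraph_colon[OF E]]] by simp
  finally show ?thesis .
qed

text \<open>Deletion and contraction both have fewer edges than \<open>E\<close>, so
  \<open>card E < n\<close> is inherited by the recursive calls. Without edges the complex is a full
  simplex, which is contractible, or empty with \<open>m = 0\<close>.\<close>

lemma psi_fuel_le_cconn:
  assumes "hypergraph V E" "card E < n" "ereal (real m) \<le> psi_fuel n V E"
  shows "cconn m (realization V (Ind V E))"
  using assms
proof (induction n arbitrary: V E m)
  case (Suc n)
  show ?case
  proof (cases "E = {}")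
    case True
    show ?thesis
    proof (cases "V = {}")
      case True
      then show ?thesis using Suc.prems(3) by (simp add: cconn_def)
    next
      case False
      then obtain w where "w \<in> V" by blast
      then have "contractible_space (top_of_set (realization V (Ind V E)))" "realization V (Ind V E) \<noteq> {}"
        using contractible_cone[of V "Ind V E" w] Suc.prems(1) True
        by (auto simp: Ind_def hypergraph_def simplicial_Pow Pow_def[symmetric] simp del: contractible_space_top_of_set)
      then show ?thesis unfolding cconn_def by (intro allI impI cube_ext_contractible)
    qed
  next
    case False
    then obtain F where edge: "F \<in> E" "ereal (real m) \<le> psi_fuel n V (E - {F})"
        "ereal (real (Suc m - card F)) \<le> psi_fuel n (colon_V V E F) (colon_E E F)"
      using Suc.prems(3) le_psi_fuel_iff[OF Suc.prems(1)] by blast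
    interpret hyperedge V E F by standard (fact Suc.prems(1) edge(1))+
    have "card (E - {F}) < n"
      using Suc.prems(2) card_Suc_Diff1[OF finite_edges[OF E] F] by linarith
    then show ?thesis
      using Suc.IH[OF hypergraph_Diff[OF E] _ edge(2)]
        Suc.IH[OF hypergraph_colon[OF E F] _ edge(3)] card_colon[OF E, of F]
      by (intro cconn_delete_contract) auto
  qed
qed simp

text \<open>Induction along the splitting: the splitting edge itself witnesses the maximum, and its
  homological condition transfers the bound to the contraction.\<close>

lemma hconn_le_psi_fuel:
  assumes "properly_splitted V E" "hypergraph V E" "card E < n" "hconn m (realization V (Ind V E))"
  shows "ereal (real m) \<le> psi_fuel n V E"
  using assms
proof (induction arbitrary: n m rule: properly_splitted.induct)
  case (ps_empty V)
  obtain n' where n: "n = Suc n'" using ps_empty.prems(2) by (cases n) simp_all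
  show ?case
  proof (cases "V = {}")
    case True
    then have "realization V (Ind V {}) = {}" by (auto simp: realization_def)
    then show ?thesis using ps_empty.prems(3) n by (auto simp: hconn_def)
  qed (simp add: n)
next
  case (ps_split F E V)
  obtain n' where n: "n = Suc n'" using ps_split.prems(2) by (cases n) simp_all
  interpret hyperedge V E F by standard (fact ps_split.prems(1) ps_split.hyps(1))+
  have card: "card (E - {F}) < n'"
    using ps_split.prems(2) n card_Suc_Diff1[OF finite_edges[OF E] F] by linarith
  let ?Y = "realization V (Ind V E)" and ?Z = "realization (colon_V V E F) L"
  have "ereal (real m) \<le> conn_h (top_of_set ?Y) + 2"
    by (rule hconn_imp_conn_h[OF ps_split.prems(3)])
  moreover have "conn_h (top_of_set ?Y) - ereal (real (card F)) + 1 \<le> conn_h (top_of_set ?Z)"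
    using ps_split.hyps(2) by (simp add: geom_eq)
  \<comment> \<open>The left side may be negative and the connectivities infinite, so the shift is
    made in extended reals before returning to natural numbers.\<close>
  ultimately have "ereal (real m + 1 - real (card F)) \<le> conn_h (top_of_set ?Z) + 2"
    by (cases "conn_h (top_of_set ?Y)"; cases "conn_h (top_of_set ?Z)") (auto simp: one_ereal_def)
  then have Z: "hconn (Suc m - card F) ?Z"
  proof (cases "Suc m \<le> card F")
    case False
    then have "real m + 1 - real (card F) = real (Suc m - card F)" by (simp add: of_nat_diff)
    then show ?thesis
      using \<open>ereal (real m + 1 - real (card F)) \<le> conn_h (top_of_set ?Z) + 2\<close> by (intro conn_h_imp_hconn) simp
  qed (simp add: hconn_def)
  have "ereal (real m) \<le> psi_fuel n' V (E - {F})"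
    using ps_split.IH(1)[OF hypergraph_Diff[OF E] card hconn_delete[OF ps_split.prems(3) Z]] .
  moreover have "ereal (real (Suc m - card F)) \<le> psi_fuel n' (colon_V V E F) (colon_E E F)"
    using ps_split.IH(2)[OF hypergraph_colon[OF E F] _ Z] card card_colon[OF E, of F] by simp
  ultimately show ?case
    unfolding n using F by (subst le_psi_fuel_iff[OF E]) auto
qed

theorem theorem3p16:
  fixes V :: "'a set" and E :: "'a set set"
  assumes "hypergraph V E"
    and "properly_splitted V E"
  shows "psi V E = conn (geom V (Ind V E)) + 2"
proof -
  let ?Y = "realization V (Ind V E)"
  have Ind: "simplicial V (Ind V E)"
    using assms(1) by (simp add: simplicial_Ind hypergraph_def)
  \<comment> \<open>The circle closes: a bound on \<open>psi\<close> gives homotopical connectivity,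
    then homological connectivity, then the bound on \<open>psi\<close> again.\<close>
  have iff: "ereal (real m) \<le> psi V E \<longleftrightarrow> cconn m ?Y" for m
    unfolding psi_def
    using psi_fuel_le_cconn[OF assms(1)] hconn_le_psi_fuel[OF assms(2,1)] cconn_imp_hconn[OF Ind]
    by blast
  have "enat_valued (psi V E)"
    unfolding psi_def by (rule psi_fuel_enat_valued[OF assms(1)])
  then consider "psi V E = \<infinity>" | p :: nat where "psi V E = ereal (real p)"
    unfolding enat_valued_def by blast
  then show ?thesis
  proof cases
    case 1
    then have "cconn m ?Y" for m using iff[of m] by simp
    then show ?thesis using conn_eq_infinity[of ?Y] 1 by (simp only: geom_eq)
  next
    case (2 p)
    then have "cconn p ?Y" "\<not> cconn (Suc p) ?Y" using iff[of p] iff[of "Suc p"] by auto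
    from conn_eq_nat[OF this] show ?thesis using 2 by (simp only: geom_eq)
  qed
qed

end
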